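(* For all $P_1,P_2,N>0$, $$\mathrm{cl}\Big(\bigcup_{\sigma^2>0}\ \bigcap_{\mathsf K}\mathcal C_{\mathrm{NoisyFB}}(P_1,P_2,N,\mathsf K)\Big)=\mathcal C_{\mathrm{PerfectFB}}(P_1,P_2,N),$$ where the intersection is over all $2\times2$ positive semidefinite $\mathsf K$ whose diagonal entries are at most $\sigma^2$.
   Context: Channel model (noisy feedback). Fix $P_1,P_2,N>0$ and a $2\times 2$ positive semidefinite matrix $\mathsf{K}_W=\begin{pmatrix}\sigma_1^2&\varrho\sigma_1\sigma_2\\ \varrho\sigma_1\sigma_2&\sigma_2^2\end{pmatrix}$ with $\sigma_1,\sigma_2\ge 0$, $\varrho\in[-1,1]$. Messages $M_1,M_2$ are independent and uniform on finite sets $\mathcal{M}_1,\mathcal{M}_2$. $\{Z_t\}$ is IID $\mathcal{N}(0,N)$, $\{(W_{1,t},W_{2,t})\}$ is IID zero-mean bivariate Gaussian with covariance $\mathsf{K}_W$, and $M_1,M_2,\{Z_t\},\{(W_{1,t},W_{2,t})\}$ are mutually independent. The output is $Y_t=X_{1,t}+X_{2,t}+Z_t$ and Transmitter $\nu\in\{1,2\}$ observes causally the feedback $V_{\nu,t}=Y_t+W_{\nu,t}$. A blocklength-$n$ code consists of encoders $X_{\nu,t}=\varphi_{\nu,t}(M_\nu,V_{\nu,1},\dots,V_{\nu,t-1})$, $t=1,\dots,n$, satisfying $\frac1n\sum_{t=1}^n\mathbb{E}[X_{\nu,t}^2]\le P_\nu$ ($\nu=1,2$), and a decoder $\phi:\mathbb{R}^n\to\mathcal{M}_1\times\mathcal{M}_2$.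 A pair $(R_1,R_2)$ is achievable if for every $\delta>0$ and all sufficiently large $n$ there is such a code with $\frac1n\log|\mathcal{M}_\nu|>R_\nu-\delta$ ($\nu=1,2$), and the error probabilities $\Pr[\phi(Y_1,\dots,Y_n)\ne(M_1,M_2)]$ tend to $0$ as $n\to\infty$. $\mathcal{C}_{\mathrm{NoisyFB}}(P_1,P_2,N,\mathsf{K}_W)$ is the set of achievable pairs, and $\mathcal C_{\mathrm{PerfectFB}}(P_1,P_2,N)=\mathcal C_{\mathrm{NoisyFB}}(P_1,P_2,N,\mathbf 0)$ with $\mathbf 0$ the $2\times 2$ zero matrix (noise-free feedback). $\mathrm{cl}$ denotes closure. *)

theory Defs
  imports "HOL-Probability.Probability"
begin

text \<open>Two-user Gaussian multiple-access channel with noisy feedback.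
  Time indices are 0-based: t = 0, ..., n-1.
  Randomness of blocklength n: IID standard normals omega(t,k), t < n, k < 3.
  Z_t = sqrt N * omega(t,0); the feedback noise pair (W_1t, W_2t) is obtained
  from (omega(t,1), omega(t,2)) by the Cholesky factor of K, hence is a zero-mean
  bivariate Gaussian with covariance K (also when K is singular).\<close>

definition psd2 :: "real^2^2 \<Rightarrow> bool" where
  "psd2 K \<longleftrightarrow> transpose K = K \<and> (\<forall>x. 0 \<le> x \<bullet> (K *v x))"

definition noise_space :: "nat \<Rightarrow> (nat \<times> nat \<Rightarrow> real) measure" where
  "noise_space n = PiM ({..<n} \<times> {..<3}) (\<lambda>_. density lborel std_normal_density)"

definition Zn :: "real \<Rightarrow> (nat \<times> nat \<Rightarrow> real) \<Rightarrow> nat \<Rightarrow> real" where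
  "Zn N \<omega> t = sqrt N * \<omega> (t, 0)"

definition W1n :: "real^2^2 \<Rightarrow> (nat \<times> nat \<Rightarrow> real) \<Rightarrow> nat \<Rightarrow> real" where
  "W1n K \<omega> t = sqrt (K$1$1) * \<omega> (t, 1)"

definition W2n :: "real^2^2 \<Rightarrow> (nat \<times> nat \<Rightarrow> real) \<Rightarrow> nat \<Rightarrow> real" where
  "W2n K \<omega> t = (if K$1$1 = 0 then sqrt (K$2$2) * \<omega> (t, 2)
     else (K$1$2 / sqrt (K$1$1)) * \<omega> (t, 1) + sqrt (K$2$2 - (K$1$2)\<^sup>2 / K$1$1) * \<omega> (t, 2))"

text \<open>Past feedback V_{1..t-1} seen at time t, given the outputs so far (list ys)
  and the feedback noise w, as an element of the space of PiM {..<t}.\<close>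
definition past :: "real list \<Rightarrow> (nat \<Rightarrow> real) \<Rightarrow> nat \<Rightarrow> (nat \<Rightarrow> real)" where
  "past ys w t = restrict (\<lambda>s. ys ! s + w s) {..<t}"

text \<open>Encoders: phi t m v is the channel input at time t for message m and
  past feedback v (a function on {..<t}).  out_seq computes Y_0..Y_{t-1}.\<close>
primrec out_seq ::
  "(nat \<Rightarrow> nat \<Rightarrow> (nat \<Rightarrow> real) \<Rightarrow> real) \<Rightarrow> (nat \<Rightarrow> nat \<Rightarrow> (nat \<Rightarrow> real) \<Rightarrow> real)
   \<Rightarrow> real \<Rightarrow> real^2^2 \<Rightarrow> nat \<Rightarrow> nat \<Rightarrow> (nat \<times> nat \<Rightarrow> real) \<Rightarrow> nat \<Rightarrow> real list" where
  "out_seq phi1 phi2 N K a b \<omega> 0 = []"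
| "out_seq phi1 phi2 N K a b \<omega> (Suc t) =
     (let ys = out_seq phi1 phi2 N K a b \<omega> t in
      ys @ [phi1 t a (past ys (W1n K \<omega>) t) + phi2 t b (past ys (W2n K \<omega>) t) + Zn N \<omega> t])"

definition X1 where
  "X1 phi1 phi2 N K a b \<omega> t = phi1 t a (past (out_seq phi1 phi2 N K a b \<omega> t) (W1n K \<omega>) t)"
definition X2 where
  "X2 phi1 phi2 N K a b \<omega> t = phi2 t b (past (out_seq phi1 phi2 N K a b \<omega> t) (W2n K \<omega>) t)"

text \<open>A blocklength-n code with message sets {..<m1}, {..<m2} (measurable encoders
  and decoder) satisfying the average power constraints.  Expectations are over
  uniform independent messages and the noise.\<close>
definition is_code ::
  "real \<Rightarrow> real \<Rightarrow> real \<Rightarrow> real^2^2 \<Rightarrow> nat \<Rightarrow> nat \<Rightarrow> nat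
   \<Rightarrow> (nat \<Rightarrow> nat \<Rightarrow> (nat \<Rightarrow> real) \<Rightarrow> real) \<Rightarrow> (nat \<Rightarrow> nat \<Rightarrow> (nat \<Rightarrow> real) \<Rightarrow> real)
   \<Rightarrow> ((nat \<Rightarrow> real) \<Rightarrow> nat \<times> nat) \<Rightarrow> bool" where
  "is_code P1 P2 N K n m1 m2 phi1 phi2 dec \<longleftrightarrow>
     0 < m1 \<and> 0 < m2 \<and>
     (\<forall>t<n. \<forall>m. phi1 t m \<in> borel_measurable (PiM {..<t} (\<lambda>_. borel))) \<and>
     (\<forall>t<n. \<forall>m. phi2 t m \<in> borel_measurable (PiM {..<t} (\<lambda>_. borel))) \<and>
     dec \<in> measurable (PiM {..<n} (\<lambda>_. borel)) (count_space UNIV) \<and>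
     (\<Sum>t<n. \<Sum>a<m1. \<Sum>b<m2. \<integral>\<^sup>+ \<omega>. ennreal ((X1 phi1 phi2 N K a b \<omega> t)\<^sup>2) \<partial>noise_space n)
        \<le> ennreal (real n * real m1 * real m2 * P1) \<and>
     (\<Sum>t<n. \<Sum>a<m1. \<Sum>b<m2. \<integral>\<^sup>+ \<omega>. ennreal ((X2 phi1 phi2 N K a b \<omega> t)\<^sup>2) \<partial>noise_space n)
        \<le> ennreal (real n * real m1 * real m2 * P2)"

definition err_prob ::
  "real \<Rightarrow> real^2^2 \<Rightarrow> nat \<Rightarrow> nat \<Rightarrow> nat
   \<Rightarrow> (nat \<Rightarrow> nat \<Rightarrow> (nat \<Rightarrow> real) \<Rightarrow> real) \<Rightarrow> (nat \<Rightarrow> nat \<Rightarrow> (nat \<Rightarrow> real) \<Rightarrow> real)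
   \<Rightarrow> ((nat \<Rightarrow> real) \<Rightarrow> nat \<times> nat) \<Rightarrow> real" where
  "err_prob N K n m1 m2 phi1 phi2 dec =
     (\<Sum>a<m1. \<Sum>b<m2. measure (noise_space n)
        {\<omega> \<in> space (noise_space n).
           dec (restrict (\<lambda>t. out_seq phi1 phi2 N K a b \<omega> n ! t) {..<n}) \<noteq> (a, b)})
     / (real m1 * real m2)"

definition achievable :: "real \<Rightarrow> real \<Rightarrow> real \<Rightarrow> real^2^2 \<Rightarrow> real \<times> real \<Rightarrow> bool" where
  "achievable P1 P2 N K R \<longleftrightarrow>
     (\<forall>\<delta>>0. \<exists>m1 m2 phi1 phi2 dec.
        (\<forall>\<^sub>F n in sequentially.
           is_code P1 P2 N K n (m1 n) (m2 n) (phi1 n) (phi2 n) (dec n) \<and>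
           ln (real (m1 n)) / real n > fst R - \<delta> \<and>
           ln (real (m2 n)) / real n > snd R - \<delta>) \<and>
        (\<lambda>n. err_prob N K n (m1 n) (m2 n) (phi1 n) (phi2 n) (dec n)) \<longlonglongrightarrow> 0)"

definition C_NoisyFB :: "real \<Rightarrow> real \<Rightarrow> real \<Rightarrow> real^2^2 \<Rightarrow> (real \<times> real) set" where
  "C_NoisyFB P1 P2 N K = {R. achievable P1 P2 N K R}"

definition C_PerfectFB :: "real \<Rightarrow> real \<Rightarrow> real \<Rightarrow> (real \<times> real) set" where
  "C_PerfectFB P1 P2 N = C_NoisyFB P1 P2 N 0"

end

theory Submission
  imports Defs
begin

text \<open>No capacity formula is needed. Take a code of some blocklength \<open>n0\<close> for perfect feedback with
  small error probability. Its encoders are merely measurable, but working backwards in time they can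
  be replaced by bounded continuous ones (and the decoder by a continuous statistic) at an arbitrarily
  small cost in power and error. For continuous encoders the channel trajectories depend continuously
  on the feedback noise, so by dominated convergence the new code is nearly as good for every small
  enough noise covariance. This gives a noisy but memoryless channel with inputs the message pairs of
  the inner code, and the remaining errors are corrected by an outer code for each user: a
  Gilbert--Varshamov code with minimum distance proportional to its length. Translating the two outer
  codes at random makes each pair of codewords uniform, so the expected number of wrong blocks is that
  of the inner code under uniform messages; closing the outer codes under constant shifts makes the
  power average exact. A few silent slots compensate the excess power.\<close>

section \<open>Channel recursion and closedness of the achievable region\<close>

text \<open>One inclusion is soft: \<open>K = 0\<close> takes part in every intersection, and the
  region for perfect feedback is closed. The obstacle on the other side is uniformity. With
  noise-free feedback an encoder may react to arbitrarily fine digits of its observation, so a good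
  code can collapse under any positive noise. Even for continuous encoders the tolerable noise may
  shrink as the blocklength grows, whereas one noise level must serve all blocklengths and all
  admissible covariances. Hence robustness is secured at a single blocklength \<open>n0\<close>
  only, with a threshold independent of \<open>K\<close>, and long codes repeat this one inner code
  in independent blocks. Its error probability is small but fixed, and driving it to 0 is the task
  of the outer codes. These may depend on \<open>K\<close>, since the intersection asks for
  achievability under each \<open>K\<close> separately. Counting arguments for the outer codes lose
  factors \<open>2 ^ L\<close>, where \<open>L\<close> is the number of blocks; they are affordable
  because a block has length \<open>n0\<close>, so that the loss in rate is at most
  \<open>ln 2 / n0\<close>.\<close>

lemma closed_C_NoisyFB: "closed (C_NoisyFB P1 P2 N K)"
proof -
  have "R \<in> C_NoisyFB P1 P2 N K" if R: "R \<in> closure (C_NoisyFB P1 P2 N K)" for R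
    unfolding C_NoisyFB_def mem_Collect_eq achievable_def
  proof (intro allI impI)
    fix \<delta> :: real assume \<delta>: "\<delta> > 0"
    \<comment> \<open>Achievability itself has a slack: half of \<delta> pays for moving from
      \<open>R\<close> to \<open>S\<close>, and the other half is used as the slack of
      \<open>S\<close>.\<close>
    then obtain S where S: "S \<in> C_NoisyFB P1 P2 N K" "dist S R < \<delta> / 2"
      using R unfolding closure_approachable by (meson half_gt_zero)
    have d: "\<bar>fst S - fst R\<bar> < \<delta> / 2" "\<bar>snd S - snd R\<bar> < \<delta> / 2"
      using S(2) dist_fst_le[of S R] dist_snd_le[of S R] by (auto simp: dist_real_def)
    have "\<delta> / 2 > 0" using \<delta> by simp
    with S(1) obtain m1 m2 phi1 phi2 dec where
      ev: "\<forall>\<^sub>F n in sequentially.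
           is_code P1 P2 N K n (m1 n) (m2 n) (phi1 n) (phi2 n) (dec n) \<and>
           ln (real (m1 n)) / real n > fst S - \<delta> / 2 \<and>
           ln (real (m2 n)) / real n > snd S - \<delta> / 2"
      and lim: "(\<lambda>n. err_prob N K n (m1 n) (m2 n) (phi1 n) (phi2 n) (dec n)) \<longlonglongrightarrow> 0"
      unfolding C_NoisyFB_def achievable_def by blast
    show "\<exists>m1 m2 phi1 phi2 dec.
        (\<forall>\<^sub>F n in sequentially.
           is_code P1 P2 N K n (m1 n) (m2 n) (phi1 n) (phi2 n) (dec n) \<and>
           ln (real (m1 n)) / real n > fst R - \<delta> \<and>
           ln (real (m2 n)) / real n > snd R - \<delta>) \<and>
        (\<lambda>n. err_prob N K n (m1 n) (m2 n) (phi1 n) (phi2 n) (dec n)) \<longlonglongrightarrow> 0"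
      by (rule exI[of _ m1], rule exI[of _ m2], rule exI[of _ phi1], rule exI[of _ phi2],
          rule exI[of _ dec], intro conjI lim, rule eventually_mono[OF ev])
        (use d in linarith)
  qed
  then show ?thesis
    using closure_subset_eq by blast
qed

section \<open>Outputs as functions of time, measurability and causality\<close>

type_synonym encoder = "nat \<Rightarrow> nat \<Rightarrow> (nat \<Rightarrow> real) \<Rightarrow> real"

text \<open>Replaces the list-valued recursion \<open>out_seq\<close>: by \<open>X1_eq\<close> and
  \<open>X2_eq\<close> below, the inputs at time \<open>t\<close> depend on the values of this
  function before \<open>t\<close>, so that strong induction on time applies directly.\<close>

definition yout :: "encoder \<Rightarrow> encoder \<Rightarrow> real \<Rightarrow> real^2^2 \<Rightarrow> nat \<Rightarrow> nat
    \<Rightarrow> (nat \<times> nat \<Rightarrow> real) \<Rightarrow> nat \<Rightarrow> real" where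
  "yout phi1 phi2 N K a b \<omega> t = X1 phi1 phi2 N K a b \<omega> t + X2 phi1 phi2 N K a b \<omega> t + Zn N \<omega> t"

lemma length_out_seq [simp]: "length (out_seq phi1 phi2 N K a b \<omega> t) = t"
  by (induction t) (auto simp: Let_def)

lemma out_seq_nth:
  assumes "s < t"
  shows "out_seq phi1 phi2 N K a b \<omega> t ! s = yout phi1 phi2 N K a b \<omega> s"
  using assms
proof (induction t)
  case (Suc t)
  show ?case
  proof (cases "s < t")
    case True
    with Suc show ?thesis by (auto simp: Let_def nth_append)
  next
    case False
    with Suc.prems have "s = t" by simp
    then show ?thesis by (simp add: Let_def nth_append yout_def X1_def X2_def)
  qed
qed simp

lemma X1_eq: "X1 phi1 phi2 N K a b \<omega> t =
    phi1 t a (restrict (\<lambda>s. yout phi1 phi2 N K a b \<omega> s + W1n K \<omega> s) {..<t})"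
  unfolding X1_def past_def
  by (rule arg_cong[where f = "phi1 t a"]) (auto simp: out_seq_nth restrict_def)

lemma X2_eq: "X2 phi1 phi2 N K a b \<omega> t =
    phi2 t b (restrict (\<lambda>s. yout phi1 phi2 N K a b \<omega> s + W2n K \<omega> s) {..<t})"
  unfolding X2_def past_def
  by (rule arg_cong[where f = "phi2 t b"]) (auto simp: out_seq_nth restrict_def)

lemma restrict_out_seq:
  "restrict (\<lambda>t. out_seq phi1 phi2 N K a b \<omega> n ! t) {..<n}
    = restrict (yout phi1 phi2 N K a b \<omega>) {..<n}"
  by (auto simp: out_seq_nth restrict_def)

definition meas_enc :: "nat \<Rightarrow> encoder \<Rightarrow> bool" where
  "meas_enc n phi \<longleftrightarrow> (\<forall>t<n. \<forall>m. phi t m \<in> borel_measurable (PiM {..<t} (\<lambda>_. borel)))"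

lemma prob_space_noise: "prob_space (noise_space n)"
  unfolding noise_space_def
  by (rule prob_space_PiM, rule prob_space_normal_density) simp

lemma noise_component_measurable:
  assumes "t < n" "k < 3"
  shows "(\<lambda>\<omega>. \<omega> (t, k)) \<in> borel_measurable (noise_space n)"
proof -
  have "(\<lambda>\<omega>. \<omega> (t, k)) \<in> noise_space n \<rightarrow>\<^sub>M density lborel std_normal_density"
    unfolding noise_space_def using assms by (intro measurable_component_singleton) auto
  then show ?thesis by simp
qed

lemma noise_measurable:
  assumes "t < n"
  shows "(\<lambda>\<omega>. Zn N \<omega> t) \<in> borel_measurable (noise_space n)"
    and "(\<lambda>\<omega>. W1n K \<omega> t) \<in> borel_measurable (noise_space n)"
    and "(\<lambda>\<omega>. W2n K \<omega> t) \<in> borel_measurable (noise_space n)"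
proof -
  have [measurable]: "(\<lambda>\<omega>. \<omega> (t, 0)) \<in> borel_measurable (noise_space n)"
    "(\<lambda>\<omega>. \<omega> (t, 1)) \<in> borel_measurable (noise_space n)"
    "(\<lambda>\<omega>. \<omega> (t, 2)) \<in> borel_measurable (noise_space n)"
    using assms by (auto intro!: noise_component_measurable)
  show "(\<lambda>\<omega>. Zn N \<omega> t) \<in> borel_measurable (noise_space n)"
    and "(\<lambda>\<omega>. W1n K \<omega> t) \<in> borel_measurable (noise_space n)"
    and "(\<lambda>\<omega>. W2n K \<omega> t) \<in> borel_measurable (noise_space n)"
    unfolding Zn_def W1n_def W2n_def by measurable
qed

lemma channel_measurable:
  assumes "meas_enc n phi1" "meas_enc n phi2" "t < n"
  shows "(\<lambda>\<omega>. X1 phi1 phi2 N K a b \<omega> t) \<in> borel_measurable (noise_space n) \<and>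
    (\<lambda>\<omega>. X2 phi1 phi2 N K a b \<omega> t) \<in> borel_measurable (noise_space n) \<and>
    (\<lambda>\<omega>. yout phi1 phi2 N K a b \<omega> t) \<in> borel_measurable (noise_space n)"
  using assms(3)
proof (induction t rule: less_induct)
  case (less t)
  have y: "(\<lambda>\<omega>. yout phi1 phi2 N K a b \<omega> s) \<in> borel_measurable (noise_space n)" if "s < t" for s
    using less that by auto
  have v: "(\<lambda>\<omega>. restrict (\<lambda>s. yout phi1 phi2 N K a b \<omega> s + W \<omega> s) {..<t})
      \<in> noise_space n \<rightarrow>\<^sub>M PiM {..<t} (\<lambda>_. borel)"
    if "\<And>s. s < t \<Longrightarrow> (\<lambda>\<omega>. W \<omega> s) \<in> borel_measurable (noise_space n)" for W
    using y that by (intro measurable_restrict borel_measurable_add) auto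
  have 1: "(\<lambda>\<omega>. X1 phi1 phi2 N K a b \<omega> t) \<in> borel_measurable (noise_space n)"
    unfolding X1_eq
    by (rule measurable_compose[OF v])
      (use assms less.prems noise_measurable in \<open>auto simp: meas_enc_def\<close>)
  have 2: "(\<lambda>\<omega>. X2 phi1 phi2 N K a b \<omega> t) \<in> borel_measurable (noise_space n)"
    unfolding X2_eq
    by (rule measurable_compose[OF v])
      (use assms less.prems noise_measurable in \<open>auto simp: meas_enc_def\<close>)
  show ?case
    using 1 2 noise_measurable(1)[OF less.prems] unfolding yout_def by simp
qed

lemma output_measurable:
  assumes "meas_enc n phi1" "meas_enc n phi2" "t \<le> n"
  shows "(\<lambda>\<omega>. restrict (yout phi1 phi2 N K a b \<omega>) {..<t})
    \<in> noise_space n \<rightarrow>\<^sub>M PiM {..<t} (\<lambda>_. borel)"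
  using channel_measurable[OF assms(1,2)] assms(3) by (intro measurable_restrict) auto

text \<open>Causality. It freezes the trajectory before the single time at which the encoders are
  altered later on.\<close>

lemma yout_prefix_cong:
  assumes "\<And>s. s < k \<Longrightarrow> phi1' s = phi1 s" "\<And>s. s < k \<Longrightarrow> phi2' s = phi2 s" "t < k"
  shows "X1 phi1' phi2' N K a b \<omega> t = X1 phi1 phi2 N K a b \<omega> t \<and>
    X2 phi1' phi2' N K a b \<omega> t = X2 phi1 phi2 N K a b \<omega> t \<and>
    yout phi1' phi2' N K a b \<omega> t = yout phi1 phi2 N K a b \<omega> t"
  using assms(3)
proof (induction t rule: less_induct)
  case (less t)
  then have past: "restrict (\<lambda>s. yout phi1' phi2' N K a b \<omega> s + w s) {..<t}
      = restrict (\<lambda>s. yout phi1 phi2 N K a b \<omega> s + w s) {..<t}" for w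
    by (auto simp: restrict_def)
  have "X1 phi1' phi2' N K a b \<omega> t = X1 phi1 phi2 N K a b \<omega> t"
    "X2 phi1' phi2' N K a b \<omega> t = X2 phi1 phi2 N K a b \<omega> t"
    unfolding X1_eq X2_eq past using assms(1,2) less.prems by auto
  then show ?case by (simp add: yout_def)
qed

section \<open>Approximation of measurable functions by continuous ones\<close>

text \<open>Continuity in the topology of pointwise convergence of the coordinates below \<open>t\<close>;
  such a function ignores all other coordinates.\<close>

definition coord_continuous :: "nat \<Rightarrow> ((nat \<Rightarrow> real) \<Rightarrow> real) \<Rightarrow> bool" where
  "coord_continuous t f \<longleftrightarrow>
    (\<forall>(v :: nat \<Rightarrow> nat \<Rightarrow> real) v0. (\<forall>s<t. (\<lambda>j. v j s) \<longlonglongrightarrow> v0 s) \<longrightarrow> (\<lambda>j. f (v j)) \<longlonglongrightarrow> f v0)"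

text \<open>Continuity lets trajectories pass to limits, measurability keeps the replaced functions
  legal encoders, and boundedness provides dominating constants.\<close>

definition approximant :: "nat \<Rightarrow> ((nat \<Rightarrow> real) \<Rightarrow> real) \<Rightarrow> bool" where
  "approximant t g \<longleftrightarrow> coord_continuous t g \<and> g \<in> borel_measurable (PiM {..<t} (\<lambda>_. borel))
     \<and> (\<exists>B. \<forall>v. \<bar>g v\<bar> \<le> B)"

lemma approximant_const: "approximant t (\<lambda>_. c)"
  by (auto simp: approximant_def coord_continuous_def)

text \<open>Bounded \<open>f\<close> and \<open>g\<close> take values in a compact box, on which the
  continuous \<open>F\<close> is bounded; no global bound on \<open>F\<close> is required.\<close>

lemma approximant_comp2:
  assumes "approximant t f" "approximant t g"
    and F: "continuous_on UNIV (\<lambda>p. F (fst p) (snd p))"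
  shows "approximant t (\<lambda>v. F (f v) (g v) :: real)"
proof -
  obtain A B where A: "\<And>v. \<bar>f v\<bar> \<le> A" and B: "\<And>v. \<bar>g v\<bar> \<le> B"
    using assms unfolding approximant_def by auto
  have "compact ((\<lambda>p. F (fst p) (snd p)) ` (cball 0 A \<times> cball 0 B))"
    by (intro compact_continuous_image compact_Times compact_cball continuous_on_subset[OF F]) auto
  then obtain C where C: "\<And>x. x \<in> (\<lambda>p. F (fst p) (snd p)) ` (cball 0 A \<times> cball 0 B) \<Longrightarrow> norm x \<le> C"
    using compact_imp_bounded bounded_iff by metis
  have bd: "\<bar>F (f v) (g v)\<bar> \<le> C" for v
    using C[of "F (f v) (g v)"] A[of v] B[of v] by (force simp: image_iff)
  have "coord_continuous t (\<lambda>v. F (f v) (g v))"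
    unfolding coord_continuous_def
  proof (intro allI impI)
    fix v :: "nat \<Rightarrow> nat \<Rightarrow> real" and v0 assume "\<forall>s<t. (\<lambda>j. v j s) \<longlonglongrightarrow> v0 s"
    with assms have "(\<lambda>j. f (v j)) \<longlonglongrightarrow> f v0" "(\<lambda>j. g (v j)) \<longlonglongrightarrow> g v0"
      unfolding approximant_def coord_continuous_def by blast+
    then have "(\<lambda>j. (f (v j), g (v j))) \<longlonglongrightarrow> (f v0, g v0)"
      by (rule tendsto_Pair)
    from continuous_on_tendsto_compose[OF F this]
    show "(\<lambda>j. F (f (v j)) (g (v j))) \<longlonglongrightarrow> F (f v0) (g v0)" by simp
  qed
  moreover have "(\<lambda>v. F (f v) (g v)) \<in> borel_measurable (PiM {..<t} (\<lambda>_. borel))"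
  proof -
    have "(\<lambda>v. (f v, g v)) \<in> borel_measurable (PiM {..<t} (\<lambda>_. borel))"
      using assms unfolding approximant_def by (intro borel_measurable_Pair) auto
    from measurable_compose[OF this borel_measurable_continuous_onI[OF F]] show ?thesis by simp
  qed
  ultimately show ?thesis using bd unfolding approximant_def by blast
qed

section \<open>Density of bounded continuous functions in L1, and almost everywhere
  approximation\<close>

text \<open>Membership in the L1 closure of the approximants. The Bochner integral of a
  non-integrable function is 0, so the predicate is meaningful only for integrable \<open>f\<close>;
  the lemmas carry integrability along separately.\<close>

definition L1_approximable :: "nat \<Rightarrow> (nat \<Rightarrow> real) measure \<Rightarrow> ((nat \<Rightarrow> real) \<Rightarrow> real) \<Rightarrow> bool" where
  "L1_approximable t \<mu> f \<longleftrightarrow> (\<forall>e>0. \<exists>g. approximant t g \<and> (\<integral>v. \<bar>f v - g v\<bar> \<partial>\<mu>) < e)"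

context
  fixes t :: nat and \<mu> :: "(nat \<Rightarrow> real) measure"
  assumes fin: "finite_measure \<mu>" and sets_mu [measurable_cong]: "sets \<mu> = sets (PiM {..<t} (\<lambda>_. borel))"
begin

interpretation finite_measure \<mu> by (rule fin)

lemma borel_measurable_mu: "borel_measurable \<mu> = borel_measurable (PiM {..<t} (\<lambda>_. borel))"
  by (rule measurable_cong_sets[OF sets_mu refl])

lemma indicator_integrable: "A \<in> sets \<mu> \<Longrightarrow> integrable \<mu> (indicat_real A)"
  by (simp add: less_top[symmetric])

lemma approximant_integrable:
  assumes "approximant t g"
  shows "integrable \<mu> g"
proof -
  from assms obtain B where "\<And>v. \<bar>g v\<bar> \<le> B" and m: "g \<in> borel_measurable (PiM {..<t} (\<lambda>_. borel))"
    unfolding approximant_def by auto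
  then show ?thesis
    by (intro integrable_const_bound[where B = B]) (auto simp: borel_measurable_mu)
qed

lemma L1_approximable_lim:
  assumes s: "\<And>i. L1_approximable t \<mu> (s i)" and si: "\<And>i. integrable \<mu> (s i)"
    and f: "integrable \<mu> f"
    and lim: "(\<lambda>i. \<integral>v. \<bar>f v - s i v\<bar> \<partial>\<mu>) \<longlonglongrightarrow> 0"
  shows "L1_approximable t \<mu> f"
  unfolding L1_approximable_def
proof (intro allI impI)
  fix e :: real assume e: "e > 0"
  then obtain i where i: "(\<integral>v. \<bar>f v - s i v\<bar> \<partial>\<mu>) < e / 2"
    using order_tendstoD(2)[OF lim, of "e/2"] by (auto simp: eventually_sequentially)
  from e s obtain g where g: "approximant t g" "(\<integral>v. \<bar>s i v - g v\<bar> \<partial>\<mu>) < e / 2"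
    unfolding L1_approximable_def by (meson half_gt_zero)
  have "(\<integral>v. \<bar>f v - g v\<bar> \<partial>\<mu>) \<le> (\<integral>v. \<bar>f v - s i v\<bar> + \<bar>s i v - g v\<bar> \<partial>\<mu>)"
    using f si approximant_integrable[OF g(1)] by (intro integral_mono) auto
  also have "\<dots> = (\<integral>v. \<bar>f v - s i v\<bar> \<partial>\<mu>) + (\<integral>v. \<bar>s i v - g v\<bar> \<partial>\<mu>)"
    using f si approximant_integrable[OF g(1)] by (intro Bochner_Integration.integral_add) auto
  finally show "\<exists>g. approximant t g \<and> (\<integral>v. \<bar>f v - g v\<bar> \<partial>\<mu>) < e"
    using g i by (intro exI[of _ g]) auto
qed

lemma L1_approximable_dominated:
  assumes s: "\<And>i. L1_approximable t \<mu> (s i)" and si: "\<And>i. integrable \<mu> (s i)"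
    and f: "integrable \<mu> f" and w: "integrable \<mu> w"
    and lim: "\<And>v. v \<in> space \<mu> \<Longrightarrow> (\<lambda>i. s i v) \<longlonglongrightarrow> f v"
    and dom: "\<And>i v. v \<in> space \<mu> \<Longrightarrow> \<bar>s i v\<bar> \<le> w v"
  shows "L1_approximable t \<mu> f"
proof (rule L1_approximable_lim[OF s si f])
  have "(\<lambda>i. \<integral>v. \<bar>f v - s i v\<bar> \<partial>\<mu>) \<longlonglongrightarrow> (\<integral>v. 0 \<partial>\<mu>)"
  proof (rule integral_dominated_convergence[where w = "\<lambda>v. \<bar>f v\<bar> + w v"])
    show "AE v in \<mu>. (\<lambda>i. \<bar>f v - s i v\<bar>) \<longlonglongrightarrow> 0"
    proof (rule AE_I2)
      fix v assume "v \<in> space \<mu>"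
      from tendsto_rabs[OF tendsto_diff[OF tendsto_const lim[OF this], of "f v"]]
      show "(\<lambda>i. \<bar>f v - s i v\<bar>) \<longlonglongrightarrow> 0" by simp
    qed
    show "AE v in \<mu>. norm \<bar>f v - s i v\<bar> \<le> \<bar>f v\<bar> + w v" for i
      using dom[of _ i] by (intro AE_I2) (smt (verit) real_norm_def)
  qed (use f si w in auto)
  then show "(\<lambda>i. \<integral>v. \<bar>f v - s i v\<bar> \<partial>\<mu>) \<longlonglongrightarrow> 0" by simp
qed

text \<open>A Lipschitz \<open>F\<close> turns L1 errors of the arguments into an L1 error of the
  value. The instances used are maximum, difference, sum and multiplication by a constant.\<close>

lemma L1_approximable_comp2:
  assumes f: "L1_approximable t \<mu> f" "integrable \<mu> f" and g: "L1_approximable t \<mu> g" "integrable \<mu> g"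
    and F: "continuous_on UNIV (\<lambda>p. F (fst p) (snd p))" and Fi: "integrable \<mu> (\<lambda>v. F (f v) (g v))"
    and lip: "\<And>x x' y y'. \<bar>F x y - F x' y'\<bar> \<le> C * (\<bar>x - x'\<bar> + \<bar>y - y'\<bar>)" and C: "C > 0"
  shows "L1_approximable t \<mu> (\<lambda>v. F (f v) (g v) :: real)"
  unfolding L1_approximable_def
proof (intro allI impI)
  fix e :: real assume e: "e > 0"
  then have e': "e / (2 * C) > 0" using C by simp
  from f(1) e' obtain f' where f': "approximant t f'" "(\<integral>v. \<bar>f v - f' v\<bar> \<partial>\<mu>) < e / (2 * C)"
    unfolding L1_approximable_def by blast
  from g(1) e' obtain g' where g': "approximant t g'" "(\<integral>v. \<bar>g v - g' v\<bar> \<partial>\<mu>) < e / (2 * C)"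
    unfolding L1_approximable_def by blast
  note [simp] = f(2) g(2) approximant_integrable[OF f'(1)] approximant_integrable[OF g'(1)]
  have a: "approximant t (\<lambda>v. F (f' v) (g' v))"
    by (rule approximant_comp2[OF f'(1) g'(1) F])
  have "(\<integral>v. \<bar>F (f v) (g v) - F (f' v) (g' v)\<bar> \<partial>\<mu>)
      \<le> (\<integral>v. C * (\<bar>f v - f' v\<bar> + \<bar>g v - g' v\<bar>) \<partial>\<mu>)"
    using lip approximant_integrable[OF a] Fi
    by (intro integral_mono) auto
  also have "\<dots> = C * ((\<integral>v. \<bar>f v - f' v\<bar> \<partial>\<mu>) + (\<integral>v. \<bar>g v - g' v\<bar> \<partial>\<mu>))"
    by (simp add: distrib_left)
  also have "\<dots> < C * (e / (2 * C) + e / (2 * C))"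
    using f'(2) g'(2) C by (intro mult_strict_left_mono) auto
  also have "\<dots> = e" using C by simp
  finally show "\<exists>h. approximant t h \<and> (\<integral>v. \<bar>F (f v) (g v) - h v\<bar> \<partial>\<mu>) < e"
    using a by blast
qed

lemma L1_approximable_approximant: "approximant t g \<Longrightarrow> L1_approximable t \<mu> g"
  unfolding L1_approximable_def by (intro allI impI exI[of _ g]) simp

lemma L1_approximable_const: "L1_approximable t \<mu> (\<lambda>_. c)"
  by (rule L1_approximable_approximant[OF approximant_const])

text \<open>The sets with approximable indicator form a \<sigma>-algebra \<open>D\<close>: unions
  come from the maximum, complements from \<open>1 - x\<close>, countable unions from dominated
  convergence. \<open>D\<close> contains the half-spaces bounding one coordinate, which generate the
  product \<sigma>-algebra.\<close>

lemma L1_approximable_indicator: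
  assumes "A \<in> sets \<mu>"
  shows "L1_approximable t \<mu> (indicator A)"
proof -
  define D where "D = {A \<in> sets \<mu>. L1_approximable t \<mu> (indicator A)}"
  have D_un: "A \<union> B \<in> D" if A: "A \<in> D" and B: "B \<in> D" for A B
  proof -
    have "L1_approximable t \<mu> (\<lambda>v. max (indicator A v) (indicator B v))"
      using A B unfolding D_def
      by (intro L1_approximable_comp2[where C = 1 and F = max] integrable_max continuous_intros)
         (auto simp: indicator_integrable)
    moreover have "(\<lambda>v. max (indicator A v) (indicator B v) :: real) = indicator (A \<union> B)"
      by (auto simp: fun_eq_iff indicator_def)
    ultimately show ?thesis using A B by (auto simp: D_def)
  qed
  have D_empty: "{} \<in> D"
  proof -
    have "indicat_real {} = (\<lambda>v :: nat \<Rightarrow> real. 0)" by auto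
    then show ?thesis using L1_approximable_const[of 0] by (simp add: D_def)
  qed
  interpret D: sigma_algebra "space \<mu>" D
    unfolding sigma_algebra_iff2
  proof (intro conjI ballI allI impI)
    show "D \<subseteq> Pow (space \<mu>)" using sets.sets_into_space by (auto simp: D_def)
    show "{} \<in> D" by (rule D_empty)
  next
    fix A assume A: "A \<in> D"
    have "L1_approximable t \<mu> (\<lambda>v. 1 - indicator A v)"
      using A unfolding D_def
      by (intro L1_approximable_comp2[where C = 1 and F = "\<lambda>x y. x - y"] L1_approximable_const continuous_intros)
         (auto simp: indicator_integrable)
    then have "L1_approximable t \<mu> (indicator (space \<mu> - A))"
      unfolding L1_approximable_def
      by (simp add: indicator_def of_bool_not_iff cong: Bochner_Integration.integral_cong)
    then show "space \<mu> - A \<in> D" using A by (auto simp: D_def)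
  next
    fix A :: "nat \<Rightarrow> _" assume A: "range A \<subseteq> D"
    have U: "(\<Union>i<n. A i) \<in> D" for n
    proof (induction n)
      case (Suc n)
      have "A n \<in> D" using A by auto
      from D_un[OF this Suc] show ?case by (simp only: lessThan_Suc UN_insert)
    qed (simp add: D_empty)
    have UA: "(\<Union>i. A i) \<in> sets \<mu>" using A by (auto simp: D_def)
    have "L1_approximable t \<mu> (indicator (\<Union>i. A i))"
    proof (rule L1_approximable_dominated[where s = "\<lambda>n. indicator (\<Union>i<n. A i)" and w = "\<lambda>_. 1"])
      show "L1_approximable t \<mu> (indicat_real (\<Union>i<n. A i))"
        "integrable \<mu> (indicat_real (\<Union>i<n. A i))" for n
        using U[of n] unfolding D_def by (auto intro: indicator_integrable)
      show "integrable \<mu> (indicat_real (\<Union>i. A i))" by (rule indicator_integrable[OF UA])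
      show "(\<lambda>n. indicat_real (\<Union>i<n. A i) v) \<longlonglongrightarrow> indicator (\<Union>i. A i) v" for v
        by (rule LIMSEQ_indicator_UN)
      show "integrable \<mu> (\<lambda>_. 1 :: real)" by simp
      show "\<bar>indicat_real (\<Union>i<n. A i) v\<bar> \<le> 1" for n v by (simp only: indicator_def) simp
    qed
    then show "(\<Union>i. A i) \<in> D" using UA by (simp add: D_def)
  qed
  define \<D> where "\<D> = sigma (space \<mu>) D"
  have sD: "sets \<D> = D" "space \<D> = space \<mu>"
    unfolding \<D>_def using D.space_closed by (auto simp: D.sigma_sets_eq)
  have spc: "space \<mu> = PiE {..<t} (\<lambda>_. UNIV)"
    using sets_eq_imp_space_eq[OF sets_mu] by (simp add: space_PiM)
  have coord: "(\<lambda>v. v i) \<in> borel_measurable \<D>" if i: "i < t" for i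
    unfolding borel_measurable_iff_le sD
  proof
    fix x :: real
    have mi: "(\<lambda>v. v i) \<in> borel_measurable \<mu>"
      using i by (subst measurable_cong_sets[OF sets_mu refl]) (auto intro: measurable_component_singleton)
    have S: "{v \<in> space \<mu>. v i \<le> x} \<in> sets \<mu>"
      using mi by measurable
    \<comment> \<open>A ramp in coordinate \<open>i\<close>: it is 1 up to \<open>x\<close>, falls
      linearly, and is 0 from \<open>x + 1 / j\<close> on (for positive \<open>j\<close>), so it
      tends to the indicator of the half-space.\<close>
    let ?s = "\<lambda>j v. max 0 (1 - real j * max 0 (v i - x)) :: real"
    have ap: "approximant t (?s j)" for j
      unfolding approximant_def
    proof (intro conjI)
      show "coord_continuous t (?s j)"
        unfolding coord_continuous_def using i by (auto intro!: tendsto_intros)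
      show "\<exists>B. \<forall>v. \<bar>?s j v\<bar> \<le> B" by (rule exI[of _ 1]) auto
      show "?s j \<in> borel_measurable (PiM {..<t} (\<lambda>_. borel))"
        using mi unfolding measurable_cong_sets[OF sets_mu refl] by measurable
    qed
    have "L1_approximable t \<mu> (indicator {v \<in> space \<mu>. v i \<le> x})"
    proof (rule L1_approximable_dominated[where s = ?s and w = "\<lambda>_. 1"])
      show "L1_approximable t \<mu> (?s j)" for j
        by (rule L1_approximable_approximant[OF ap])
      show "integrable \<mu> (?s j)" for j by (rule approximant_integrable[OF ap])
      show "integrable \<mu> (indicat_real {v \<in> space \<mu>. v i \<le> x})"
        using S by (rule indicator_integrable)
      show "(\<lambda>j. ?s j v) \<longlonglongrightarrow> indicat_real {v \<in> space \<mu>. v i \<le> x} v" if v: "v \<in> space \<mu>" for v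
      proof (cases "v i \<le> x")
        case True
        then show ?thesis using v by simp
      next
        case False
        then obtain m :: nat where "1 / (v i - x) < real m" using reals_Archimedean2 by blast
        with False have m: "1 < real m * (v i - x)" by (simp add: field_simps)
        have "?s j v = 0" if "j \<ge> m" for j
        proof -
          have "real m * (v i - x) \<le> real j * (v i - x)" using False that by (intro mult_right_mono) auto
          with m have "1 < real j * (v i - x)" by linarith
          with False show ?thesis by simp
        qed
        then have "eventually (\<lambda>j. ?s j v = indicat_real {v \<in> space \<mu>. v i \<le> x} v) sequentially"
          using False eventually_sequentially by (auto simp: indicator_def)
        then show ?thesis by (rule tendsto_eventually)
      qed
    qed auto
    with S show "{v \<in> space \<mu>. v i \<le> x} \<in> D"
      by (simp add: D_def)
  qed
  \<comment> \<open>On \<open>space \<mu>\<close> the restriction is the identity. Its measurability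
    from \<open>D\<close> to the product \<sigma>-algebra therefore says that every measurable set
    belongs to \<open>D\<close>.\<close>
  have "(\<lambda>v. restrict v {..<t}) \<in> \<D> \<rightarrow>\<^sub>M PiM {..<t} (\<lambda>_. borel)"
    by (rule measurable_restrict) (use coord in auto)
  moreover have "A \<in> sets (PiM {..<t} (\<lambda>_. borel))" using assms sets_mu by simp
  ultimately have "(\<lambda>v. restrict v {..<t}) -` A \<inter> space \<D> \<in> sets \<D>"
    by (rule measurable_sets)
  moreover have "(\<lambda>v. restrict v {..<t}) -` A \<inter> space \<D> = A"
    using sets.sets_into_space[OF assms] unfolding sD spc by (auto simp: PiE_restrict)
  ultimately show ?thesis by (simp add: sD D_def)
qed

lemma L1_approximable_integrable:
  assumes "integrable \<mu> f"
  shows "L1_approximable t \<mu> f"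
  using assms
proof (induction rule: integrable_induct)
  case (base A c)
  have "L1_approximable t \<mu> (\<lambda>v. c * indicator A v)"
  \<comment> \<open>The summand 1 keeps the Lipschitz constant positive when
    \<open>c = 0\<close>.\<close>
  proof (rule L1_approximable_comp2[where C = "\<bar>c\<bar> + 1" and F = "\<lambda>x y. c * x" and g = "\<lambda>_. 0"])
    show "\<bar>c * x - c * x'\<bar> \<le> (\<bar>c\<bar> + 1) * (\<bar>x - x'\<bar> + \<bar>y - y'\<bar>)" for x x' y y'
      unfolding right_diff_distrib[symmetric] abs_mult by (intro mult_mono) auto
  qed (use base in \<open>auto intro!: L1_approximable_indicator L1_approximable_const indicator_integrable continuous_intros\<close>)
  then show ?case by (simp add: mult.commute)
next
  case (add f g)
  then show ?case
    by (intro L1_approximable_comp2[where C = 1 and F = "\<lambda>x y. x + y"] continuous_intros) auto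
next
  case (lim f s)
  show ?case
    by (rule L1_approximable_dominated[where s = s and w = "\<lambda>v. 2 * \<bar>f v\<bar>"]) (use lim in auto)
qed

text \<open>L1 approximations with errors tending to 0 have a subsequence converging almost
  everywhere. Clipping them to \<open>[-B, B]\<close> beforehand does not increase the error,
  because \<open>f\<close> already takes its values there.\<close>

lemma AE_approximation:
  assumes m: "f \<in> borel_measurable (PiM {..<t} (\<lambda>_. borel))" and B: "\<And>v. \<bar>f v\<bar> \<le> B"
  obtains g where "\<And>j::nat. approximant t (g j)" "\<And>j v. \<bar>g j v\<bar> \<le> B"
    "AE v in \<mu>. (\<lambda>j. g j v) \<longlonglongrightarrow> f v"
proof -
  have fi: "integrable \<mu> f"
    using m B by (intro integrable_const_bound[where B = B]) (auto simp: borel_measurable_mu)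
  have "\<exists>g. approximant t g \<and> (\<integral>v. \<bar>f v - g v\<bar> \<partial>\<mu>) < 1 / Suc j" for j
    using L1_approximable_integrable[OF fi] unfolding L1_approximable_def by simp
  then obtain g0 where g0: "\<And>j. approximant t (g0 j)" "\<And>j. (\<integral>v. \<bar>f v - g0 j v\<bar> \<partial>\<mu>) < 1 / Suc j"
    by metis
  define g where "g j v = max (- B) (min B (g0 j v))" for j v
  have B0: "0 \<le> B" using B[of undefined] by linarith
  have ga: "approximant t (g j)" for j
    unfolding g_def
    by (rule approximant_comp2[OF g0(1) approximant_const[of t 0], where F = "\<lambda>x y. max (- B) (min B x)"])
      (intro continuous_intros)
  have gB: "\<bar>g j v\<bar> \<le> B" for j v using B0 by (auto simp: g_def)
  have gi: "integrable \<mu> (\<lambda>v. f v - g j v)" for j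
    using fi approximant_integrable[OF ga] by auto
  have "(\<lambda>j. \<integral>v. norm (f v - g j v) \<partial>\<mu>) \<longlonglongrightarrow> 0"
  proof (rule tendsto_sandwich[OF _ _ tendsto_const LIMSEQ_inverse_real_of_nat])
    have "(\<integral>v. norm (f v - g j v) \<partial>\<mu>) \<le> inverse (real (Suc j))" for j
    proof -
      have "\<bar>f v - g j v\<bar> \<le> \<bar>f v - g0 j v\<bar>" for v
        using B[of v] by (auto simp: g_def)
      then have "(\<integral>v. norm (f v - g j v) \<partial>\<mu>) \<le> (\<integral>v. \<bar>f v - g0 j v\<bar> \<partial>\<mu>)"
        using gi fi approximant_integrable[OF g0(1)] by (intro integral_mono) auto
      with g0(2)[of j] show ?thesis by (simp add: inverse_eq_divide)
    qed
    then show "\<forall>\<^sub>F j in sequentially. (\<integral>v. norm (f v - g j v) \<partial>\<mu>) \<le> inverse (real (Suc j))"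
      by simp
  qed auto
  from tendsto_L1_AE_subseq[OF gi this] obtain r where
    r: "AE v in \<mu>. (\<lambda>n. f v - g (r n) v) \<longlonglongrightarrow> 0" by blast
  show thesis
  proof (rule that[of "\<lambda>j. g (r j)"])
    show "AE v in \<mu>. (\<lambda>j. g (r j) v) \<longlonglongrightarrow> f v"
      using r
    proof (rule AE_mp, intro AE_I2 impI)
      fix v assume "(\<lambda>n. f v - g (r n) v) \<longlonglongrightarrow> 0"
      from tendsto_diff[OF tendsto_const this, of "f v"] show "(\<lambda>j. g (r j) v) \<longlonglongrightarrow> f v" by simp
    qed
  qed (use ga gB in auto)
qed

end

text \<open>The feedback seen by one user has a different law for each message of the other user,
  but the encoder must be replaced by one function for all of them. Approximation under the image of
  counting measure times \<open>M\<close> handles the finitely many laws at once, since its null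
  sets are null for each of them.\<close>

lemma AE_approximation_family:
  assumes I: "finite I" and M: "finite_measure M"
    and U: "\<And>x. x \<in> I \<Longrightarrow> U x \<in> M \<rightarrow>\<^sub>M PiM {..<t} (\<lambda>_. borel)"
    and m: "f \<in> borel_measurable (PiM {..<t} (\<lambda>_. borel))" and B: "\<And>v. \<bar>f v\<bar> \<le> B"
  obtains g where "\<And>j::nat. approximant t (g j)" "\<And>j v. \<bar>g j v\<bar> \<le> B"
    "\<And>x. x \<in> I \<Longrightarrow> AE \<omega> in M. (\<lambda>j. g j (U x \<omega>)) \<longlonglongrightarrow> f (U x \<omega>)"
proof -
  interpret M: finite_measure M by fact
  let ?P = "count_space I \<Otimes>\<^sub>M M"
  interpret C: finite_measure "count_space I" by (rule finite_measure_count_space[OF I])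
  interpret P: pair_sigma_finite "count_space I" M ..
  interpret PF: finite_measure ?P
  proof
    show "emeasure ?P (space ?P) \<noteq> \<infinity>"
      unfolding space_pair_measure
      by (subst M.emeasure_pair_measure_Times) (auto simp: ennreal_mult_eq_top_iff I emeasure_count_space)
  qed
  let ?V = "\<lambda>(x, \<omega>). U x \<omega>"
  have V: "?V \<in> ?P \<rightarrow>\<^sub>M PiM {..<t} (\<lambda>_. borel)"
    by (rule measurable_pair_measure_countable1) (use I U in \<open>auto simp: countable_finite\<close>)
  let ?\<mu> = "distr ?P (PiM {..<t} (\<lambda>_. borel)) ?V"
  have fin: "finite_measure ?\<mu>" by (rule PF.finite_measure_distr[OF V])
  from AE_approximation[OF fin _ m B] obtain g where g: "\<And>j::nat. approximant t (g j)" "\<And>j v. \<bar>g j v\<bar> \<le> B"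
    "AE v in ?\<mu>. (\<lambda>j. g j v) \<longlonglongrightarrow> f v" by auto
  have gm [measurable]: "g j \<in> borel_measurable (PiM {..<t} (\<lambda>_. borel))" for j
    using g(1)[of j] by (simp add: approximant_def)
  note m [measurable]
  have "AE z in ?P. (\<lambda>j. g j (?V z)) \<longlonglongrightarrow> f (?V z)"
    by (rule AE_distrD[OF V g(3)])
  from P.AE_pair[OF this] have "AE x in count_space I. AE \<omega> in M. (\<lambda>j. g j (U x \<omega>)) \<longlonglongrightarrow> f (U x \<omega>)"
    by simp
  then show thesis by (intro that[of g] g) (auto simp: AE_count_space)
qed

section \<open>Robustness of a fixed code against small feedback noise\<close>

definition power1 :: "encoder \<Rightarrow> encoder \<Rightarrow> real \<Rightarrow> real^2^2 \<Rightarrow> nat \<Rightarrow> nat \<Rightarrow> nat \<Rightarrow> ennreal" where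
  "power1 phi1 phi2 N K n m1 m2 =
    (\<Sum>t<n. \<Sum>a<m1. \<Sum>b<m2. \<integral>\<^sup>+ \<omega>. ennreal ((X1 phi1 phi2 N K a b \<omega> t)\<^sup>2) \<partial>noise_space n)"

definition power2 :: "encoder \<Rightarrow> encoder \<Rightarrow> real \<Rightarrow> real^2^2 \<Rightarrow> nat \<Rightarrow> nat \<Rightarrow> nat \<Rightarrow> ennreal" where
  "power2 phi1 phi2 N K n m1 m2 =
    (\<Sum>t<n. \<Sum>a<m1. \<Sum>b<m2. \<integral>\<^sup>+ \<omega>. ennreal ((X2 phi1 phi2 N K a b \<omega> t)\<^sup>2) \<partial>noise_space n)"

text \<open>A continuous surrogate for the error probability of the decoder that rounds \<open>h\<close> to the
  nearest integer and reads it as an encoded message pair: it dominates the error indicator, and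
  equals it if \<open>h\<close> is integer valued.\<close>

definition soft_loss :: "((nat \<Rightarrow> real) \<Rightarrow> real) \<Rightarrow> nat \<Rightarrow> nat \<Rightarrow> (nat \<Rightarrow> real) \<Rightarrow> real" where
  "soft_loss h a b v = min 1 (2 * \<bar>h v - real (prod_encode (a, b))\<bar>)"

definition total_loss :: "((nat \<Rightarrow> real) \<Rightarrow> real) \<Rightarrow> encoder \<Rightarrow> encoder \<Rightarrow> real \<Rightarrow> real^2^2
    \<Rightarrow> nat \<Rightarrow> nat \<Rightarrow> nat \<Rightarrow> ennreal" where
  "total_loss h phi1 phi2 N K n m1 m2 =
    (\<Sum>a<m1. \<Sum>b<m2. \<integral>\<^sup>+ \<omega>. ennreal (soft_loss h a b (restrict (yout phi1 phi2 N K a b \<omega>) {..<n})) \<partial>noise_space n)"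

lemma soft_loss_measurable:
  assumes "h \<in> borel_measurable (PiM {..<n} (\<lambda>_. borel))"
  shows "soft_loss h a b \<in> borel_measurable (PiM {..<n} (\<lambda>_. borel))"
  unfolding soft_loss_def[abs_def] using assms by measurable

lemma soft_loss_bounds: "0 \<le> soft_loss h a b v" "soft_loss h a b v \<le> 1"
  by (auto simp: soft_loss_def)

lemma coord_continuousD:
  assumes "coord_continuous t f" "\<And>s. s < t \<Longrightarrow> (\<lambda>j. v j s) \<longlonglongrightarrow> v0 s"
  shows "(\<lambda>j. f (v j)) \<longlonglongrightarrow> f v0"
  using assms unfolding coord_continuous_def by blast

lemma coord_continuous_restrictD:
  assumes "coord_continuous t f" "\<And>s. s < t \<Longrightarrow> (\<lambda>j. v j s) \<longlonglongrightarrow> v0 s"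
  shows "(\<lambda>j. f (restrict (v j) {..<t})) \<longlonglongrightarrow> f (restrict v0 {..<t})"
  using assms by (intro coord_continuousD[OF assms(1)]) auto

text \<open>\<open>F\<close> is kept abstract to serve both users and both limits needed later:
  varying encoders with \<open>K = 0\<close>, and fixed encoders with varying
  \<open>K\<close>.\<close>

lemma power_tendsto:
  fixes F :: "nat \<Rightarrow> nat \<Rightarrow> nat \<Rightarrow> (nat \<times> nat \<Rightarrow> real) \<Rightarrow> nat \<Rightarrow> real"
  assumes Fm: "\<And>j a b t. t < n \<Longrightarrow> (\<lambda>\<omega>. F j a b \<omega> t) \<in> borel_measurable (noise_space n)"
    and F0m: "\<And>a b t. t < n \<Longrightarrow> (\<lambda>\<omega>. F0 a b \<omega> t) \<in> borel_measurable (noise_space n)"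
    and Dm: "\<And>a b t. t < n \<Longrightarrow> D a b t \<in> borel_measurable (noise_space n)"
    and lim: "\<And>a b t. \<lbrakk>a < m1; b < m2; t < n\<rbrakk> \<Longrightarrow>
      AE \<omega> in noise_space n. (\<lambda>j. F j a b \<omega> t) \<longlonglongrightarrow> F0 a b \<omega> t"
    and D: "\<And>a b t. \<lbrakk>a < m1; b < m2; t < n\<rbrakk> \<Longrightarrow> (\<integral>\<^sup>+ \<omega>. ennreal (D a b t \<omega>) \<partial>noise_space n) < \<infinity>"
    and dom: "\<And>a b t j \<omega>. \<lbrakk>a < m1; b < m2; t < n\<rbrakk> \<Longrightarrow> (F j a b \<omega> t)\<^sup>2 \<le> D a b t \<omega>"
  shows "(\<lambda>j. \<Sum>t<n. \<Sum>a<m1. \<Sum>b<m2. \<integral>\<^sup>+ \<omega>. ennreal ((F j a b \<omega> t)\<^sup>2) \<partial>noise_space n)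
    \<longlonglongrightarrow> (\<Sum>t<n. \<Sum>a<m1. \<Sum>b<m2. \<integral>\<^sup>+ \<omega>. ennreal ((F0 a b \<omega> t)\<^sup>2) \<partial>noise_space n)"
proof (intro tendsto_sum)
  fix t a b assume *: "t \<in> {..<n}" "a \<in> {..<m1}" "b \<in> {..<m2}"
  have [measurable]: "(\<lambda>\<omega>. F j a b \<omega> t) \<in> borel_measurable (noise_space n)"
    "(\<lambda>\<omega>. F0 a b \<omega> t) \<in> borel_measurable (noise_space n)" for j
    using Fm F0m * by auto
  show "(\<lambda>j. \<integral>\<^sup>+ \<omega>. ennreal ((F j a b \<omega> t)\<^sup>2) \<partial>noise_space n)
    \<longlonglongrightarrow> (\<integral>\<^sup>+ \<omega>. ennreal ((F0 a b \<omega> t)\<^sup>2) \<partial>noise_space n)"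
  proof (rule nn_integral_dominated_convergence[where w = "\<lambda>\<omega>. ennreal (D a b t \<omega>)"])
    have "AE \<omega> in noise_space n. (\<lambda>j. F j a b \<omega> t) \<longlonglongrightarrow> F0 a b \<omega> t" using lim * by simp
    then show "AE \<omega> in noise_space n. (\<lambda>j. ennreal ((F j a b \<omega> t)\<^sup>2)) \<longlonglongrightarrow> ennreal ((F0 a b \<omega> t)\<^sup>2)"
      by eventually_elim (intro tendsto_ennrealI tendsto_power)
    show "AE \<omega> in noise_space n. ennreal ((F j a b \<omega> t)\<^sup>2) \<le> ennreal (D a b t \<omega>)" for j
      using dom * by (intro AE_I2 ennreal_leI) auto
  qed (use Dm D * in auto)
qed

text \<open>All ingredients may vary with \<open>j\<close>: the encoders during smoothing,
  \<open>h\<close> when the decoder is made continuous, and \<open>K\<close> when the feedback noise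
  shrinks. The constant 1 dominates the loss.\<close>

lemma loss_tendsto:
  assumes meas: "\<And>j::nat. meas_enc n (p j)" "\<And>j. meas_enc n (q j)" "meas_enc n p0" "meas_enc n q0"
    and hm: "\<And>j. h j \<in> borel_measurable (PiM {..<n} (\<lambda>_. borel))" "h0 \<in> borel_measurable (PiM {..<n} (\<lambda>_. borel))"
    and lim: "\<And>a b. \<lbrakk>a < m1; b < m2\<rbrakk> \<Longrightarrow>
      AE \<omega> in noise_space n. (\<lambda>j. h j (restrict (yout (p j) (q j) N (K j) a b \<omega>) {..<n}))
         \<longlonglongrightarrow> h0 (restrict (yout p0 q0 N K0 a b \<omega>) {..<n})"
  shows "(\<lambda>j. total_loss (h j) (p j) (q j) N (K j) n m1 m2) \<longlonglongrightarrow> total_loss h0 p0 q0 N K0 n m1 m2"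
  unfolding total_loss_def
proof (intro tendsto_sum)
  fix a b assume *: "a \<in> {..<m1}" "b \<in> {..<m2}"
  interpret prob_space "noise_space n" by (rule prob_space_noise)
  have [measurable]: "(\<lambda>\<omega>. soft_loss (h j) a b (restrict (yout (p j) (q j) N (K j) a b \<omega>) {..<n}))
      \<in> borel_measurable (noise_space n)" for j
    by (rule measurable_compose[OF output_measurable[OF meas(1,2) order_refl] soft_loss_measurable[OF hm(1)]])
  have [measurable]: "(\<lambda>\<omega>. soft_loss h0 a b (restrict (yout p0 q0 N K0 a b \<omega>) {..<n}))
      \<in> borel_measurable (noise_space n)"
    by (rule measurable_compose[OF output_measurable[OF meas(3,4) order_refl] soft_loss_measurable[OF hm(2)]])
  show "(\<lambda>j. \<integral>\<^sup>+ \<omega>. ennreal (soft_loss (h j) a b (restrict (yout (p j) (q j) N (K j) a b \<omega>) {..<n})) \<partial>noise_space n)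
    \<longlonglongrightarrow> (\<integral>\<^sup>+ \<omega>. ennreal (soft_loss h0 a b (restrict (yout p0 q0 N K0 a b \<omega>) {..<n})) \<partial>noise_space n)"
  proof (rule nn_integral_dominated_convergence[where w = "\<lambda>\<omega>. 1"])
    show "AE \<omega> in noise_space n.
       (\<lambda>j. ennreal (soft_loss (h j) a b (restrict (yout (p j) (q j) N (K j) a b \<omega>) {..<n})))
        \<longlonglongrightarrow> ennreal (soft_loss h0 a b (restrict (yout p0 q0 N K0 a b \<omega>) {..<n}))"
    proof -
      have "AE \<omega> in noise_space n. (\<lambda>j. h j (restrict (yout (p j) (q j) N (K j) a b \<omega>) {..<n}))
         \<longlonglongrightarrow> h0 (restrict (yout p0 q0 N K0 a b \<omega>) {..<n})" using lim * by simp
      then show ?thesis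
        unfolding soft_loss_def by eventually_elim (intro tendsto_ennrealI tendsto_intros)
    qed
    show "AE \<omega> in noise_space n.
        ennreal (soft_loss (h j) a b (restrict (yout (p j) (q j) N (K j) a b \<omega>) {..<n})) \<le> 1" for j
      using soft_loss_bounds by (intro AE_I2) (auto simp: ennreal_le_1)
  qed (auto simp: emeasure_space_1)
qed

text \<open>The channel noise \<open>Zn\<close> does not depend on \<open>j\<close>, so convergence
  of the inputs carries over to the output; \<open>step\<close> only has to go from earlier outputs
  to the current inputs.\<close>

lemma outputs_tendsto:
  assumes "t < n"
    and step: "\<And>t. t < n \<Longrightarrow> (\<And>s. s < t \<Longrightarrow> (\<lambda>j. yout (p j) (q j) N (K j) a b \<omega> s) \<longlonglongrightarrow> yout p0 q0 N K0 a b \<omega> s)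
      \<Longrightarrow> (\<lambda>j. X1 (p j) (q j) N (K j) a b \<omega> t) \<longlonglongrightarrow> X1 p0 q0 N K0 a b \<omega> t \<and>
          (\<lambda>j. X2 (p j) (q j) N (K j) a b \<omega> t) \<longlonglongrightarrow> X2 p0 q0 N K0 a b \<omega> t"
  shows "(\<lambda>j. X1 (p j) (q j) N (K j) a b \<omega> t) \<longlonglongrightarrow> X1 p0 q0 N K0 a b \<omega> t \<and>
    (\<lambda>j. X2 (p j) (q j) N (K j) a b \<omega> t) \<longlonglongrightarrow> X2 p0 q0 N K0 a b \<omega> t \<and>
    (\<lambda>j. yout (p j) (q j) N (K j) a b \<omega> t) \<longlonglongrightarrow> yout p0 q0 N K0 a b \<omega> t"
  using assms(1)
proof (induction t rule: less_induct)
  case (less t)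
  then have "(\<lambda>j. X1 (p j) (q j) N (K j) a b \<omega> t) \<longlonglongrightarrow> X1 p0 q0 N K0 a b \<omega> t \<and>
    (\<lambda>j. X2 (p j) (q j) N (K j) a b \<omega> t) \<longlonglongrightarrow> X2 p0 q0 N K0 a b \<omega> t"
    by (intro step) auto
  then show ?case unfolding yout_def by (auto intro!: tendsto_intros)
qed

lemma W_zero [simp]: "W1n 0 \<omega> s = 0" "W2n 0 \<omega> s = 0"
  by (auto simp: W1n_def W2n_def)

section \<open>Replacing the encoders by continuous ones, one time at a time\<close>

text \<open>\<open>k\<close> records the progress of the backward replacement: \<open>k = n\<close>
  is an empty condition, and \<open>k = 0\<close> says that all encoders are continuous and
  bounded.\<close>

definition cont_enc :: "nat \<Rightarrow> nat \<Rightarrow> encoder \<Rightarrow> bool" where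
  "cont_enc k n phi \<longleftrightarrow> (\<forall>t. k \<le> t \<longrightarrow> t < n \<longrightarrow> (\<forall>m. coord_continuous t (phi t m)) \<and> (\<exists>B. \<forall>m v. \<bar>phi t m v\<bar> \<le> B))"

text \<open>Strict inequalities, so that they persist along convergent sequences and each
  replacement can keep the same three bounds.\<close>

definition costs_below where
  "costs_below h p q N K n m1 m2 Q1 Q2 E \<longleftrightarrow> power1 p q N K n m1 m2 < Q1 \<and>
     power2 p q N K n m1 m2 < Q2 \<and> total_loss h p q N K n m1 m2 < E"

text \<open>Before \<open>k\<close> the trajectories coincide. At \<open>k\<close> the past is
  therefore unchanged, which is why \<open>lim\<close> can be stated along the outputs of the
  unperturbed code. After \<open>k\<close> the encoders are continuous and transmit the convergence.
  The domination hypotheses allow truncation (where \<open>p0\<close> may be unbounded) as well as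
  approximation of a bounded function.\<close>

lemma perturb_one_time:
  assumes meas: "\<And>j::nat. meas_enc n (p j)" "\<And>j. meas_enc n (q j)" "meas_enc n p0" "meas_enc n q0"
    and hm: "h \<in> borel_measurable (PiM {..<n} (\<lambda>_. borel))" and hc: "coord_continuous n h"
    and k: "k < n" and other: "\<And>j t. t \<noteq> k \<Longrightarrow> p j t = p0 t" "\<And>j t. t \<noteq> k \<Longrightarrow> q j t = q0 t"
    and cont: "cont_enc (Suc k) n p0" "cont_enc (Suc k) n q0"
    and lim: "\<And>a b. \<lbrakk>a < m1; b < m2\<rbrakk> \<Longrightarrow> AE \<omega> in noise_space n.
        (\<lambda>j. p j k a (restrict (yout p0 q0 N 0 a b \<omega>) {..<k})) \<longlonglongrightarrow> p0 k a (restrict (yout p0 q0 N 0 a b \<omega>) {..<k}) \<and>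
        (\<lambda>j. q j k b (restrict (yout p0 q0 N 0 a b \<omega>) {..<k})) \<longlonglongrightarrow> q0 k b (restrict (yout p0 q0 N 0 a b \<omega>) {..<k})"
    and dom: "\<And>j m v. \<bar>p j k m v\<bar> \<le> max B \<bar>p0 k m v\<bar>" "\<And>j m v. \<bar>q j k m v\<bar> \<le> max B \<bar>q0 k m v\<bar>"
    and cost: "costs_below h p0 q0 N 0 n m1 m2 Q1 Q2 E"
  shows "\<exists>j. costs_below h (p j) (q j) N 0 n m1 m2 Q1 Q2 E"
proof -
  interpret prob_space "noise_space n" by (rule prob_space_noise)
  have early: "X1 (p j) (q j) N 0 a b \<omega> t = X1 p0 q0 N 0 a b \<omega> t \<and>
      X2 (p j) (q j) N 0 a b \<omega> t = X2 p0 q0 N 0 a b \<omega> t \<and>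
      yout (p j) (q j) N 0 a b \<omega> t = yout p0 q0 N 0 a b \<omega> t" if "t < k" for j a b \<omega> t
    by (rule yout_prefix_cong[where k = k]) (use other that in auto)
  have past: "restrict (yout (p j) (q j) N 0 a b \<omega>) {..<k} = restrict (yout p0 q0 N 0 a b \<omega>) {..<k}" for j a b \<omega>
    using early by (auto simp: restrict_def)
  have conv: "AE \<omega> in noise_space n. \<forall>t<n.
      (\<lambda>j. X1 (p j) (q j) N 0 a b \<omega> t) \<longlonglongrightarrow> X1 p0 q0 N 0 a b \<omega> t \<and>
      (\<lambda>j. X2 (p j) (q j) N 0 a b \<omega> t) \<longlonglongrightarrow> X2 p0 q0 N 0 a b \<omega> t \<and>
      (\<lambda>j. yout (p j) (q j) N 0 a b \<omega> t) \<longlonglongrightarrow> yout p0 q0 N 0 a b \<omega> t" if ab: "a < m1" "b < m2" for a b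
    using lim[OF ab]
  proof (rule AE_mp, intro AE_I2 impI allI)
    fix \<omega> t assume t: "t < n"
      and l: "(\<lambda>j. p j k a (restrict (yout p0 q0 N 0 a b \<omega>) {..<k})) \<longlonglongrightarrow> p0 k a (restrict (yout p0 q0 N 0 a b \<omega>) {..<k}) \<and>
        (\<lambda>j. q j k b (restrict (yout p0 q0 N 0 a b \<omega>) {..<k})) \<longlonglongrightarrow> q0 k b (restrict (yout p0 q0 N 0 a b \<omega>) {..<k})"
    show "(\<lambda>j. X1 (p j) (q j) N 0 a b \<omega> t) \<longlonglongrightarrow> X1 p0 q0 N 0 a b \<omega> t \<and>
      (\<lambda>j. X2 (p j) (q j) N 0 a b \<omega> t) \<longlonglongrightarrow> X2 p0 q0 N 0 a b \<omega> t \<and>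
      (\<lambda>j. yout (p j) (q j) N 0 a b \<omega> t) \<longlonglongrightarrow> yout p0 q0 N 0 a b \<omega> t"
      using t
    proof (rule outputs_tendsto)
      fix t assume t: "t < n"
        and IH: "\<And>s. s < t \<Longrightarrow> (\<lambda>j. yout (p j) (q j) N 0 a b \<omega> s) \<longlonglongrightarrow> yout p0 q0 N 0 a b \<omega> s"
      consider "t < k" | "t = k" | "k < t" by linarith
      then show "(\<lambda>j. X1 (p j) (q j) N 0 a b \<omega> t) \<longlonglongrightarrow> X1 p0 q0 N 0 a b \<omega> t \<and>
          (\<lambda>j. X2 (p j) (q j) N 0 a b \<omega> t) \<longlonglongrightarrow> X2 p0 q0 N 0 a b \<omega> t"
      proof cases
        case 1
        then show ?thesis using early by simp
      next
        case 2
        show ?thesis using l unfolding X1_eq X2_eq 2 by (simp add: past)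
      next
        case 3
        then have c: "coord_continuous t (p0 t a)" "coord_continuous t (q0 t b)"
          using cont t unfolding cont_enc_def by auto
        have o: "p j t = p0 t" "q j t = q0 t" for j using 3 other by auto
        show ?thesis
          unfolding X1_eq X2_eq o
          by (intro conjI coord_continuous_restrictD[OF c(1)] coord_continuous_restrictD[OF c(2)]) (use IH in simp_all)
      qed
    qed
  qed
  obtain Bp where Bp: "\<And>t m v. k < t \<Longrightarrow> t < n \<Longrightarrow> \<bar>p0 t m v\<bar> \<le> Bp t"
    using cont(1) unfolding cont_enc_def Suc_le_eq by metis
  obtain Bq where Bq: "\<And>t m v. k < t \<Longrightarrow> t < n \<Longrightarrow> \<bar>q0 t m v\<bar> \<le> Bq t"
    using cont(2) unfolding cont_enc_def Suc_le_eq by metis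
  have sq: "x\<^sup>2 \<le> c\<^sup>2 + y\<^sup>2" if "\<bar>x\<bar> \<le> max c \<bar>y\<bar>" for x y c :: real
  proof -
    have "\<bar>x\<bar> \<le> \<bar>c\<bar> \<or> \<bar>x\<bar> \<le> \<bar>y\<bar>" using that by linarith
    then have "x\<^sup>2 \<le> c\<^sup>2 \<or> x\<^sup>2 \<le> y\<^sup>2" by (simp add: abs_le_square_iff)
    then show ?thesis by (smt (verit) zero_le_power2)
  qed
  \<comment> \<open>A single dominating function for three cases: the input is unchanged before
    \<open>k\<close>, controlled by \<open>dom\<close> at \<open>k\<close>, and bounded by
    \<open>Bp\<close> after \<open>k\<close>. It is integrable because the power of the unperturbed
    code lies strictly below \<open>Q1\<close>, hence is finite.\<close>
  have D1: "(X1 (p j) (q j) N 0 a b \<omega> t)\<^sup>2 \<le> (max B (Bp t))\<^sup>2 + (X1 p0 q0 N 0 a b \<omega> t)\<^sup>2"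
    if "t < n" for j a b t \<omega>
  proof (rule sq)
    consider "t < k" | "t = k" | "k < t" by linarith
    then show "\<bar>X1 (p j) (q j) N 0 a b \<omega> t\<bar> \<le> max (max B (Bp t)) \<bar>X1 p0 q0 N 0 a b \<omega> t\<bar>"
    proof cases
      case 1 then show ?thesis using early by simp
    next
      case 2
      show ?thesis unfolding X1_eq 2 using dom(1)[of j a "restrict (yout p0 q0 N 0 a b \<omega>) {..<k}"] by (simp add: past)
    next
      case 3
      then show ?thesis unfolding X1_eq[of "p j"] using other(1)[of t j] Bp[OF 3 that] by (simp add: max.coboundedI1 max.coboundedI2)
    qed
  qed
  have D2: "(X2 (p j) (q j) N 0 a b \<omega> t)\<^sup>2 \<le> (max B (Bq t))\<^sup>2 + (X2 p0 q0 N 0 a b \<omega> t)\<^sup>2"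
    if "t < n" for j a b t \<omega>
  proof (rule sq)
    consider "t < k" | "t = k" | "k < t" by linarith
    then show "\<bar>X2 (p j) (q j) N 0 a b \<omega> t\<bar> \<le> max (max B (Bq t)) \<bar>X2 p0 q0 N 0 a b \<omega> t\<bar>"
    proof cases
      case 1 then show ?thesis using early by simp
    next
      case 2
      show ?thesis unfolding X2_eq 2 using dom(2)[of j b "restrict (yout p0 q0 N 0 a b \<omega>) {..<k}"] by (simp add: past)
    next
      case 3
      then show ?thesis unfolding X2_eq[of "p j"] using other(2)[of t j] Bq[OF 3 that] by (simp add: max.coboundedI1 max.coboundedI2)
    qed
  qed
  have fin_aux: "(\<integral>\<^sup>+ \<omega>. ennreal (c\<^sup>2 + (f \<omega>)\<^sup>2) \<partial>noise_space n) < \<infinity>"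
    if "(\<integral>\<^sup>+ \<omega>. ennreal ((f \<omega>)\<^sup>2) \<partial>noise_space n) < \<infinity>" "f \<in> borel_measurable (noise_space n)" for f and c :: real
  proof -
    have "(\<integral>\<^sup>+ \<omega>. ennreal (c\<^sup>2 + (f \<omega>)\<^sup>2) \<partial>noise_space n) =
        (\<integral>\<^sup>+ \<omega>. ennreal (c\<^sup>2) + ennreal ((f \<omega>)\<^sup>2) \<partial>noise_space n)"
      by (intro nn_integral_cong) simp
    also have "\<dots> = ennreal (c\<^sup>2) + (\<integral>\<^sup>+ \<omega>. ennreal ((f \<omega>)\<^sup>2) \<partial>noise_space n)"
      using that(2) by (subst nn_integral_add) (auto simp: emeasure_space_1)
    finally show ?thesis using that(1) by (simp add: less_top)
  qed
  have P1fin: "(\<integral>\<^sup>+ \<omega>. ennreal ((X1 p0 q0 N 0 a b \<omega> t)\<^sup>2) \<partial>noise_space n) < \<infinity>"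
    if "a < m1" "b < m2" "t < n" for a b t
  proof -
    have "power1 p0 q0 N 0 n m1 m2 < \<infinity>" using cost unfolding costs_below_def using order.strict_trans2 top_greatest by (metis infinity_ennreal_def)
    then show ?thesis using that unfolding power1_def by (auto simp: ennreal_sum_less_top)
  qed
  have P2fin: "(\<integral>\<^sup>+ \<omega>. ennreal ((X2 p0 q0 N 0 a b \<omega> t)\<^sup>2) \<partial>noise_space n) < \<infinity>"
    if "a < m1" "b < m2" "t < n" for a b t
  proof -
    have "power2 p0 q0 N 0 n m1 m2 < \<infinity>" using cost unfolding costs_below_def using order.strict_trans2 top_greatest by (metis infinity_ennreal_def)
    then show ?thesis using that unfolding power2_def by (auto simp: ennreal_sum_less_top)
  qed
  note cm = channel_measurable[OF meas(3,4)]
  have "(\<lambda>j. power1 (p j) (q j) N 0 n m1 m2) \<longlonglongrightarrow> power1 p0 q0 N 0 n m1 m2"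
    unfolding power1_def
  proof (rule power_tendsto[where D = "\<lambda>a b t \<omega>. (max B (Bp t))\<^sup>2 + (X1 p0 q0 N 0 a b \<omega> t)\<^sup>2"])
    show "AE \<omega> in noise_space n. (\<lambda>j. X1 (p j) (q j) N 0 a b \<omega> t) \<longlonglongrightarrow> X1 p0 q0 N 0 a b \<omega> t"
      if "a < m1" "b < m2" "t < n" for a b t
      using conv[OF that(1,2)] by eventually_elim (use that in auto)
    show "(\<integral>\<^sup>+ \<omega>. ennreal ((max B (Bp t))\<^sup>2 + (X1 p0 q0 N 0 a b \<omega> t)\<^sup>2) \<partial>noise_space n) < \<infinity>"
      if "a < m1" "b < m2" "t < n" for a b t
      using that cm by (intro fin_aux P1fin) auto
  qed (use cm channel_measurable[OF meas(1,2)] in \<open>auto intro!: D1 borel_measurable_add borel_measurable_power\<close>)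
  then have 1: "\<forall>\<^sub>F j in sequentially. power1 (p j) (q j) N 0 n m1 m2 < Q1"
    by (rule order_tendstoD(2)) (use cost in \<open>simp add: costs_below_def\<close>)
  have "(\<lambda>j. power2 (p j) (q j) N 0 n m1 m2) \<longlonglongrightarrow> power2 p0 q0 N 0 n m1 m2"
    unfolding power2_def
  proof (rule power_tendsto[where D = "\<lambda>a b t \<omega>. (max B (Bq t))\<^sup>2 + (X2 p0 q0 N 0 a b \<omega> t)\<^sup>2"])
    show "AE \<omega> in noise_space n. (\<lambda>j. X2 (p j) (q j) N 0 a b \<omega> t) \<longlonglongrightarrow> X2 p0 q0 N 0 a b \<omega> t"
      if "a < m1" "b < m2" "t < n" for a b t
      using conv[OF that(1,2)] by eventually_elim (use that in auto)
    show "(\<integral>\<^sup>+ \<omega>. ennreal ((max B (Bq t))\<^sup>2 + (X2 p0 q0 N 0 a b \<omega> t)\<^sup>2) \<partial>noise_space n) < \<infinity>"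
      if "a < m1" "b < m2" "t < n" for a b t
      using that cm by (intro fin_aux P2fin) auto
  qed (use cm channel_measurable[OF meas(1,2)] in \<open>auto intro!: D2 borel_measurable_add borel_measurable_power\<close>)
  then have 2: "\<forall>\<^sub>F j in sequentially. power2 (p j) (q j) N 0 n m1 m2 < Q2"
    by (rule order_tendstoD(2)) (use cost in \<open>simp add: costs_below_def\<close>)
  have "(\<lambda>j. total_loss h (p j) (q j) N 0 n m1 m2) \<longlonglongrightarrow> total_loss h p0 q0 N 0 n m1 m2"
  proof (rule loss_tendsto[OF meas hm hm])
    fix a b assume "a < m1" "b < m2"
    from conv[OF this] show "AE \<omega> in noise_space n. (\<lambda>j. h (restrict (yout (p j) (q j) N 0 a b \<omega>) {..<n}))
         \<longlonglongrightarrow> h (restrict (yout p0 q0 N 0 a b \<omega>) {..<n})"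
      by eventually_elim (auto intro: coord_continuous_restrictD[OF hc])
  qed
  then have 3: "\<forall>\<^sub>F j in sequentially. total_loss h (p j) (q j) N 0 n m1 m2 < E"
    by (rule order_tendstoD(2)) (use cost in \<open>simp add: costs_below_def\<close>)
  from eventually_conj[OF 1 eventually_conj[OF 2 3]] show ?thesis
    unfolding costs_below_def eventually_sequentially by blast
qed

text \<open>Approximation works for bounded functions only. Truncation at level \<open>j\<close> is
  pointwise eventually the identity and never increases the absolute value, so
  \<open>perturb_one_time\<close> applies with \<open>B = 0\<close>.\<close>

lemma clip_encoders_at:
  assumes meas: "meas_enc n p0" "meas_enc n q0"
    and h: "approximant n h" and k: "k < n"
    and cont: "cont_enc (Suc k) n p0" "cont_enc (Suc k) n q0"
    and cost: "costs_below h p0 q0 N 0 n m1 m2 Q1 Q2 E"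
  obtains p q B where "meas_enc n p" "meas_enc n q" "cont_enc (Suc k) n p" "cont_enc (Suc k) n q"
    "\<And>m v. \<bar>p k m v\<bar> \<le> B" "\<And>m v. \<bar>q k m v\<bar> \<le> B" "costs_below h p q N 0 n m1 m2 Q1 Q2 E"
proof -
  define clip where "clip phi j t m v = (if t = k then max (- real j) (min (real j) (phi t m v)) else phi t m v)"
    for phi :: encoder and j t m v
  have clip_other: "clip phi j t = phi t" if "t \<noteq> k" for phi j t
    using that by (auto simp: clip_def fun_eq_iff)
  have clip_meas: "meas_enc n (clip phi j)" if "meas_enc n phi" for phi j
    unfolding meas_enc_def
  proof (intro allI impI)
    fix t m assume "t < n"
    then have [measurable]: "phi t m \<in> borel_measurable (PiM {..<t} (\<lambda>_. borel))"
      using that by (simp add: meas_enc_def)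
    show "clip phi j t m \<in> borel_measurable (PiM {..<t} (\<lambda>_. borel))"
      unfolding clip_def[abs_def] by measurable
  qed
  have clip_lim: "(\<lambda>j. clip phi j k m v) \<longlonglongrightarrow> phi k m v" for phi m v
  proof (rule tendsto_eventually)
    obtain j0 :: nat where j0: "\<bar>phi k m v\<bar> \<le> real j0" using real_arch_simple by blast
    have "clip phi j k m v = phi k m v" if "j \<ge> j0" for j
    proof -
      have "\<bar>phi k m v\<bar> \<le> real j" using j0 that by linarith
      then show ?thesis unfolding clip_def by auto
    qed
    then show "\<forall>\<^sub>F j in sequentially. clip phi j k m v = phi k m v"
      unfolding eventually_sequentially by blast
  qed
  have clip_cont: "cont_enc (Suc k) n (clip phi j)" if "cont_enc (Suc k) n phi" for phi j
    using that by (auto simp: cont_enc_def clip_other)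
  have dom: "\<bar>clip phi j k m v\<bar> \<le> max 0 \<bar>phi k m v\<bar>" for phi j m v
    by (auto simp: clip_def)
  from h have hm: "h \<in> borel_measurable (PiM {..<n} (\<lambda>_. borel))" and hc: "coord_continuous n h"
    by (auto simp: approximant_def)
  have "\<exists>j. costs_below h (clip p0 j) (clip q0 j) N 0 n m1 m2 Q1 Q2 E"
    by (rule perturb_one_time[OF clip_meas[OF meas(1)] clip_meas[OF meas(2)] meas hm hc k
          clip_other clip_other cont _ dom dom cost]) (assumption | intro AE_I2 conjI clip_lim)+
  then obtain j where j: "costs_below h (clip p0 j) (clip q0 j) N 0 n m1 m2 Q1 Q2 E" by blast
  have "\<bar>clip phi j k m v\<bar> \<le> real j" for phi m v by (auto simp: clip_def)
  then show thesis
    using that[of "clip p0 j" "clip q0 j" "real j"] clip_meas meas clip_cont cont j by blast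
qed

text \<open>For each own message the family lemma is applied with the messages of the other user as
  index set. Convergence almost everywhere along the feedback is enough for
  \<open>perturb_one_time\<close>, so no uniform approximation is needed.\<close>

lemma smooth_encoders_at:
  assumes meas: "meas_enc n p0" "meas_enc n q0"
    and h: "approximant n h" and k: "k < n"
    and cont: "cont_enc (Suc k) n p0" "cont_enc (Suc k) n q0"
    and B: "\<And>m v. \<bar>p0 k m v\<bar> \<le> B" "\<And>m v. \<bar>q0 k m v\<bar> \<le> B"
    and cost: "costs_below h p0 q0 N 0 n m1 m2 Q1 Q2 E"
  obtains p q where "meas_enc n p" "meas_enc n q" "cont_enc k n p" "cont_enc k n q"
    "costs_below h p q N 0 n m1 m2 Q1 Q2 E"
proof -
  \<comment> \<open>Without feedback noise both transmitters observe exactly the past outputs, so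
    one observation serves both.\<close>
  let ?V = "\<lambda>a b \<omega>. restrict (yout p0 q0 N 0 a b \<omega>) {..<k}"
  have B0: "0 \<le> B" using B(1)[of 0 undefined] by linarith
  have Vm: "?V a b \<in> noise_space n \<rightarrow>\<^sub>M PiM {..<k} (\<lambda>_. borel)" for a b
    using output_measurable[OF meas, of k] k by auto
  have fin: "finite_measure (noise_space n)"
    using prob_space_noise prob_space.finite_measure by blast
  have "\<exists>g. (\<forall>j::nat. approximant k (g j)) \<and> (\<forall>j v. \<bar>g j v\<bar> \<le> B) \<and>
      (\<forall>b<m2. AE \<omega> in noise_space n. (\<lambda>j. g j (?V a b \<omega>)) \<longlonglongrightarrow> p0 k a (?V a b \<omega>))" for a
  proof -
    have m: "p0 k a \<in> borel_measurable (PiM {..<k} (\<lambda>_. borel))" using meas(1) k by (simp add: meas_enc_def)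
    show ?thesis
    proof (rule AE_approximation_family[OF finite_lessThan[of m2] fin Vm[of a] m B(1)])
      fix g assume "\<And>j::nat. approximant k (g j)" "\<And>j v. \<bar>g j v\<bar> \<le> B"
        "\<And>b. b \<in> {..<m2} \<Longrightarrow> AE \<omega> in noise_space n. (\<lambda>j. g j (?V a b \<omega>)) \<longlonglongrightarrow> p0 k a (?V a b \<omega>)"
      then show ?thesis by (intro exI[of _ g] conjI allI impI) (auto simp only: lessThan_iff)
    qed
  qed
  from choice[OF allI[OF this]] obtain gp where gp0:
    "\<forall>a. (\<forall>j::nat. approximant k (gp a j)) \<and> (\<forall>j v. \<bar>gp a j v\<bar> \<le> B) \<and>
      (\<forall>b<m2. AE \<omega> in noise_space n. (\<lambda>j. gp a j (?V a b \<omega>)) \<longlonglongrightarrow> p0 k a (?V a b \<omega>))" ..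
  have gp: "approximant k (gp a j)" "\<bar>gp a j v\<bar> \<le> B"
    "b < m2 \<Longrightarrow> AE \<omega> in noise_space n. (\<lambda>j. gp a j (?V a b \<omega>)) \<longlonglongrightarrow> p0 k a (?V a b \<omega>)"
    for a b j v
    using gp0 by blast+
  have "\<exists>g. (\<forall>j::nat. approximant k (g j)) \<and> (\<forall>j v. \<bar>g j v\<bar> \<le> B) \<and>
      (\<forall>a<m1. AE \<omega> in noise_space n. (\<lambda>j. g j (?V a b \<omega>)) \<longlonglongrightarrow> q0 k b (?V a b \<omega>))" for b
  proof -
    have m: "q0 k b \<in> borel_measurable (PiM {..<k} (\<lambda>_. borel))" using meas(2) k by (simp add: meas_enc_def)
    show ?thesis
    proof (rule AE_approximation_family[OF finite_lessThan[of m1] fin Vm[of _ b] m B(2)])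
      fix g assume "\<And>j::nat. approximant k (g j)" "\<And>j v. \<bar>g j v\<bar> \<le> B"
        "\<And>a. a \<in> {..<m1} \<Longrightarrow> AE \<omega> in noise_space n. (\<lambda>j. g j (?V a b \<omega>)) \<longlonglongrightarrow> q0 k b (?V a b \<omega>)"
      then show ?thesis by (intro exI[of _ g] conjI allI impI) (auto simp only: lessThan_iff)
    qed
  qed
  from choice[OF allI[OF this]] obtain gq where gq0:
    "\<forall>b. (\<forall>j::nat. approximant k (gq b j)) \<and> (\<forall>j v. \<bar>gq b j v\<bar> \<le> B) \<and>
      (\<forall>a<m1. AE \<omega> in noise_space n. (\<lambda>j. gq b j (?V a b \<omega>)) \<longlonglongrightarrow> q0 k b (?V a b \<omega>))" ..
  have gq: "approximant k (gq b j)" "\<bar>gq b j v\<bar> \<le> B"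
    "a < m1 \<Longrightarrow> AE \<omega> in noise_space n. (\<lambda>j. gq b j (?V a b \<omega>)) \<longlonglongrightarrow> q0 k b (?V a b \<omega>)"
    for a b j v
    using gq0 by blast+
  define p where "p j t m v = (if t = k then gp m j v else p0 t m v)" for j t m v
  define q where "q j t m v = (if t = k then gq m j v else q0 t m v)" for j t m v
  have pk: "p j k = (\<lambda>m. gp m j)" "q j k = (\<lambda>m. gq m j)" for j
    by (auto simp: p_def q_def fun_eq_iff)
  have other: "p j t = p0 t" "q j t = q0 t" if "t \<noteq> k" for j t
    using that by (auto simp: p_def q_def fun_eq_iff)
  have pm: "meas_enc n (p j)" for j
    unfolding meas_enc_def
  proof (intro allI impI)
    fix t m assume "t < n"
    then show "p j t m \<in> borel_measurable (PiM {..<t} (\<lambda>_. borel))"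
      using meas(1) gp(1)[of m j] by (cases "t = k") (auto simp: pk other meas_enc_def approximant_def)
  qed
  have qm: "meas_enc n (q j)" for j
    unfolding meas_enc_def
  proof (intro allI impI)
    fix t m assume "t < n"
    then show "q j t m \<in> borel_measurable (PiM {..<t} (\<lambda>_. borel))"
      using meas(2) gq(1)[of m j] by (cases "t = k") (auto simp: pk other meas_enc_def approximant_def)
  qed
  from h have hm: "h \<in> borel_measurable (PiM {..<n} (\<lambda>_. borel))" and hc: "coord_continuous n h"
    by (auto simp: approximant_def)
  have "\<exists>j. costs_below h (p j) (q j) N 0 n m1 m2 Q1 Q2 E"
  proof (rule perturb_one_time[OF pm qm meas hm hc k other(1) other(2) cont _ _ _ cost])
    fix a b assume "a < m1" "b < m2"
    with gp(3)[of b a] gq(3)[of a b] show "AE \<omega> in noise_space n.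
        (\<lambda>j. p j k a (?V a b \<omega>)) \<longlonglongrightarrow> p0 k a (?V a b \<omega>) \<and>
        (\<lambda>j. q j k b (?V a b \<omega>)) \<longlonglongrightarrow> q0 k b (?V a b \<omega>)"
      unfolding pk by auto
  next
    show "\<bar>p j k m v\<bar> \<le> max B \<bar>p0 k m v\<bar>" "\<bar>q j k m v\<bar> \<le> max B \<bar>q0 k m v\<bar>" for j m v
      using gp(2)[of m j v] gq(2)[of m j v] unfolding pk by (auto intro: max.coboundedI1)
  qed
  then obtain j where j: "costs_below h (p j) (q j) N 0 n m1 m2 Q1 Q2 E" by blast
  have "cont_enc k n (p j)"
    unfolding cont_enc_def
  proof (intro allI impI)
    fix t assume t: "k \<le> t" "t < n"
    show "(\<forall>m. coord_continuous t (p j t m)) \<and> (\<exists>B. \<forall>m v. \<bar>p j t m v\<bar> \<le> B)"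
    proof (cases "t = k")
      case True
      then show ?thesis using gp(1,2) by (auto simp: pk approximant_def intro!: exI[of _ B])
    next
      case False
      then show ?thesis using cont(1) t unfolding other(1)[OF False] cont_enc_def by auto
    qed
  qed
  moreover have "cont_enc k n (q j)"
    unfolding cont_enc_def
  proof (intro allI impI)
    fix t assume t: "k \<le> t" "t < n"
    show "(\<forall>m. coord_continuous t (q j t m)) \<and> (\<exists>B. \<forall>m v. \<bar>q j t m v\<bar> \<le> B)"
    proof (cases "t = k")
      case True
      then show ?thesis using gq(1,2) by (auto simp: pk approximant_def intro!: exI[of _ B])
    next
      case False
      then show ?thesis using cont(2) t unfolding other(2)[OF False] cont_enc_def by auto
    qed
  qed
  ultimately show thesis using that[of "p j" "q j"] pm qm j by blast
qed

text \<open>Encoders are replaced from the last time backwards: an encoder that is already continuous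
  tolerates the small change of its feedback caused by the replacement of an earlier one.\<close>

lemma smooth_encoders:
  assumes meas: "meas_enc n p0" "meas_enc n q0" and h: "approximant n h"
    and cost: "costs_below h p0 q0 N 0 n m1 m2 Q1 Q2 E"
  obtains p q where "meas_enc n p" "meas_enc n q" "cont_enc 0 n p" "cont_enc 0 n q"
    "costs_below h p q N 0 n m1 m2 Q1 Q2 E"
proof -
  have "\<exists>p q. meas_enc n p \<and> meas_enc n q \<and> cont_enc k n p \<and> cont_enc k n q \<and>
      costs_below h p q N 0 n m1 m2 Q1 Q2 E" if "k \<le> n" for k
    using that
  proof (induction rule: inc_induct)
    case base
    then show ?case using meas cost by (intro exI[of _ p0] exI[of _ q0]) (auto simp: cont_enc_def)
  next
    case (step k)
    then obtain p q where pq: "meas_enc n p" "meas_enc n q" "cont_enc (Suc k) n p" "cont_enc (Suc k) n q"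
      "costs_below h p q N 0 n m1 m2 Q1 Q2 E" by blast
    obtain p' q' B where pq': "meas_enc n p'" "meas_enc n q'" "cont_enc (Suc k) n p'" "cont_enc (Suc k) n q'"
      "\<And>m v. \<bar>p' k m v\<bar> \<le> B" "\<And>m v. \<bar>q' k m v\<bar> \<le> B" "costs_below h p' q' N 0 n m1 m2 Q1 Q2 E"
      using clip_encoders_at[OF pq(1,2) h step.hyps(2) pq(3-5)] by metis
    from smooth_encoders_at[OF pq'(1,2) h step.hyps(2) pq'(3-7)] show ?case by metis
  qed
  from this[of 0] show thesis using that by blast
qed

section \<open>Stability under small feedback noise, uniformly in the covariance\<close>

lemma psd2_entries:
  assumes "psd2 K"
  shows "0 \<le> K$1$1" "0 \<le> K$2$2" "(K$1$2)\<^sup>2 \<le> K$1$1 * K$2$2"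
proof -
  have q: "0 \<le> x\<^sup>2 * K$1$1 + 2 * x * y * K$1$2 + y\<^sup>2 * K$2$2" for x y :: real
  proof -
    have "K$2$1 = K$1$2" using assms unfolding psd2_def transpose_def by (metis vec_lambda_beta)
    moreover have "0 \<le> vector [x, y] \<bullet> (K *v vector [x, y])" using assms unfolding psd2_def by blast
    ultimately show ?thesis
      by (simp add: inner_vec_def matrix_vector_mult_def sum_2 algebra_simps power2_eq_square)
  qed
  show a: "0 \<le> K$1$1" using q[of 1 0] by simp
  show b: "0 \<le> K$2$2" using q[of 0 1] by simp
  show "(K$1$2)\<^sup>2 \<le> K$1$1 * K$2$2"
  proof (cases "K$1$1 = 0")
    case True
    have "K$1$2 = 0"
    proof (rule ccontr)
      assume "K$1$2 \<noteq> 0"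
      \<comment> \<open>With \<open>K$1$1 = 0\<close> the quadratic form equals -1 at this
        point.\<close>
      then show False using q[of "- (K$2$2 + 1) / (2 * K$1$2)" 1] True by (simp add: field_simps)
    qed
    then show ?thesis using True by simp
  next
    case False
    with a have pos: "0 < K$1$1" by simp
    \<comment> \<open>The vector \<open>(- K$1$2, K$1$1)\<close> makes the quadratic form
      \<open>K$1$1\<close> times the determinant.\<close>
    have "0 \<le> K$1$1 * (K$1$1 * K$2$2 - (K$1$2)\<^sup>2)"
      using q[of "- (K$1$2)" "K$1$1"] by (simp add: algebra_simps power2_eq_square)
    then show ?thesis using pos by (simp add: zero_le_mult_iff)
  qed
qed

text \<open>The rows of the Cholesky factor have squared lengths \<open>K$1$1\<close> and
  \<open>K$2$2\<close>, so bounds on the diagonal control every coefficient whatever the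
  correlation. The bound holds pathwise and depends on \<open>K\<close> only through
  \<open>s2\<close>.\<close>

lemma feedback_noise_bound:
  assumes "psd2 K" "K$1$1 \<le> s2" "K$2$2 \<le> s2"
  shows "\<bar>W1n K \<omega> t\<bar> \<le> sqrt s2 * \<bar>\<omega> (t, 1)\<bar>"
    and "\<bar>W2n K \<omega> t\<bar> \<le> sqrt s2 * (\<bar>\<omega> (t, 1)\<bar> + \<bar>\<omega> (t, 2)\<bar>)"
proof -
  note e = psd2_entries[OF assms(1)]
  show "\<bar>W1n K \<omega> t\<bar> \<le> sqrt s2 * \<bar>\<omega> (t, 1)\<bar>"
    using assms(2) e(1) by (auto simp: W1n_def abs_mult intro!: mult_right_mono)
  show "\<bar>W2n K \<omega> t\<bar> \<le> sqrt s2 * (\<bar>\<omega> (t, 1)\<bar> + \<bar>\<omega> (t, 2)\<bar>)"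
  proof (cases "K$1$1 = 0")
    case True
    have "\<bar>W2n K \<omega> t\<bar> \<le> sqrt s2 * \<bar>\<omega> (t, 2)\<bar>"
      using assms(3) e(2) True by (auto simp: W2n_def abs_mult intro!: mult_right_mono)
    also have "\<dots> \<le> sqrt s2 * (\<bar>\<omega> (t, 1)\<bar> + \<bar>\<omega> (t, 2)\<bar>)"
      using assms e by (intro mult_left_mono) auto
    finally show ?thesis .
  next
    case False
    with e(1) have pos: "0 < K$1$1" by simp
    have "(K$1$2)\<^sup>2 \<le> K$1$1 * s2"
      using e(3) mult_left_mono[OF assms(3), of "K$1$1"] pos by linarith
    then have "(K$1$2 / sqrt (K$1$1))\<^sup>2 \<le> s2"
      using pos by (simp add: power_divide field_simps)
    then have c: "\<bar>K$1$2 / sqrt (K$1$1)\<bar> \<le> sqrt s2"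
      using real_le_rsqrt by (metis power2_abs)
    have "K$2$2 - (K$1$2)\<^sup>2 / K$1$1 \<le> s2"
      using assms(3) divide_nonneg_pos[OF zero_le_power2 pos, of "K$1$2"] by linarith
    moreover have "0 \<le> K$2$2 - (K$1$2)\<^sup>2 / K$1$1"
      using e(3) pos by (simp add: pos_divide_le_eq mult.commute)
    ultimately have d: "\<bar>sqrt (K$2$2 - (K$1$2)\<^sup>2 / K$1$1)\<bar> \<le> sqrt s2" by simp
    have "\<bar>W2n K \<omega> t\<bar> \<le> \<bar>K$1$2 / sqrt (K$1$1)\<bar> * \<bar>\<omega> (t, 1)\<bar>
        + \<bar>sqrt (K$2$2 - (K$1$2)\<^sup>2 / K$1$1)\<bar> * \<bar>\<omega> (t, 2)\<bar>"
      using False unfolding W2n_def by (simp only: if_False abs_mult[symmetric] abs_triangle_ineq)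
    also have "\<dots> \<le> sqrt s2 * \<bar>\<omega> (t, 1)\<bar> + sqrt s2 * \<bar>\<omega> (t, 2)\<bar>"
      using c d by (intro add_mono mult_right_mono) auto
    finally show ?thesis by (simp add: distrib_left)
  qed
qed

text \<open>If no threshold worked, there would be bad covariances with diagonals at most
  \<open>1 / (j + 1)\<close>. Their noise tends to 0 pointwise, hence so does the change of
  trajectories and costs, contradicting the strict bounds at \<open>K = 0\<close>. Arguing along a
  sequence gives uniformity over all admissible covariances.\<close>

lemma costs_stable_small_noise:
  assumes meas: "meas_enc n p" "meas_enc n q" and h: "approximant n h"
    and cont: "cont_enc 0 n p" "cont_enc 0 n q"
    and cost: "costs_below h p q N 0 n m1 m2 Q1 Q2 E"
  shows "\<exists>s2>0. \<forall>K. psd2 K \<and> K$1$1 \<le> s2 \<and> K$2$2 \<le> s2 \<longrightarrow> costs_below h p q N K n m1 m2 Q1 Q2 E"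
proof (rule ccontr)
  assume neg: "\<not> ?thesis"
  have "\<exists>K. psd2 K \<and> K$1$1 \<le> inverse (real (Suc j)) \<and> K$2$2 \<le> inverse (real (Suc j)) \<and>
      \<not> costs_below h p q N K n m1 m2 Q1 Q2 E" for j
  proof -
    have "inverse (real (Suc j)) > 0" by simp
    with neg show ?thesis by blast
  qed
  then obtain K where K: "\<And>j. psd2 (K j)" "\<And>j. K j$1$1 \<le> inverse (real (Suc j))"
      "\<And>j. K j$2$2 \<le> inverse (real (Suc j))" and bad: "\<And>j. \<not> costs_below h p q N (K j) n m1 m2 Q1 Q2 E"
    by metis
  interpret prob_space "noise_space n" by (rule prob_space_noise)
  have s: "(\<lambda>j. sqrt (inverse (real (Suc j))) * c) \<longlonglongrightarrow> 0" for c
    using tendsto_mult_right[OF tendsto_real_sqrt[OF LIMSEQ_inverse_real_of_nat], of c] by (simp add: mult.commute)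
  have W1: "(\<lambda>j. W1n (K j) \<omega> t) \<longlonglongrightarrow> 0" for \<omega> t
    by (rule tendsto_rabs_zero_cancel, rule tendsto_sandwich[OF _ _ tendsto_const s[of "\<bar>\<omega> (t, 1)\<bar>"]])
      (use feedback_noise_bound(1)[OF K] in auto)
  have W2: "(\<lambda>j. W2n (K j) \<omega> t) \<longlonglongrightarrow> 0" for \<omega> t
    by (rule tendsto_rabs_zero_cancel, rule tendsto_sandwich[OF _ _ tendsto_const s[of "\<bar>\<omega> (t, 1)\<bar> + \<bar>\<omega> (t, 2)\<bar>"]])
      (use feedback_noise_bound(2)[OF K] in auto)
  have conv: "(\<lambda>j. X1 p q N (K j) a b \<omega> t) \<longlonglongrightarrow> X1 p q N 0 a b \<omega> t \<and>
      (\<lambda>j. X2 p q N (K j) a b \<omega> t) \<longlonglongrightarrow> X2 p q N 0 a b \<omega> t \<and>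
      (\<lambda>j. yout p q N (K j) a b \<omega> t) \<longlonglongrightarrow> yout p q N 0 a b \<omega> t" if "t < n" for a b \<omega> t
    using that
  proof (rule outputs_tendsto)
    fix t assume t: "t < n"
      and IH: "\<And>s. s < t \<Longrightarrow> (\<lambda>j. yout p q N (K j) a b \<omega> s) \<longlonglongrightarrow> yout p q N 0 a b \<omega> s"
    have c: "coord_continuous t (p t a)" "coord_continuous t (q t b)"
      using cont t unfolding cont_enc_def by auto
    show "(\<lambda>j. X1 p q N (K j) a b \<omega> t) \<longlonglongrightarrow> X1 p q N 0 a b \<omega> t \<and>
          (\<lambda>j. X2 p q N (K j) a b \<omega> t) \<longlonglongrightarrow> X2 p q N 0 a b \<omega> t"
      unfolding X1_eq X2_eq
      by (intro conjI coord_continuous_restrictD[OF c(1)] coord_continuous_restrictD[OF c(2)] tendsto_add IH)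
        (simp_all add: W1 W2)
  qed
  obtain Bp where Bp: "\<And>t m v. t < n \<Longrightarrow> \<bar>p t m v\<bar> \<le> Bp t"
    using cont(1) unfolding cont_enc_def by (metis le0)
  obtain Bq where Bq: "\<And>t m v. t < n \<Longrightarrow> \<bar>q t m v\<bar> \<le> Bq t"
    using cont(2) unfolding cont_enc_def by (metis le0)
  have sq: "x\<^sup>2 \<le> c\<^sup>2" if "\<bar>x\<bar> \<le> c" for x c :: real
    using that power_mono[OF that, of 2] by simp
  have X1B: "(X1 p q N (K j) a b \<omega> t)\<^sup>2 \<le> (Bp t)\<^sup>2" and X2B: "(X2 p q N (K j) a b \<omega> t)\<^sup>2 \<le> (Bq t)\<^sup>2"
    if "t < n" for j a b \<omega> t
    unfolding X1_eq X2_eq using that by (auto intro!: sq Bp Bq)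
  note cm = channel_measurable[OF meas]
  have "(\<lambda>j. power1 p q N (K j) n m1 m2) \<longlonglongrightarrow> power1 p q N 0 n m1 m2"
    unfolding power1_def
    by (rule power_tendsto[where D = "\<lambda>a b t \<omega>. (Bp t)\<^sup>2"])
      (use cm conv in \<open>auto intro!: X1B simp: emeasure_space_1\<close>)
  then have 1: "\<forall>\<^sub>F j in sequentially. power1 p q N (K j) n m1 m2 < Q1"
    by (rule order_tendstoD(2)) (use cost in \<open>simp add: costs_below_def\<close>)
  have "(\<lambda>j. power2 p q N (K j) n m1 m2) \<longlonglongrightarrow> power2 p q N 0 n m1 m2"
    unfolding power2_def
    by (rule power_tendsto[where D = "\<lambda>a b t \<omega>. (Bq t)\<^sup>2"])
      (use cm conv in \<open>auto intro!: X2B simp: emeasure_space_1\<close>)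
  then have 2: "\<forall>\<^sub>F j in sequentially. power2 p q N (K j) n m1 m2 < Q2"
    by (rule order_tendstoD(2)) (use cost in \<open>simp add: costs_below_def\<close>)
  from h have hm: "h \<in> borel_measurable (PiM {..<n} (\<lambda>_. borel))" and hc: "coord_continuous n h"
    by (auto simp: approximant_def)
  have "(\<lambda>j. total_loss h p q N (K j) n m1 m2) \<longlonglongrightarrow> total_loss h p q N 0 n m1 m2"
    by (rule loss_tendsto[OF meas meas hm hm])
      (use conv in \<open>auto intro!: AE_I2 coord_continuous_restrictD[OF hc]\<close>)
  then have 3: "\<forall>\<^sub>F j in sequentially. total_loss h p q N (K j) n m1 m2 < E"
    by (rule order_tendstoD(2)) (use cost in \<open>simp add: costs_below_def\<close>)
  from eventually_conj[OF 1 eventually_conj[OF 2 3]] have "\<exists>j. costs_below h p q N (K j) n m1 m2 Q1 Q2 E"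
    unfolding costs_below_def eventually_sequentially by blast
  with bad show False by blast
qed

section \<open>Continuous decoding statistics and the robust inner code\<close>

text \<open>The decoder becomes a bounded real function \<open>f\<close> by numbering message pairs.
  Its soft loss is exactly the error indicator, and approximating \<open>f\<close> almost everywhere
  changes the total loss arbitrarily little.\<close>

lemma soft_decoder:
  assumes meas: "meas_enc n p" "meas_enc n q"
    and dec: "dec \<in> measurable (PiM {..<n} (\<lambda>_. borel)) (count_space UNIV)"
    and err: "(\<Sum>a<m1. \<Sum>b<m2. measure (noise_space n) {\<omega> \<in> space (noise_space n).
        dec (restrict (yout p q N 0 a b \<omega>) {..<n}) \<noteq> (a, b)}) < e"
  obtains h where "approximant n h" "total_loss h p q N 0 n m1 m2 < ennreal e"
proof -
  interpret prob_space "noise_space n" by (rule prob_space_noise)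
  let ?c = "\<lambda>x. real (prod_encode x)"
  \<comment> \<open>The cap makes \<open>f\<close> bounded. It exceeds the number of every valid
    pair by at least 1, so a wrong decision stays at distance at least 1 from the true number even
    after capping.\<close>
  define B where "B = 1 + (\<Sum>x\<in>{..<m1} \<times> {..<m2}. ?c x)"
  have cB: "?c (a, b) \<le> B - 1" if "a < m1" "b < m2" for a b
    unfolding B_def using member_le_sum[of "(a, b)" "{..<m1} \<times> {..<m2}" ?c] that by auto
  have B0: "B \<ge> 0" unfolding B_def by (simp add: sum_nonneg)
  define f where "f v = min (?c (dec v)) B" for v
  have fm: "f \<in> borel_measurable (PiM {..<n} (\<lambda>_. borel))"
  proof -
    have "(\<lambda>x. min (?c x) B) \<in> borel_measurable (count_space UNIV)" by simp
    from measurable_compose[OF dec this] show ?thesis unfolding f_def[abs_def] .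
  qed
  have fB: "\<bar>f v\<bar> \<le> B" for v using B0 by (auto simp: f_def)
  have sl: "soft_loss f a b v = indicator {v. dec v \<noteq> (a, b)} v" if ab: "a < m1" "b < m2" for a b v
  proof (cases "dec v = (a, b)")
    case True
    then show ?thesis using cB[OF ab] by (simp add: soft_loss_def f_def)
  next
    case False
    then have "prod_encode (dec v) \<noteq> prod_encode (a, b)" using inj_prod_encode[of UNIV] by (auto dest: injD)
    then have "\<bar>?c (dec v) - ?c (a, b)\<bar> \<ge> 1" by linarith
    then have "\<bar>f v - ?c (a, b)\<bar> \<ge> 1" using cB[OF ab] unfolding f_def by linarith
    then show ?thesis using False by (simp add: soft_loss_def)
  qed
  have outm: "(\<lambda>\<omega>. restrict (yout p q N 0 a b \<omega>) {..<n}) \<in> noise_space n \<rightarrow>\<^sub>M PiM {..<n} (\<lambda>_. borel)" for a b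
    by (rule output_measurable[OF meas order_refl])
  have errm: "{\<omega> \<in> space (noise_space n). dec (restrict (yout p q N 0 a b \<omega>) {..<n}) \<noteq> (a, b)} \<in> events" for a b
    using measurable_sets[OF measurable_compose[OF outm dec], of "- {(a, b)}" a b]
    by (simp add: vimage_def Int_def conj_commute)
  have "total_loss f p q N 0 n m1 m2 = (\<Sum>a<m1. \<Sum>b<m2. ennreal (measure (noise_space n) {\<omega> \<in> space (noise_space n).
        dec (restrict (yout p q N 0 a b \<omega>) {..<n}) \<noteq> (a, b)}))"
    unfolding total_loss_def
  proof (intro sum.cong refl)
    fix a b assume "a \<in> {..<m1}" "b \<in> {..<m2}"
    then have "(\<integral>\<^sup>+ \<omega>. ennreal (soft_loss f a b (restrict (yout p q N 0 a b \<omega>) {..<n})) \<partial>noise_space n)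
      = (\<integral>\<^sup>+ \<omega>. indicator {\<omega> \<in> space (noise_space n).
        dec (restrict (yout p q N 0 a b \<omega>) {..<n}) \<noteq> (a, b)} \<omega> \<partial>noise_space n)"
      by (intro nn_integral_cong) (auto simp: sl indicator_def)
    also have "\<dots> = emeasure (noise_space n) {\<omega> \<in> space (noise_space n).
        dec (restrict (yout p q N 0 a b \<omega>) {..<n}) \<noteq> (a, b)}"
      by (rule nn_integral_indicator[OF errm])
    finally show "(\<integral>\<^sup>+ \<omega>. ennreal (soft_loss f a b (restrict (yout p q N 0 a b \<omega>) {..<n})) \<partial>noise_space n)
      = ennreal (measure (noise_space n) {\<omega> \<in> space (noise_space n).
        dec (restrict (yout p q N 0 a b \<omega>) {..<n}) \<noteq> (a, b)})"
      by (simp add: emeasure_eq_measure)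
  qed
  also have "\<dots> < ennreal e"
    using err by (simp add: sum_nonneg ennreal_lessI order.strict_trans1[OF _ err])
  finally have lf: "total_loss f p q N 0 n m1 m2 < ennreal e" .
  show thesis
  proof (rule AE_approximation_family[of "{..<m1} \<times> {..<m2}" "noise_space n"
        "\<lambda>x \<omega>. restrict (yout p q N 0 (fst x) (snd x) \<omega>) {..<n}" n f B])
    fix g assume g: "\<And>j::nat. approximant n (g j)"
      "\<And>x. x \<in> {..<m1} \<times> {..<m2} \<Longrightarrow> AE \<omega> in noise_space n. (\<lambda>j. g j (restrict (yout p q N 0 (fst x) (snd x) \<omega>) {..<n}))
        \<longlonglongrightarrow> f (restrict (yout p q N 0 (fst x) (snd x) \<omega>) {..<n})"
    have gm: "g j \<in> borel_measurable (PiM {..<n} (\<lambda>_. borel))" for j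
      using g(1)[of j] by (simp add: approximant_def)
    have "(\<lambda>j. total_loss (g j) p q N 0 n m1 m2) \<longlonglongrightarrow> total_loss f p q N 0 n m1 m2"
    proof (rule loss_tendsto[OF meas meas gm fm])
      fix a b assume "a < m1" "b < m2"
      then show "AE \<omega> in noise_space n. (\<lambda>j. g j (restrict (yout p q N 0 a b \<omega>) {..<n}))
          \<longlonglongrightarrow> f (restrict (yout p q N 0 a b \<omega>) {..<n})"
        using g(2)[of "(a, b)"] by simp
    qed
    from order_tendstoD(2)[OF this lf] obtain j where "total_loss (g j) p q N 0 n m1 m2 < ennreal e"
      unfolding eventually_sequentially by blast
    then show thesis using that g(1) by blast
  qed (use outm fm fB in \<open>auto simp: finite_measure_axioms\<close>)
qed

text \<open>A negative rounded value is turned into 0 by \<open>nat\<close> and read as the pair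
  \<open>(0, 0)\<close>; there \<open>h\<close> is below -1/2 and the soft loss is 1 for every pair
  anyway.\<close>

definition rounding_decoder :: "((nat \<Rightarrow> real) \<Rightarrow> real) \<Rightarrow> (nat \<Rightarrow> real) \<Rightarrow> nat \<times> nat" where
  "rounding_decoder h v = prod_decode (nat \<lfloor>h v + 1 / 2\<rfloor>)"

lemma rounding_decoder_measurable:
  assumes [measurable]: "h \<in> borel_measurable (PiM {..<n} (\<lambda>_. borel))"
  shows "rounding_decoder h \<in> measurable (PiM {..<n} (\<lambda>_. borel)) (count_space UNIV)"
proof -
  have "(\<lambda>v. \<lfloor>h v + 1 / 2\<rfloor>) \<in> measurable (PiM {..<n} (\<lambda>_. borel)) (count_space UNIV)"
    by measurable
  then have "(\<lambda>v. prod_decode (nat \<lfloor>h v + 1 / 2\<rfloor>)) \<in> measurable (PiM {..<n} (\<lambda>_. borel)) (count_space UNIV)"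
    by (rule measurable_compose) simp
  then show ?thesis unfolding rounding_decoder_def[abs_def] .
qed

lemma rounding_decoder_error_le: "indicator {v. rounding_decoder h v \<noteq> (a, b)} v \<le> soft_loss h a b v"
proof (cases "soft_loss h a b v < 1")
  case True
  then have "\<bar>h v - real (prod_encode (a, b))\<bar> < 1 / 2"
    unfolding soft_loss_def by (simp add: min_less_iff_disj)
  then have "\<lfloor>h v + 1 / 2\<rfloor> = int (prod_encode (a, b))" by linarith
  then have "rounding_decoder h v = (a, b)" by (simp add: rounding_decoder_def)
  then show ?thesis using soft_loss_bounds by simp
next
  case False
  then show ?thesis using soft_loss_bounds[of h a b v] by (auto simp: indicator_def)
qed

lemma is_code_iff:
  "is_code P1 P2 N K n m1 m2 phi1 phi2 dec \<longleftrightarrow> 0 < m1 \<and> 0 < m2 \<and> meas_enc n phi1 \<and> meas_enc n phi2 \<and>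
     dec \<in> measurable (PiM {..<n} (\<lambda>_. borel)) (count_space UNIV) \<and>
     power1 phi1 phi2 N K n m1 m2 \<le> ennreal (real n * real m1 * real m2 * P1) \<and>
     power2 phi1 phi2 N K n m1 m2 \<le> ennreal (real n * real m1 * real m2 * P2)"
  unfolding is_code_def meas_enc_def power1_def power2_def ..

lemma err_prob_eq:
  "err_prob N K n m1 m2 phi1 phi2 dec = (\<Sum>a<m1. \<Sum>b<m2. measure (noise_space n)
      {\<omega> \<in> space (noise_space n). dec (restrict (yout phi1 phi2 N K a b \<omega>) {..<n}) \<noteq> (a, b)})
     / (real m1 * real m2)"
  unfolding err_prob_def restrict_out_seq ..

lemma rounding_err_prob_less:
  assumes meas: "meas_enc n p" "meas_enc n q" and hm: "h \<in> borel_measurable (PiM {..<n} (\<lambda>_. borel))"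
    and m: "0 < m1" "0 < m2" and loss: "total_loss h p q N K n m1 m2 < ennreal (real m1 * real m2 * e)"
  shows "err_prob N K n m1 m2 p q (rounding_decoder h) < e"
proof -
  interpret prob_space "noise_space n" by (rule prob_space_noise)
  let ?A = "\<lambda>a b. {\<omega> \<in> space (noise_space n). rounding_decoder h (restrict (yout p q N K a b \<omega>) {..<n}) \<noteq> (a, b)}"
  have outm: "(\<lambda>\<omega>. restrict (yout p q N K a b \<omega>) {..<n}) \<in> noise_space n \<rightarrow>\<^sub>M PiM {..<n} (\<lambda>_. borel)" for a b
    by (rule output_measurable[OF meas order_refl])
  have errm: "?A a b \<in> events" for a b
    using measurable_sets[OF measurable_compose[OF outm rounding_decoder_measurable[OF hm]], of "- {(a, b)}" a b]
    by (simp add: vimage_def Int_def conj_commute)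
  have "ennreal (measure (noise_space n) (?A a b))
      \<le> (\<integral>\<^sup>+ \<omega>. ennreal (soft_loss h a b (restrict (yout p q N K a b \<omega>) {..<n})) \<partial>noise_space n)" for a b
  proof -
    have "ennreal (measure (noise_space n) (?A a b)) = (\<integral>\<^sup>+ \<omega>. indicator (?A a b) \<omega> \<partial>noise_space n)"
      using errm by (simp add: emeasure_eq_measure)
    also have "\<dots> \<le> (\<integral>\<^sup>+ \<omega>. ennreal (soft_loss h a b (restrict (yout p q N K a b \<omega>) {..<n})) \<partial>noise_space n)"
    proof (rule nn_integral_mono)
      fix \<omega>
      let ?v = "restrict (yout p q N K a b \<omega>) {..<n}"
      have "indicator (?A a b) \<omega> \<le> ennreal (indicator {v. rounding_decoder h v \<noteq> (a, b)} ?v)"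
        by (auto simp: indicator_def)
      also have "\<dots> \<le> ennreal (soft_loss h a b ?v)"
        by (rule ennreal_leI[OF rounding_decoder_error_le])
      finally show "indicator (?A a b) \<omega> \<le> ennreal (soft_loss h a b ?v)" .
    qed
    finally show ?thesis .
  qed
  then have "(\<Sum>a<m1. \<Sum>b<m2. ennreal (measure (noise_space n) (?A a b))) \<le> total_loss h p q N K n m1 m2"
    unfolding total_loss_def by (intro sum_mono)
  also note loss
  finally have "ennreal (\<Sum>a<m1. \<Sum>b<m2. measure (noise_space n) (?A a b)) < ennreal (real m1 * real m2 * e)"
    by (simp add: sum_nonneg)
  then have "(\<Sum>a<m1. \<Sum>b<m2. measure (noise_space n) (?A a b)) < real m1 * real m2 * e"
    by (simp add: ennreal_less_iff sum_nonneg)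
  then show ?thesis unfolding err_prob_eq using m by (simp add: field_simps)
qed

text \<open>The order of quantifiers is the point: a single code serves all covariances below the
  threshold. The decoder is made continuous before the encoders, since the replacement of encoders
  relies on a continuous \<open>h\<close>. The gaps between \<open>P1\<close> and \<open>P1'\<close>
  and between \<open>P2\<close> and \<open>P2'\<close> make the power bounds strict.\<close>

theorem robust_code:
  assumes code: "is_code P1 P2 N 0 n m1 m2 phi1 phi2 dec" and err: "err_prob N 0 n m1 m2 phi1 phi2 dec < e"
    and n: "0 < n" and P: "0 < P1" "P1 < P1'" "0 < P2" "P2 < P2'"
  obtains s2 psi1 psi2 d where "s2 > 0"
    "\<And>K. \<lbrakk>psd2 K; K$1$1 \<le> s2; K$2$2 \<le> s2\<rbrakk> \<Longrightarrow>
       is_code P1' P2' N K n m1 m2 psi1 psi2 d \<and> err_prob N K n m1 m2 psi1 psi2 d < e"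
proof -
  from code have m: "0 < m1" "0 < m2" and meas: "meas_enc n phi1" "meas_enc n phi2"
    and dec: "dec \<in> measurable (PiM {..<n} (\<lambda>_. borel)) (count_space UNIV)"
    and pw: "power1 phi1 phi2 N 0 n m1 m2 \<le> ennreal (real n * real m1 * real m2 * P1)"
     "power2 phi1 phi2 N 0 n m1 m2 \<le> ennreal (real n * real m1 * real m2 * P2)"
    unfolding is_code_iff by auto
  let ?Q1 = "ennreal (real n * real m1 * real m2 * P1')" and ?Q2 = "ennreal (real n * real m1 * real m2 * P2')"
  let ?E = "real m1 * real m2 * e"
  have "(\<Sum>a<m1. \<Sum>b<m2. measure (noise_space n) {\<omega> \<in> space (noise_space n).
        dec (restrict (yout phi1 phi2 N 0 a b \<omega>) {..<n}) \<noteq> (a, b)}) < ?E"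
    using err m unfolding err_prob_eq by (simp add: field_simps)
  from soft_decoder[OF meas dec this] obtain h where
    h: "approximant n h" "total_loss h phi1 phi2 N 0 n m1 m2 < ennreal ?E" by blast
  have "ennreal (real n * real m1 * real m2 * P1) < ?Q1" "ennreal (real n * real m1 * real m2 * P2) < ?Q2"
    using n m P by (auto intro!: ennreal_lessI)
  then have "costs_below h phi1 phi2 N 0 n m1 m2 ?Q1 ?Q2 (ennreal ?E)"
    unfolding costs_below_def using pw h(2) by (auto intro: order.strict_trans1)
  from smooth_encoders[OF meas h(1) this] obtain p q where
    pq: "meas_enc n p" "meas_enc n q" "cont_enc 0 n p" "cont_enc 0 n q"
    "costs_below h p q N 0 n m1 m2 ?Q1 ?Q2 (ennreal ?E)" by blast
  from costs_stable_small_noise[OF pq(1,2) h(1) pq(3-5)] obtain s2 where s2: "s2 > 0"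
    "\<And>K. \<lbrakk>psd2 K; K$1$1 \<le> s2; K$2$2 \<le> s2\<rbrakk> \<Longrightarrow> costs_below h p q N K n m1 m2 ?Q1 ?Q2 (ennreal ?E)" by blast
  have hm: "h \<in> borel_measurable (PiM {..<n} (\<lambda>_. borel))" using h(1) by (simp add: approximant_def)
  show thesis
  proof (rule that[OF s2(1), of p q "rounding_decoder h"])
    fix K assume "psd2 K" "K$1$1 \<le> s2" "K$2$2 \<le> s2"
    from s2(2)[OF this] have c: "costs_below h p q N K n m1 m2 ?Q1 ?Q2 (ennreal ?E)" .
    then show "is_code P1' P2' N K n m1 m2 p q (rounding_decoder h) \<and> err_prob N K n m1 m2 p q (rounding_decoder h) < e"
      using m pq(1,2) rounding_decoder_measurable[OF hm] rounding_err_prob_less[OF pq(1,2) hm m]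
      unfolding is_code_iff costs_below_def by auto
  qed
qed

section \<open>Outer codes\<close>

definition words :: "nat \<Rightarrow> nat \<Rightarrow> (nat \<Rightarrow> nat) set" where
  "words L m = {..<L} \<rightarrow>\<^sub>E {..<m}"

definition hdist :: "nat \<Rightarrow> (nat \<Rightarrow> nat) \<Rightarrow> (nat \<Rightarrow> nat) \<Rightarrow> nat" where
  "hdist L x y = card {l. l < L \<and> x l \<noteq> y l}"

text \<open>Translation by \<open>s\<close> in the group (Z/m)^L. The argument \<open>s\<close> need
  not be a word itself; in particular it may be a constant function.\<close>

definition add_word :: "nat \<Rightarrow> nat \<Rightarrow> (nat \<Rightarrow> nat) \<Rightarrow> (nat \<Rightarrow> nat) \<Rightarrow> (nat \<Rightarrow> nat)" where
  "add_word L m s x = restrict (\<lambda>l. (x l + s l) mod m) {..<L}"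

definition shift_closed :: "nat \<Rightarrow> nat \<Rightarrow> (nat \<Rightarrow> nat) set \<Rightarrow> bool" where
  "shift_closed L m C \<longleftrightarrow> (\<forall>x\<in>C. \<forall>c. add_word L m (\<lambda>_. c) x \<in> C)"

lemma finite_words [simp]: "finite (words L m)"
  by (simp add: words_def finite_PiE)

lemma card_words: "card (words L m) = m ^ L"
  by (simp add: words_def card_PiE)

lemma words_less: "x \<in> words L m \<Longrightarrow> l < L \<Longrightarrow> x l < m"
  by (auto simp: words_def PiE_def)

lemma words_eqI: "x \<in> words L m \<Longrightarrow> y \<in> words L m \<Longrightarrow> (\<And>l. l < L \<Longrightarrow> x l = y l) \<Longrightarrow> x = y"
  unfolding words_def by (rule PiE_ext) auto

lemma add_word_in_words: "0 < m \<Longrightarrow> add_word L m s x \<in> words L m"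
  by (auto simp: words_def add_word_def)

lemma add_word_nth: "l < L \<Longrightarrow> add_word L m s x l = (x l + s l) mod m"
  by (simp add: add_word_def)

lemma add_word_assoc: "add_word L m s (add_word L m t x) = add_word L m (\<lambda>l. s l + t l) x"
  by (auto simp: add_word_def restrict_def mod_simps ac_simps)

lemma add_word_zero: "x \<in> words L m \<Longrightarrow> (\<And>l. l < L \<Longrightarrow> s l mod m = 0) \<Longrightarrow> add_word L m s x = x"
proof (rule words_eqI[where L = L and m = m])
  assume x: "x \<in> words L m" and s: "\<And>l. l < L \<Longrightarrow> s l mod m = 0"
  show "add_word L m s x \<in> words L m"
  proof (cases "m = 0 \<and> L > 0")
    case True
    then show ?thesis using words_less[OF x, of 0] by simp
  next
    case False
    then show ?thesis by (auto simp: words_def add_word_def)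
  qed
  show "add_word L m s x l = x l" if "l < L" for l
    using words_less[OF x that] s[OF that] by (simp add: add_word_nth that mod_add_eq[symmetric, of _ "s l"])
qed

lemma add_mod_eq_iff: "(a + c) mod m = (b + c) mod m \<longleftrightarrow> a mod m = b mod m" for a b c m :: nat
  by (simp add: mod_eq_iff_dvd_symdiff_nat)

lemma add_mod_cancel: "a < m \<Longrightarrow> b < m \<Longrightarrow> (a + c) mod m = (b + c) mod m \<longleftrightarrow> a = b" for a b c m :: nat
  by (simp add: add_mod_eq_iff)

lemma hdist_add_word:
  assumes "x \<in> words L m" "y \<in> words L m"
  shows "hdist L (add_word L m s x) (add_word L m s y) = hdist L x y"
  unfolding hdist_def
  by (rule arg_cong[where f = card])
    (use assms in \<open>auto simp: add_word_nth add_mod_cancel[OF words_less words_less]\<close>)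

lemma inj_on_add_word: "inj_on (add_word L m s) (words L m)"
proof (rule inj_onI)
  fix x y assume xy: "x \<in> words L m" "y \<in> words L m" "add_word L m s x = add_word L m s y"
  show "x = y"
  proof (rule words_eqI[OF xy(1,2)])
    fix l assume "l < L"
    then show "x l = y l"
      using fun_cong[OF xy(3), of l] xy(1,2) by (simp add: add_word_nth add_mod_cancel words_less)
  qed
qed

text \<open>With \<open>x\<close> fixed and \<open>s\<close> uniform over all words, the translate
  of \<open>x\<close> is uniform too; the averaging over random translates rests on this.\<close>

lemma inj_on_add_word_left: "inj_on (\<lambda>s. add_word L m s x) (words L m)"
proof (rule inj_onI)
  fix s t assume st: "s \<in> words L m" "t \<in> words L m" "add_word L m s x = add_word L m t x"
  show "s = t"
  proof (rule words_eqI[OF st(1,2)])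
    fix l assume "l < L"
    then show "s l = t l"
      using fun_cong[OF st(3), of l] st(1,2) by (simp add: add_word_nth add_mod_cancel words_less add.commute[of "x l"])
  qed
qed

section \<open>Gilbert-Varshamov codes invariant under constant shifts\<close>

text \<open>There are at most \<open>2 ^ L\<close> candidates for the set of positions where
  \<open>x\<close> differs from \<open>y\<close>, and fewer than \<open>d\<close> positions leave at
  most \<open>m ^ d\<close> choices. The crude factor \<open>2 ^ L\<close> replaces an entropy
  estimate.\<close>

lemma card_hamming_ball:
  assumes "0 < m"
  shows "card {x \<in> words L m. hdist L x y < d} \<le> 2 ^ L * m ^ d"
proof -
  let ?D = "{D. D \<subseteq> {..<L} \<and> card D < d}"
  let ?B = "\<lambda>D. {x \<in> words L m. \<forall>l\<in>{..<L} - D. x l = y l}"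
  have "card {x \<in> words L m. hdist L x y < d} \<le> card (\<Union>D\<in>?D. ?B D)"
  proof (rule card_mono)
    show "{x \<in> words L m. hdist L x y < d} \<subseteq> (\<Union>D\<in>?D. ?B D)"
    proof
      fix x assume x: "x \<in> {x \<in> words L m. hdist L x y < d}"
      then have "{l. l < L \<and> x l \<noteq> y l} \<in> ?D" by (auto simp: hdist_def)
      then show "x \<in> (\<Union>D\<in>?D. ?B D)" using x by (intro UN_I) auto
    qed
  qed auto
  also have "\<dots> \<le> (\<Sum>D\<in>?D. card (?B D))" by (rule card_UN_le) auto
  also have "\<dots> \<le> (\<Sum>D\<in>?D. m ^ d)"
  proof (rule sum_mono)
    fix D assume D: "D \<in> ?D"
    have fD: "finite D" using D finite_subset by auto
    have "card (?B D) \<le> card (D \<rightarrow>\<^sub>E {..<m})"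
    proof (rule card_inj_on_le)
      show "inj_on (\<lambda>x. restrict x D) (?B D)"
      proof (rule inj_onI)
        fix x z assume xz: "x \<in> ?B D" "z \<in> ?B D" "restrict x D = restrict z D"
        show "x = z"
        proof (rule words_eqI[where L = L and m = m])
          fix l assume "l < L"
          have "restrict x D l = restrict z D l" using xz(3) by simp
          then show "x l = z l" using xz(1,2) \<open>l < L\<close> by (cases "l \<in> D") auto
        qed (use xz in auto)
      qed
      show "(\<lambda>x. restrict x D) ` ?B D \<subseteq> D \<rightarrow>\<^sub>E {..<m}"
        using D by (auto dest: words_less)
    qed (auto simp: finite_PiE fD)
    also have "\<dots> = m ^ card D" by (simp add: card_PiE fD)
    also have "\<dots> \<le> m ^ d" using D assms by (intro power_increasing) auto
    finally show "card (?B D) \<le> m ^ d" .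
  qed
  also have "\<dots> \<le> card (Pow {..<L}) * m ^ d"
    unfolding sum_constant of_nat_id by (intro mult_right_mono card_mono) auto
  finally show ?thesis by (simp add: card_Pow)
qed

definition min_dist :: "nat \<Rightarrow> nat \<Rightarrow> (nat \<Rightarrow> nat) set \<Rightarrow> bool" where
  "min_dist L d C \<longleftrightarrow> (\<forall>x\<in>C. \<forall>y\<in>C. x \<noteq> y \<longrightarrow> d \<le> hdist L x y)"

lemma hdist_commute: "hdist L x y = hdist L y x"
  unfolding hdist_def by (metis (lifting))

text \<open>Gilbert--Varshamov: a maximal code among those that are also invariant under adding constant
  words covers all words by balls of radius less than \<open>d\<close>.\<close>

lemma exists_shift_closed_code:
  assumes m: "0 < m" and d: "0 < d" "d \<le> L"
  obtains C where "C \<subseteq> words L m" "min_dist L d C" "shift_closed L m C"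
    "m ^ L \<le> card C * (2 ^ L * m ^ d)"
proof -
  let ?F = "{C. C \<subseteq> words L m \<and> min_dist L d C \<and> shift_closed L m C}"
  have fin: "finite ?F" by (rule finite_subset[of _ "Pow (words L m)"]) auto
  have "{} \<in> ?F" by (simp add: min_dist_def shift_closed_def)
  then have ne: "?F \<noteq> {}" by blast
  from finite_has_maximal[OF fin ne] obtain C where C: "C \<in> ?F" and mx: "\<forall>C'\<in>?F. C \<subseteq> C' \<longrightarrow> C = C'" ..
  have max: "C = C'" if "C' \<subseteq> words L m" "min_dist L d C'" "shift_closed L m C'" "C \<subseteq> C'" for C'
    using bspec[OF mx, of C'] that by simp
  have cover: "\<exists>y\<in>C. hdist L x y < d" if x: "x \<in> words L m" for x
  proof (rule ccontr)
    assume "\<not> ?thesis"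
    then have far: "\<And>y. y \<in> C \<Longrightarrow> d \<le> hdist L x y" by auto
    \<comment> \<open>A word far from \<open>C\<close> is added together with its orbit under
      constant shifts, so that the enlarged code is again shift closed.\<close>
    let ?O = "range (\<lambda>c. add_word L m (\<lambda>_. c) x)"
    have xO: "x \<in> ?O"
      by (rule range_eqI[of _ _ 0], rule add_word_zero[symmetric, OF x]) simp
    \<comment> \<open>Distinct constant shifts of the same word differ in every position, so their
      distance is \<open>L\<close>.\<close>
    have OO: "d \<le> hdist L (add_word L m (\<lambda>_. c) x) (add_word L m (\<lambda>_. c') x)"
      if "add_word L m (\<lambda>_. c) x \<noteq> add_word L m (\<lambda>_. c') x" for c c'
    proof -
      have "(x l + c) mod m \<noteq> (x l + c') mod m" for l
      proof
        assume "(x l + c) mod m = (x l + c') mod m"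
        then have "c mod m = c' mod m" by (simp only: add.commute[of "x l"] add_mod_eq_iff)
        then have "(a + c) mod m = (a + c') mod m" for a by (simp only: add.commute[of a] add_mod_eq_iff)
        then show False using that by (simp add: add_word_def)
      qed
      then have "{l. l < L \<and> add_word L m (\<lambda>_. c) x l \<noteq> add_word L m (\<lambda>_. c') x l} = {..<L}"
        by (auto simp: add_word_nth)
      then show ?thesis using d by (simp add: hdist_def)
    qed
    \<comment> \<open>Distances are translation invariant, so a shifted \<open>x\<close> is as far
      from \<open>y\<close> as \<open>x\<close> is from \<open>y\<close> shifted back, which again
      lies in \<open>C\<close>. The shift \<open>?c\<close> represents \<open>-c\<close> modulo
      \<open>m\<close>.\<close>
    have OC: "d \<le> hdist L (add_word L m (\<lambda>_. c) x) y" if y: "y \<in> C" for c y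
    proof -
      let ?c = "m - c mod m"
      have z: "(?c + c) mod m = 0"
      proof -
        have "(?c + c) mod m = (?c + c mod m) mod m" by (simp add: mod_simps)
        also have "?c + c mod m = m" using m by (simp add: less_imp_le)
        finally show ?thesis by simp
      qed
      have yW: "y \<in> words L m" using C y by auto
      have "add_word L m (\<lambda>_. ?c) y \<in> C" using C y by (auto simp: shift_closed_def)
      from far[OF this] have "d \<le> hdist L x (add_word L m (\<lambda>_. ?c) y)" .
      also have "x = add_word L m (\<lambda>_. ?c) (add_word L m (\<lambda>_. c) x)"
        unfolding add_word_assoc by (rule add_word_zero[symmetric, OF x z])
      also have "hdist L (add_word L m (\<lambda>_. ?c) (add_word L m (\<lambda>_. c) x)) (add_word L m (\<lambda>_. ?c) y)
          = hdist L (add_word L m (\<lambda>_. c) x) y"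
        by (rule hdist_add_word[OF add_word_in_words[OF m] yW])
      finally show ?thesis .
    qed
    have "min_dist L d (C \<union> ?O)"
      unfolding min_dist_def
    proof (intro ballI impI)
      fix u v assume uv: "u \<in> C \<union> ?O" "v \<in> C \<union> ?O" "u \<noteq> v"
      then consider "u \<in> C" "v \<in> C" | "u \<in> C" "v \<in> ?O" | "u \<in> ?O" "v \<in> C" | "u \<in> ?O" "v \<in> ?O" by blast
      then show "d \<le> hdist L u v"
      proof cases
        case 1 then show ?thesis using C uv(3) by (auto simp: min_dist_def)
      next
        case 2 then show ?thesis using OC by (auto simp: hdist_commute[of L u])
      next
        case 3 then show ?thesis using OC by auto
      next
        case 4 then show ?thesis using OO uv(3) by auto
      qed
    qed
    moreover have "shift_closed L m (C \<union> ?O)"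
      using C unfolding shift_closed_def by (auto simp: add_word_assoc)
    moreover have "C \<union> ?O \<subseteq> words L m" using C add_word_in_words[OF m] by auto
    ultimately have "C = C \<union> ?O" by (intro max Un_upper1)
    then have xC: "x \<in> C" using xO by blast
    from far[OF this] show False using d by (simp add: hdist_def)
  qed
  have "m ^ L = card (words L m)" by (simp add: card_words)
  also have "\<dots> \<le> card (\<Union>y\<in>C. {x \<in> words L m. hdist L x y < d})"
    by (rule card_mono) (use cover C in \<open>auto intro: finite_subset\<close>)
  also have "\<dots> \<le> (\<Sum>y\<in>C. card {x \<in> words L m. hdist L x y < d})"
    by (rule card_UN_le) (use C finite_words in \<open>auto intro: finite_subset\<close>)
  also have "\<dots> \<le> (\<Sum>y\<in>C. 2 ^ L * m ^ d)"
    by (intro sum_mono card_hamming_ball m)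
  finally have "m ^ L \<le> card C * (2 ^ L * m ^ d)" by simp
  then show thesis using that C by auto
qed

lemma sum_shift_mod: "(\<Sum>c<m. g ((u + c) mod m)) = (\<Sum>a<m. g a)" if "0 < m" for u m :: nat
proof (rule sum.reindex_bij_betw)
  have "inj_on (\<lambda>c. (u + c) mod m) {..<m}"
    by (rule inj_onI) (simp add: add.commute[of u] add_mod_cancel)
  moreover have "(\<lambda>c. (u + c) mod m) ` {..<m} \<subseteq> {..<m}" using that by auto
  ultimately show "bij_betw (\<lambda>c. (u + c) mod m) {..<m} {..<m}"
    by (simp add: bij_betw_def endo_inj_surj)
qed

text \<open>This is why the concatenated code meets the power constraint without any concentration argument.\<close>

lemma sum_shift_closed_code:
  fixes g :: "nat \<Rightarrow> 'a :: comm_semiring_1"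
  assumes C: "C \<subseteq> words L m" "shift_closed L m C" and m: "0 < m" and l: "l < L"
  shows "of_nat m * (\<Sum>x\<in>C. g (x l)) = of_nat (card C) * (\<Sum>a<m. g a)"
proof -
  have fin: "finite C" by (rule finite_subset[OF C(1) finite_words])
  have perm: "(\<Sum>x\<in>C. g (add_word L m (\<lambda>_. c) x l)) = (\<Sum>x\<in>C. g (x l))" for c
  proof (rule sum.reindex_bij_betw[where g = "\<lambda>x. g (x l)"])
    have "inj_on (add_word L m (\<lambda>_. c)) C" by (rule inj_on_subset[OF inj_on_add_word C(1)])
    moreover have "add_word L m (\<lambda>_. c) ` C \<subseteq> C" using C(2) by (auto simp: shift_closed_def)
    ultimately show "bij_betw (add_word L m (\<lambda>_. c)) C C"
      using fin by (simp add: bij_betw_def endo_inj_surj)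
  qed
  \<comment> \<open>Averaging over all constant shifts: each shift permutes \<open>C\<close>, while
    for a fixed codeword the letter at position \<open>l\<close> runs through the whole alphabet.
    Hence every letter occurs equally often at each position.\<close>
  have "of_nat m * (\<Sum>x\<in>C. g (x l)) = (\<Sum>c<m. \<Sum>x\<in>C. g (add_word L m (\<lambda>_. c) x l))"
    by (simp add: perm)
  also have "\<dots> = (\<Sum>x\<in>C. \<Sum>c<m. g ((x l + c) mod m))"
    using l by (subst sum.swap) (simp add: add_word_nth)
  also have "\<dots> = of_nat (card C) * (\<Sum>a<m. g a)"
    by (simp add: sum_shift_mod[OF m])
  finally show ?thesis .
qed

lemma translate_code:
  assumes C: "C \<subseteq> words L m" "min_dist L d C" "shift_closed L m C" and m: "0 < m"
  shows "add_word L m s ` C \<subseteq> words L m" "min_dist L d (add_word L m s ` C)"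
    "shift_closed L m (add_word L m s ` C)" "card (add_word L m s ` C) = card C"
proof -
  have inj: "inj_on (add_word L m s) C" by (rule inj_on_subset[OF inj_on_add_word C(1)])
  show "add_word L m s ` C \<subseteq> words L m" using add_word_in_words[OF m] by auto
  show "card (add_word L m s ` C) = card C" by (rule card_image[OF inj])
  show "min_dist L d (add_word L m s ` C)"
    unfolding min_dist_def
  proof (intro ballI impI)
    fix u v assume "u \<in> add_word L m s ` C" "v \<in> add_word L m s ` C" "u \<noteq> v"
    then obtain x y where "x \<in> C" "y \<in> C" "x \<noteq> y" "u = add_word L m s x" "v = add_word L m s y" by auto
    then show "d \<le> hdist L u v" using C(1,2) by (auto simp: hdist_add_word subset_iff min_dist_def)
  qed
  \<comment> \<open>Translations commute, so moving the code does not destroy its invariance under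
    constant shifts.\<close>
  have "add_word L m (\<lambda>_. c) (add_word L m s x) = add_word L m s (add_word L m (\<lambda>_. c) x)" for c x
    unfolding add_word_assoc by (simp add: add.commute)
  then show "shift_closed L m (add_word L m s ` C)"
    using C(3) unfolding shift_closed_def by auto
qed

lemma sum_words_prod:
  fixes f :: "nat \<Rightarrow> nat \<Rightarrow> nat \<Rightarrow> real"
  shows "(\<Sum>u\<in>words L m1. \<Sum>v\<in>words L m2. \<Prod>l<L. f l (u l) (v l)) = (\<Prod>l<L. \<Sum>a<m1. \<Sum>b<m2. f l a b)"
proof -
  have "(\<Sum>v\<in>words L m2. \<Prod>l<L. f l (u l) (v l)) = (\<Prod>l<L. \<Sum>b<m2. f l (u l) b)" for u
    unfolding words_def by (rule prod_sum_PiE[symmetric]) auto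
  then have "(\<Sum>u\<in>words L m1. \<Sum>v\<in>words L m2. \<Prod>l<L. f l (u l) (v l))
      = (\<Sum>u\<in>words L m1. \<Prod>l<L. \<Sum>b<m2. f l (u l) b)" by simp
  also have "\<dots> = (\<Prod>l<L. \<Sum>a<m1. \<Sum>b<m2. f l a b)"
    unfolding words_def by (rule prod_sum_PiE[symmetric]) auto
  finally show ?thesis .
qed

section \<open>Error of the outer codes averaged over translates\<close>

text \<open>The \<open>k\<close>-th elementary symmetric polynomial in the numbers
  \<open>p (x l) (y l)\<close>: the union bound for the event that at least \<open>k\<close> of
  \<open>L\<close> independent blocks fail, block \<open>l\<close> failing with probability
  \<open>p (x l) (y l)\<close>.\<close>

definition fail_bound :: "nat \<Rightarrow> nat \<Rightarrow> (nat \<Rightarrow> nat \<Rightarrow> real) \<Rightarrow> (nat \<Rightarrow> nat) \<Rightarrow> (nat \<Rightarrow> nat) \<Rightarrow> real" where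
  "fail_bound L k p x y = (\<Sum>S\<in>{S. S \<subseteq> {..<L} \<and> card S = k}. \<Prod>l\<in>S. p (x l) (y l))"

text \<open>For uniform words the letter pairs at different positions are independent and uniform,
  so each of the at most \<open>2 ^ L\<close> sets of positions contributes at most
  \<open>e ^ k\<close> on average. Only the mean of \<open>p\<close> matters, not its
  maximum.\<close>

lemma sum_fail_bound:
  assumes p: "\<And>a b. 0 \<le> p a b" "(\<Sum>a<m1. \<Sum>b<m2. p a b) \<le> real m1 * real m2 * e"
    and e: "0 \<le> e" and k: "k \<le> L"
  shows "(\<Sum>u\<in>words L m1. \<Sum>v\<in>words L m2. fail_bound L k p u v) \<le> real (m1 ^ L) * real (m2 ^ L) * (2 ^ L * e ^ k)"
proof -
  let ?S = "{S. S \<subseteq> {..<L} \<and> card S = k}"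
  have finS: "finite ?S" by (rule finite_subset[of _ "Pow {..<L}"]) auto
  have cS: "card ?S \<le> 2 ^ L"
    using card_mono[of "Pow {..<L}" ?S] by (auto simp: card_Pow)
  have "(\<Sum>u\<in>words L m1. \<Sum>v\<in>words L m2. fail_bound L k p u v)
      = (\<Sum>S\<in>?S. \<Sum>u\<in>words L m1. \<Sum>v\<in>words L m2. \<Prod>l\<in>S. p (u l) (v l))"
    unfolding fail_bound_def by (subst (2) sum.swap, subst sum.swap) simp
  also have "\<dots> \<le> (\<Sum>S\<in>?S. real (m1 ^ L) * real (m2 ^ L) * e ^ k)"
  proof (rule sum_mono)
    fix S assume S: "S \<in> ?S"
    \<comment> \<open>Factors 1 outside \<open>S\<close> extend the product to all positions, so
      that the sum over words factorises.\<close>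
    let ?f = "\<lambda>l a b. if l \<in> S then p a b else 1"
    have "(\<Sum>u\<in>words L m1. \<Sum>v\<in>words L m2. \<Prod>l\<in>S. p (u l) (v l))
        = (\<Sum>u\<in>words L m1. \<Sum>v\<in>words L m2. \<Prod>l<L. ?f l (u l) (v l))"
      using S by (intro sum.cong refl) (auto simp: prod.If_cases Int_absorb1)
    also have "\<dots> = (\<Prod>l<L. \<Sum>a<m1. \<Sum>b<m2. ?f l a b)" by (rule sum_words_prod)
    also have "\<dots> \<le> (\<Prod>l<L. if l \<in> S then real m1 * real m2 * e else real m1 * real m2)"
      using p by (intro prod_mono) (auto intro!: sum_nonneg)
    also have "\<dots> = (real m1 * real m2 * e) ^ card S * (real m1 * real m2) ^ card ({..<L} - S)"
      using S by (simp add: prod.If_cases Int_absorb1 Diff_eq)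
    also have "card ({..<L} - S) = L - k" using S by (subst card_Diff_subset) (auto intro: finite_subset)
    also have "card S = k" using S by simp
    also have "(real m1 * real m2 * e) ^ k * (real m1 * real m2) ^ (L - k) = real (m1 ^ L) * real (m2 ^ L) * e ^ k"
      using k by (simp add: power_mult_distrib power_add[symmetric] flip: mult.assoc)
        (metis (no_types, lifting) le_add_diff_inverse mult.assoc mult.commute power_add)
    finally show "(\<Sum>u\<in>words L m1. \<Sum>v\<in>words L m2. \<Prod>l\<in>S. p (u l) (v l)) \<le> real (m1 ^ L) * real (m2 ^ L) * e ^ k" .
  qed
  also have "\<dots> = real (card ?S) * (real (m1 ^ L) * real (m2 ^ L) * e ^ k)" by simp
  also have "\<dots> \<le> 2 ^ L * (real (m1 ^ L) * real (m2 ^ L) * e ^ k)"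
    using cS e by (intro mult_right_mono) (simp_all flip: of_nat_power add: of_nat_le_iff)
  finally show ?thesis by (simp add: mult_ac)
qed

lemma sum_swap_pairs:
  "(\<Sum>s\<in>A. \<Sum>t\<in>B. \<Sum>x\<in>C. \<Sum>y\<in>D. f s t x y) = (\<Sum>x\<in>C. \<Sum>y\<in>D. \<Sum>s\<in>A. \<Sum>t\<in>B. f s t x y)"
proof -
  have "(\<Sum>s\<in>A. \<Sum>t\<in>B. \<Sum>x\<in>C. \<Sum>y\<in>D. f s t x y) = (\<Sum>s\<in>A. \<Sum>x\<in>C. \<Sum>t\<in>B. \<Sum>y\<in>D. f s t x y)"
    by (intro sum.cong refl sum.swap)
  also have "\<dots> = (\<Sum>x\<in>C. \<Sum>s\<in>A. \<Sum>t\<in>B. \<Sum>y\<in>D. f s t x y)" by (rule sum.swap)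
  also have "\<dots> = (\<Sum>x\<in>C. \<Sum>s\<in>A. \<Sum>y\<in>D. \<Sum>t\<in>B. f s t x y)" by (intro sum.cong refl sum.swap)
  also have "\<dots> = (\<Sum>x\<in>C. \<Sum>y\<in>D. \<Sum>s\<in>A. \<Sum>t\<in>B. f s t x y)" by (intro sum.cong refl sum.swap)
  finally show ?thesis .
qed

text \<open>Over independent random translates of two fixed codes, each pair of codewords is uniform on
  all pairs of words.\<close>

lemma exists_good_outer_codes:
  assumes m: "0 < m1" "0 < m2" and d: "0 < d" "d \<le> L" and k: "k \<le> L"
    and p: "\<And>a b. 0 \<le> p a b" "(\<Sum>a<m1. \<Sum>b<m2. p a b) \<le> real m1 * real m2 * e" and e: "0 \<le> e"
  obtains C1 C2 where
    "C1 \<subseteq> words L m1" "min_dist L d C1" "shift_closed L m1 C1" "m1 ^ L \<le> card C1 * (2 ^ L * m1 ^ d)"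
    "C2 \<subseteq> words L m2" "min_dist L d C2" "shift_closed L m2 C2" "m2 ^ L \<le> card C2 * (2 ^ L * m2 ^ d)"
    "(\<Sum>x\<in>C1. \<Sum>y\<in>C2. fail_bound L k p x y) \<le> real (card C1) * real (card C2) * (2 ^ L * e ^ k)"
proof -
  obtain D1 where D1: "D1 \<subseteq> words L m1" "min_dist L d D1" "shift_closed L m1 D1" "m1 ^ L \<le> card D1 * (2 ^ L * m1 ^ d)"
    using exists_shift_closed_code[OF m(1) d] by blast
  obtain D2 where D2: "D2 \<subseteq> words L m2" "min_dist L d D2" "shift_closed L m2 D2" "m2 ^ L \<le> card D2 * (2 ^ L * m2 ^ d)"
    using exists_shift_closed_code[OF m(2) d] by blast
  let ?G = "fail_bound L k p" and ?c = "real (card D1) * real (card D2) * (2 ^ L * e ^ k)"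
  let ?T = "\<lambda>s t. \<Sum>x\<in>D1. \<Sum>y\<in>D2. ?G (add_word L m1 s x) (add_word L m2 t y)"
  have bij: "bij_betw (\<lambda>s. add_word L m s x) (words L m) (words L m)" if "0 < m" for m x
    unfolding bij_betw_def
    by (intro conjI endo_inj_surj inj_on_add_word_left image_subsetI add_word_in_words[OF that] finite_words)
  have eq: "(\<Sum>s\<in>words L m1. \<Sum>t\<in>words L m2. ?G (add_word L m1 s x) (add_word L m2 t y))
      = (\<Sum>u\<in>words L m1. \<Sum>v\<in>words L m2. ?G u v)" for x y
  proof -
    have "(\<Sum>s\<in>words L m1. \<Sum>t\<in>words L m2. ?G (add_word L m1 s x) (add_word L m2 t y))
        = (\<Sum>s\<in>words L m1. \<Sum>v\<in>words L m2. ?G (add_word L m1 s x) v)"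
      by (intro sum.cong[OF refl] sum.reindex_bij_betw[OF bij[OF m(2)]])
    also have "\<dots> = (\<Sum>u\<in>words L m1. \<Sum>v\<in>words L m2. ?G u v)"
      by (rule sum.reindex_bij_betw[OF bij[OF m(1)], where g = "\<lambda>u. \<Sum>v\<in>words L m2. ?G u v"])
    finally show ?thesis .
  qed
  have "(\<Sum>s\<in>words L m1. \<Sum>t\<in>words L m2. ?T s t)
      = (\<Sum>x\<in>D1. \<Sum>y\<in>D2. \<Sum>s\<in>words L m1. \<Sum>t\<in>words L m2. ?G (add_word L m1 s x) (add_word L m2 t y))"
    by (rule sum_swap_pairs)
  also have "\<dots> = (\<Sum>x\<in>D1. \<Sum>y\<in>D2. \<Sum>u\<in>words L m1. \<Sum>v\<in>words L m2. ?G u v)"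
    by (simp only: eq)
  also have "\<dots> = real (card D1) * real (card D2) * (\<Sum>u\<in>words L m1. \<Sum>v\<in>words L m2. ?G u v)"
    by simp
  also have "\<dots> \<le> real (card D1) * real (card D2) * (real (m1 ^ L) * real (m2 ^ L) * (2 ^ L * e ^ k))"
    by (intro mult_left_mono sum_fail_bound[OF p e k]) auto
  also have "\<dots> = (\<Sum>s\<in>words L m1. \<Sum>t\<in>words L m2. ?c)"
    by (simp add: card_words)
  finally have le: "(\<Sum>s\<in>words L m1. \<Sum>t\<in>words L m2. ?T s t) \<le> (\<Sum>s\<in>words L m1. \<Sum>t\<in>words L m2. ?c)" .
  \<comment> \<open>Some pair of translates is at least as good as the average.\<close>
  have "\<exists>s\<in>words L m1. \<exists>t\<in>words L m2. ?T s t \<le> ?c"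
  proof (rule ccontr)
    assume "\<not> ?thesis"
    then have gt: "?c < ?T s t" if "s \<in> words L m1" "t \<in> words L m2" for s t using that by force
    have ne: "words L m1 \<noteq> {}" "words L m2 \<noteq> {}" using add_word_in_words m by blast+
    have "(\<Sum>s\<in>words L m1. \<Sum>t\<in>words L m2. ?c) < (\<Sum>s\<in>words L m1. \<Sum>t\<in>words L m2. ?T s t)"
      using ne gt by (intro sum_strict_mono) auto
    with le show False by simp
  qed
  then obtain s t where st: "?T s t \<le> ?c" by blast
  note T1 = translate_code[OF D1(1-3) m(1), of s] and T2 = translate_code[OF D2(1-3) m(2), of t]
  show thesis
  proof (rule that[OF T1(1-3) _ T2(1-3)])
    show "m1 ^ L \<le> card (add_word L m1 s ` D1) * (2 ^ L * m1 ^ d)" using T1(4) D1(4) by simp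
    show "m2 ^ L \<le> card (add_word L m2 t ` D2) * (2 ^ L * m2 ^ d)" using T2(4) D2(4) by simp
    have "(\<Sum>x\<in>add_word L m1 s ` D1. \<Sum>y\<in>add_word L m2 t ` D2. ?G x y) = ?T s t"
      using inj_on_subset[OF inj_on_add_word D1(1)] inj_on_subset[OF inj_on_add_word D2(1)]
      by (simp add: sum.reindex)
    then show "(\<Sum>x\<in>add_word L m1 s ` D1. \<Sum>y\<in>add_word L m2 t ` D2. ?G x y)
      \<le> real (card (add_word L m1 s ` D1)) * real (card (add_word L m2 t ` D2)) * (2 ^ L * e ^ k)"
      using st T1(4) T2(4) by simp
  qed
qed

section \<open>Concatenated codes\<close>

lemma indep_vars_PiM_components:
  assumes M: "\<And>i. i \<in> I \<Longrightarrow> prob_space (M i)" and I: "I \<noteq> {}"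
  shows "prob_space.indep_vars (PiM I M) M (\<lambda>i \<omega>. \<omega> i) I"
proof -
  interpret prob_space "PiM I M" by (rule prob_space_PiM[OF M])
  have "distr (PiM I M) (PiM I M) (\<lambda>\<omega>. \<lambda>i\<in>I. \<omega> i) = distr (PiM I M) (PiM I M) (\<lambda>\<omega>. \<omega>)"
    by (intro distr_cong refl) (auto simp: space_PiM)
  also have "\<dots> = PiM I M" by (rule distr_id)
  also have "\<dots> = PiM I (\<lambda>i. distr (PiM I M) (M i) (\<lambda>\<omega>. \<omega> i))"
  proof (rule PiM_cong[OF refl])
    fix i assume "i \<in> I"
    then show "M i = distr (PiM I M) (M i) (\<lambda>\<omega>. \<omega> i)"
      using distr_PiM_component[of I M i] M by metis
  qed
  finally show ?thesis
    by (subst indep_vars_iff_distr_eq_PiM'[OF I]) auto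
qed

definition block :: "nat \<Rightarrow> nat \<Rightarrow> (nat \<times> nat \<Rightarrow> real) \<Rightarrow> (nat \<times> nat \<Rightarrow> real)" where
  "block n0 l \<omega> = restrict (\<lambda>x. \<omega> (l * n0 + fst x, snd x)) ({..<n0} \<times> {..<3})"

lemma block_index_less: "l * n0 + s < L * n0" if "l < L" "s < n0" for l L s n0 :: nat
proof -
  have "l * n0 + s < Suc l * n0" using that by simp
  also have "\<dots> \<le> L * n0" using that by (intro mult_le_mono1) simp
  finally show ?thesis .
qed

lemma distr_block:
  assumes "l < L" "L * n0 \<le> n"
  shows "block n0 l \<in> noise_space n \<rightarrow>\<^sub>M noise_space n0"
    and "distr (noise_space n) (noise_space n0) (block n0 l) = noise_space n0"
proof -
  let ?f = "\<lambda>x :: nat \<times> nat. (l * n0 + fst x, snd x)"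
  have f: "inj_on ?f ({..<n0} \<times> {..<3})" "?f \<in> {..<n0} \<times> {..<3} \<rightarrow> {..<n} \<times> {..<3}"
    using less_le_trans[OF block_index_less[OF assms(1)] assms(2)] by (auto simp: inj_on_def)
  have "distr (PiM ({..<n} \<times> {..<3}) (\<lambda>_. density lborel std_normal_density))
     (PiM ({..<n0} \<times> {..<3}) (\<lambda>_. density lborel std_normal_density)) (\<lambda>\<omega>. \<lambda>x\<in>{..<n0} \<times> {..<3}. \<omega> (?f x))
     = PiM ({..<n0} \<times> {..<3}) (\<lambda>_. density lborel std_normal_density)"
    by (rule distr_PiM_reindex[OF _ f]) (simp add: prob_space_normal_density)
  then show "distr (noise_space n) (noise_space n0) (block n0 l) = noise_space n0"
    unfolding noise_space_def block_def[abs_def] by simp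
  show "block n0 l \<in> noise_space n \<rightarrow>\<^sub>M noise_space n0"
    unfolding noise_space_def block_def[abs_def]
    by (intro measurable_restrict measurable_component_singleton) (use f(2) in auto)
qed

text \<open>Different blocks read the disjoint coordinate sets \<open>?K l\<close> of a product
  measure, hence are independent; each has the law of the noise of a short code by
  \<open>distr_block\<close>.\<close>

lemma prob_blocks:
  assumes S: "S \<noteq> {}" "S \<subseteq> {..<L}" and n: "L * n0 \<le> n" "0 < n0"
    and A: "\<And>l. l \<in> S \<Longrightarrow> A l \<in> sets (noise_space n0)"
  shows "measure (noise_space n) (\<Inter>l\<in>S. block n0 l -` A l \<inter> space (noise_space n))
    = (\<Prod>l\<in>S. measure (noise_space n0) (A l))"
proof -
  interpret prob_space "noise_space n" by (rule prob_space_noise)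
  let ?D = "\<lambda>_::nat \<times> nat. density lborel std_normal_density"
  let ?K = "\<lambda>l. {l * n0..<l * n0 + n0} \<times> {..<3::nat}"
  have finS: "finite S" using S(2) finite_subset by auto
  have Kn: "?K l \<subseteq> {..<n} \<times> {..<3}" if "l \<in> S" for l
  proof -
    have "Suc l * n0 \<le> L * n0" using S(2) that by (intro mult_le_mono1) auto
    then show ?thesis using n by auto
  qed
  obtain l0 where "l0 \<in> S" using S(1) by blast
  then have "(l0 * n0, 0) \<in> {..<n} \<times> {..<3::nat}" using Kn[of l0] n(2) by (intro subsetD[OF Kn]) auto
  then have "{..<n} \<times> {..<3::nat} \<noteq> {}" by blast
  then have "indep_vars ?D (\<lambda>i \<omega>. \<omega> i) ({..<n} \<times> {..<3})"
    unfolding noise_space_def by (intro indep_vars_PiM_components) (simp_all add: prob_space_normal_density)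
  moreover have "disjoint_family_on ?K S"
    unfolding disjoint_family_on_def
  proof (intro ballI impI)
    fix l l' :: nat assume "l \<noteq> l'"
    have "a div n0 = l" if "a \<in> {l * n0..<l * n0 + n0}" for a l :: nat
      using that by (intro div_nat_eqI) (auto simp: algebra_simps)
    then have "{l * n0..<l * n0 + n0} \<inter> {l' * n0..<l' * n0 + n0} = {}" using \<open>l \<noteq> l'\<close> by blast
    then show "?K l \<inter> ?K l' = {}" by blast
  qed
  ultimately have "indep_vars (\<lambda>l. PiM (?K l) ?D) (\<lambda>l \<omega>. restrict (\<lambda>i. \<omega> i) (?K l)) S"
    using Kn by (intro indep_vars_restrict) auto
  then have "indep_vars (\<lambda>_. noise_space n0) (\<lambda>l \<omega>. block n0 l (restrict \<omega> (?K l))) S"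
  proof (rule indep_vars_compose2)
    show "block n0 l \<in> PiM (?K l) ?D \<rightarrow>\<^sub>M noise_space n0" for l
      unfolding noise_space_def block_def[abs_def]
      by (intro measurable_restrict measurable_component_singleton) auto
  qed
  moreover have "block n0 l (restrict \<omega> (?K l)) = block n0 l \<omega>" for l \<omega>
    by (auto simp: block_def restrict_def)
  ultimately have "indep_vars (\<lambda>_. noise_space n0) (block n0) S" by simp
  from indep_varsD[OF this S(1) finS order_refl A]
  have "prob (\<Inter>l\<in>S. block n0 l -` A l \<inter> space (noise_space n))
      = (\<Prod>l\<in>S. prob (block n0 l -` A l \<inter> space (noise_space n)))" .
  also have "\<dots> = (\<Prod>l\<in>S. measure (noise_space n0) (A l))"
  proof (rule prod.cong[OF refl])
    fix l assume l: "l \<in> S"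
    then have "l < L" using S(2) by auto
    note db = distr_block[OF this n(1)]
    show "prob (block n0 l -` A l \<inter> space (noise_space n)) = measure (noise_space n0) (A l)"
      using measure_distr[OF db(1) A[OF l]] unfolding db(2) by simp
  qed
  finally show ?thesis .
qed

section \<open>Concatenated encoders and their power\<close>

text \<open>\<open>c i l\<close> is letter \<open>l\<close> of the codeword of message
  \<open>i\<close>, used as inner message in block \<open>l\<close>. Feedback from earlier blocks is
  discarded: this is what makes the blocks independent uses of one memoryless channel with letter
  pairs as inputs.\<close>

definition concat_enc :: "encoder \<Rightarrow> nat \<Rightarrow> nat \<Rightarrow> (nat \<Rightarrow> nat \<Rightarrow> nat) \<Rightarrow> encoder" where
  "concat_enc psi n0 L c t i v = (if t < L * n0
     then psi (t mod n0) (c i (t div n0)) (restrict (\<lambda>s. v (t div n0 * n0 + s)) {..<t mod n0}) else 0)"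

lemma meas_concat_enc:
  assumes "meas_enc n0 psi" "0 < n0"
  shows "meas_enc n (concat_enc psi n0 L c)"
  unfolding meas_enc_def
proof (intro allI impI)
  fix t m
  have "(\<lambda>v. restrict (\<lambda>s. v (t div n0 * n0 + s)) {..<t mod n0})
      \<in> PiM {..<t} (\<lambda>_. borel) \<rightarrow>\<^sub>M PiM {..<t mod n0} (\<lambda>_. borel :: real measure)"
  proof (intro measurable_restrict measurable_component_singleton)
    fix s assume "s \<in> {..<t mod n0}"
    then show "t div n0 * n0 + s \<in> {..<t}" using div_mult_mod_eq[of t n0] unfolding lessThan_iff by linarith
  qed
  moreover have "psi (t mod n0) (c m (t div n0)) \<in> borel_measurable (PiM {..<t mod n0} (\<lambda>_. borel))"
    using assms by (simp add: meas_enc_def)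
  ultimately have [measurable]: "(\<lambda>v. psi (t mod n0) (c m (t div n0)) (restrict (\<lambda>s. v (t div n0 * n0 + s)) {..<t mod n0}))
      \<in> borel_measurable (PiM {..<t} (\<lambda>_. borel))"
    by (rule measurable_compose)
  show "concat_enc psi n0 L c t m \<in> borel_measurable (PiM {..<t} (\<lambda>_. borel))"
    unfolding concat_enc_def[abs_def] by measurable
qed

lemma W_block:
  assumes "s < n0"
  shows "W1n K (block n0 l \<omega>) s = W1n K \<omega> (l * n0 + s)" "W2n K (block n0 l \<omega>) s = W2n K \<omega> (l * n0 + s)"
    "Zn N (block n0 l \<omega>) s = Zn N \<omega> (l * n0 + s)"
  using assms by (simp_all add: W1n_def W2n_def Zn_def block_def)

lemma concat_channel:
  assumes "l < L" "s < n0"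
  shows "X1 (concat_enc p n0 L c1) (concat_enc q n0 L c2) N K i j \<omega> (l * n0 + s)
       = X1 p q N K (c1 i l) (c2 j l) (block n0 l \<omega>) s \<and>
     X2 (concat_enc p n0 L c1) (concat_enc q n0 L c2) N K i j \<omega> (l * n0 + s)
       = X2 p q N K (c1 i l) (c2 j l) (block n0 l \<omega>) s \<and>
     yout (concat_enc p n0 L c1) (concat_enc q n0 L c2) N K i j \<omega> (l * n0 + s)
       = yout p q N K (c1 i l) (c2 j l) (block n0 l \<omega>) s"
  using assms(2)
proof (induction s rule: less_induct)
  case (less s)
  have dm: "(l * n0 + s) div n0 = l" "(l * n0 + s) mod n0 = s" using less.prems by simp_all
  have lt: "l * n0 + s < L * n0" using block_index_less[OF assms(1) less.prems] .
  let ?y = "yout (concat_enc p n0 L c1) (concat_enc q n0 L c2) N K i j \<omega>"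
  have past: "restrict (\<lambda>s'. restrict (\<lambda>u. ?y u + w u) {..<l * n0 + s} (l * n0 + s')) {..<s}
      = restrict (\<lambda>s'. yout p q N K (c1 i l) (c2 j l) (block n0 l \<omega>) s' + w' s') {..<s}"
    if "\<And>s'. s' < s \<Longrightarrow> w (l * n0 + s') = w' s'" for w w'
    using less that by (auto simp: restrict_def)
  have 1: "X1 (concat_enc p n0 L c1) (concat_enc q n0 L c2) N K i j \<omega> (l * n0 + s)
       = X1 p q N K (c1 i l) (c2 j l) (block n0 l \<omega>) s"
    unfolding X1_eq unfolding concat_enc_def[of p n0 L c1 "l * n0 + s"] dm
    using lt less.prems by (subst past[where w' = "W1n K (block n0 l \<omega>)"]) (simp_all add: W_block)
  have 2: "X2 (concat_enc p n0 L c1) (concat_enc q n0 L c2) N K i j \<omega> (l * n0 + s)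
       = X2 p q N K (c1 i l) (c2 j l) (block n0 l \<omega>) s"
    unfolding X2_eq unfolding concat_enc_def[of q n0 L c2 "l * n0 + s"] dm
    using lt less.prems by (subst past[where w' = "W2n K (block n0 l \<omega>)"]) (simp_all add: W_block)
  show ?case using 1 2 unfolding yout_def by (simp add: W_block[OF less.prems])
qed

lemma concat_silent:
  assumes "L * n0 \<le> t"
  shows "X1 (concat_enc p n0 L c1) phi2 N K i j \<omega> t = 0"
    "X2 phi1 (concat_enc q n0 L c2) N K i j \<omega> t = 0"
  using assms by (simp_all add: X1_eq X2_eq concat_enc_def)

lemma sum_blocks:
  fixes f :: "nat \<Rightarrow> 'a :: comm_monoid_add"
  assumes n: "L * n0 \<le> n" and z: "\<And>t. L * n0 \<le> t \<Longrightarrow> f t = 0"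
  shows "(\<Sum>t<n. f t) = (\<Sum>l<L. \<Sum>s<n0. f (l * n0 + s))"
proof -
  have "(\<Sum>t<n. f t) = (\<Sum>t<L * n0. f t)"
    using n z by (intro sum.mono_neutral_right) auto
  also have "\<dots> = (\<Sum>l<L. sum f {l * n0..<l * n0 + n0})" by (rule sum.nat_group[symmetric])
  also have "\<dots> = (\<Sum>l<L. \<Sum>s<n0. f (l * n0 + s))"
  proof (rule sum.cong[OF refl])
    fix l
    have "sum f {0 + l * n0..<n0 + l * n0} = (\<Sum>s = 0..<n0. f (s + l * n0))"
      by (rule sum.shift_bounds_nat_ivl)
    then show "sum f {l * n0..<l * n0 + n0} = (\<Sum>s<n0. f (l * n0 + s))"
      by (simp add: add.commute atLeast0LessThan)
  qed
  finally show ?thesis .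
qed

text \<open>For independent uniform outer messages the letter pair at each position is uniform over
  the inner message pairs. The identity is cross-multiplied and stated over a semiring because it is
  applied to \<open>ennreal\<close> powers.\<close>

lemma sum_code_pairs:
  fixes g :: "nat \<Rightarrow> nat \<Rightarrow> 'a :: comm_semiring_1"
  assumes C1: "C1 \<subseteq> words L m1" "shift_closed L m1 C1" "0 < m1" "bij_betw c1 {..<M1} C1"
    and C2: "C2 \<subseteq> words L m2" "shift_closed L m2 C2" "0 < m2" "bij_betw c2 {..<M2} C2" and l: "l < L"
  shows "of_nat m1 * of_nat m2 * (\<Sum>i<M1. \<Sum>j<M2. g (c1 i l) (c2 j l))
    = of_nat M1 * of_nat M2 * (\<Sum>a<m1. \<Sum>b<m2. g a b)"
proof -
  have M: "card C1 = M1" "card C2 = M2" using bij_betw_same_card[OF C1(4)] bij_betw_same_card[OF C2(4)] by auto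
  have "(\<Sum>j<M2. g a (c2 j l)) = (\<Sum>y\<in>C2. g a (y l))" for a
    by (rule sum.reindex_bij_betw[OF C2(4), where g = "\<lambda>y. g a (y l)"])
  then have 2: "of_nat m2 * (\<Sum>j<M2. g a (c2 j l)) = of_nat M2 * (\<Sum>b<m2. g a b)" for a
    using sum_shift_closed_code[OF C2(1,2,3) l, of "g a"] M by simp
  let ?h = "\<lambda>a. \<Sum>b<m2. g a b"
  have "(\<Sum>i<M1. ?h (c1 i l)) = (\<Sum>x\<in>C1. ?h (x l))"
    by (rule sum.reindex_bij_betw[OF C1(4), where g = "\<lambda>x. ?h (x l)"])
  then have 1: "of_nat m1 * (\<Sum>i<M1. ?h (c1 i l)) = of_nat M1 * (\<Sum>a<m1. ?h a)"
    using sum_shift_closed_code[OF C1(1,2,3) l, of ?h] M by simp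
  have "of_nat m1 * of_nat m2 * (\<Sum>i<M1. \<Sum>j<M2. g (c1 i l) (c2 j l))
      = of_nat m1 * (\<Sum>i<M1. of_nat m2 * (\<Sum>j<M2. g (c1 i l) (c2 j l)))"
    by (simp add: sum_distrib_left mult.assoc)
  also have "\<dots> = of_nat M2 * (of_nat m1 * (\<Sum>i<M1. ?h (c1 i l)))"
    by (simp only: 2) (simp add: sum_distrib_left mult_ac)
  also have "\<dots> = of_nat M1 * of_nat M2 * (\<Sum>a<m1. ?h a)"
    unfolding 1 by (simp add: mult_ac)
  finally show ?thesis .
qed

text \<open>Each block spends exactly the average power of the inner code, since its inner messages
  are uniform. The second hypothesis on \<open>P\<close> is where the silent slots pay for an inner
  power above \<open>P'\<close>. \<open>X\<close> and \<open>Xi\<close> are abstract so that both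
  users are covered.\<close>

lemma concat_power:
  fixes X Xi :: "nat \<Rightarrow> nat \<Rightarrow> (nat \<times> nat \<Rightarrow> real) \<Rightarrow> nat \<Rightarrow> real"
  assumes C1: "C1 \<subseteq> words L m1" "shift_closed L m1 C1" "0 < m1" "bij_betw c1 {..<M1} C1"
    and C2: "C2 \<subseteq> words L m2" "shift_closed L m2 C2" "0 < m2" "bij_betw c2 {..<M2} C2"
    and n: "L * n0 \<le> n" and P: "0 \<le> P" "real (L * n0) * P \<le> real n * P'"
    and Xm: "\<And>a b s. s < n0 \<Longrightarrow> (\<lambda>\<omega>. Xi a b \<omega> s) \<in> borel_measurable (noise_space n0)"
    and X: "\<And>i j \<omega> l s. \<lbrakk>l < L; s < n0\<rbrakk> \<Longrightarrow> X i j \<omega> (l * n0 + s) = Xi (c1 i l) (c2 j l) (block n0 l \<omega>) s"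
    and X0: "\<And>i j \<omega> t. L * n0 \<le> t \<Longrightarrow> X i j \<omega> t = 0"
    and pow: "(\<Sum>s<n0. \<Sum>a<m1. \<Sum>b<m2. \<integral>\<^sup>+ \<omega>. ennreal ((Xi a b \<omega> s)\<^sup>2) \<partial>noise_space n0)
      \<le> ennreal (real n0 * real m1 * real m2 * P)"
  shows "(\<Sum>t<n. \<Sum>i<M1. \<Sum>j<M2. \<integral>\<^sup>+ \<omega>. ennreal ((X i j \<omega> t)\<^sup>2) \<partial>noise_space n)
      \<le> ennreal (real n * real M1 * real M2 * P')"
proof -
  let ?I = "\<lambda>s a b. \<integral>\<^sup>+ \<omega>. ennreal ((Xi a b \<omega> s)\<^sup>2) \<partial>noise_space n0"
  let ?T = "\<Sum>t<n. \<Sum>i<M1. \<Sum>j<M2. \<integral>\<^sup>+ \<omega>. ennreal ((X i j \<omega> t)\<^sup>2) \<partial>noise_space n"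
  have I: "(\<integral>\<^sup>+ \<omega>. ennreal ((X i j \<omega> (l * n0 + s))\<^sup>2) \<partial>noise_space n) = ?I s (c1 i l) (c2 j l)"
    if "l < L" "s < n0" for i j l s
  proof -
    note db = distr_block[OF that(1) n]
    have "?I s (c1 i l) (c2 j l) = (\<integral>\<^sup>+ \<omega>. ennreal ((Xi (c1 i l) (c2 j l) \<omega> s)\<^sup>2) \<partial>distr (noise_space n) (noise_space n0) (block n0 l))"
      unfolding db(2) ..
    also have "\<dots> = (\<integral>\<^sup>+ \<omega>. ennreal ((Xi (c1 i l) (c2 j l) (block n0 l \<omega>) s)\<^sup>2) \<partial>noise_space n)"
      using Xm[OF that(2)] by (intro nn_integral_distr db(1)) measurable
    finally show ?thesis by (simp add: X[OF that])
  qed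
  have "?T = (\<Sum>l<L. \<Sum>s<n0. \<Sum>i<M1. \<Sum>j<M2. \<integral>\<^sup>+ \<omega>. ennreal ((X i j \<omega> (l * n0 + s))\<^sup>2) \<partial>noise_space n)"
    by (rule sum_blocks[OF n]) (simp add: X0)
  also have "\<dots> = (\<Sum>l<L. \<Sum>s<n0. \<Sum>i<M1. \<Sum>j<M2. ?I s (c1 i l) (c2 j l))"
    by (intro sum.cong[OF refl]) (simp add: I)
  finally have "of_nat m1 * of_nat m2 * ?T =
      (\<Sum>l<L. \<Sum>s<n0. of_nat m1 * of_nat m2 * (\<Sum>i<M1. \<Sum>j<M2. ?I s (c1 i l) (c2 j l)))"
    by (simp add: sum_distrib_left)
  also have "\<dots> = (\<Sum>l<L. \<Sum>s<n0. of_nat M1 * of_nat M2 * (\<Sum>a<m1. \<Sum>b<m2. ?I s a b))"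
    by (intro sum.cong[OF refl] sum_code_pairs[OF C1 C2]) simp
  also have "\<dots> = of_nat L * of_nat M1 * of_nat M2 * (\<Sum>s<n0. \<Sum>a<m1. \<Sum>b<m2. ?I s a b)"
    by (simp add: sum_distrib_left mult.assoc)
  also have "\<dots> \<le> of_nat L * of_nat M1 * of_nat M2 * ennreal (real n0 * real m1 * real m2 * P)"
    by (intro mult_left_mono pow) simp
  also have "\<dots> = ennreal (real L * real M1 * real M2 * (real n0 * real m1 * real m2 * P))"
    using P(1) by (simp add: ennreal_of_nat_eq_real_of_nat ennreal_mult)
  also have "\<dots> \<le> ennreal (real m1 * real m2 * (real n * real M1 * real M2 * P'))"
  proof (rule ennreal_leI)
    have "real m1 * real m2 * real M1 * real M2 * (real (L * n0) * P) \<le> real m1 * real m2 * real M1 * real M2 * (real n * P')"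
      by (intro mult_left_mono P(2)) simp
    then show "real L * real M1 * real M2 * (real n0 * real m1 * real m2 * P) \<le> real m1 * real m2 * (real n * real M1 * real M2 * P')"
      by (simp add: mult_ac)
  qed
  also have "\<dots> = of_nat m1 * of_nat m2 * ennreal (real n * real M1 * real M2 * P')"
    by (simp add: ennreal_of_nat_eq_real_of_nat ennreal_mult' mult.assoc)
  finally have le: "of_nat m1 * of_nat m2 * ?T \<le> of_nat m1 * of_nat m2 * ennreal (real n * real M1 * real M2 * P')" .
  have "of_nat m1 * of_nat m2 = ennreal (real m1 * real m2)"
    by (simp add: ennreal_of_nat_eq_real_of_nat ennreal_mult)
  moreover have "ennreal (real m1 * real m2) \<noteq> 0" "ennreal (real m1 * real m2) \<noteq> \<top>"
    using C1(3) C2(3) by (auto simp: ennreal_eq_0_iff mult_le_0_iff)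
  ultimately show ?thesis using le ennreal_mult_le_mult_iff by metis
qed

section \<open>Bounded distance decoding and the concatenated code\<close>

text \<open>Despite the name no distance is minimised: any codeword at distance below
  \<open>k\<close> is taken, and the index is unspecified if there is none.\<close>

definition nearest :: "nat \<Rightarrow> nat \<Rightarrow> nat \<Rightarrow> (nat \<Rightarrow> nat \<Rightarrow> nat) \<Rightarrow> (nat \<Rightarrow> nat) \<Rightarrow> nat" where
  "nearest L k M c w = (SOME i. i < M \<and> hdist L w (c i) < k)"

lemma hdist_triangle: "hdist L x z \<le> hdist L x y + hdist L y z"
proof -
  have "hdist L x z \<le> card ({l. l < L \<and> x l \<noteq> y l} \<union> {l. l < L \<and> y l \<noteq> z l})"
    unfolding hdist_def by (intro card_mono) auto
  also have "\<dots> \<le> hdist L x y + hdist L y z" unfolding hdist_def by (rule card_Un_le)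
  finally show ?thesis .
qed

text \<open>Two codewords at distance at most \<open>k - 1\<close> from \<open>w\<close> would be at
  distance at most \<open>2 * k - 2\<close> from each other, one less than the minimum
  distance.\<close>

lemma nearest_eq:
  assumes C: "min_dist L (2 * k - 1) C" "bij_betw c {..<M} C" and i: "i < M" "hdist L w (c i) < k"
  shows "nearest L k M c w = i"
  unfolding nearest_def
proof (rule some_equality)
  show "i < M \<and> hdist L w (c i) < k" using i by simp
  fix i' assume i': "i' < M \<and> hdist L w (c i') < k"
  show "i' = i"
  proof (rule ccontr)
    assume "i' \<noteq> i"
    then have "c i' \<noteq> c i" using C(2) i i' by (auto simp: bij_betw_def inj_on_def)
    then have "2 * k - 1 \<le> hdist L (c i') (c i)"
      using C i i' by (auto simp: min_dist_def bij_betw_def)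
    also have "\<dots> \<le> hdist L (c i') w + hdist L w (c i)" by (rule hdist_triangle)
    finally show False using i(2) i'[THEN conjunct2] unfolding hdist_commute[of L "c i'"] by linarith
  qed
qed

text \<open>A finite list, so that measurability into the discrete space follows by induction on the
  number of blocks; whatever the outer decoders compute from it is then measurable.\<close>

definition block_decisions :: "((nat \<Rightarrow> real) \<Rightarrow> nat \<times> nat) \<Rightarrow> nat \<Rightarrow> nat \<Rightarrow> (nat \<Rightarrow> real) \<Rightarrow> (nat \<times> nat) list" where
  "block_decisions d n0 L y = map (\<lambda>l. d (restrict (\<lambda>s. y (l * n0 + s)) {..<n0})) [0..<L]"

lemma block_decisions_nth: "l < L \<Longrightarrow> block_decisions d n0 L y ! l = d (restrict (\<lambda>s. y (l * n0 + s)) {..<n0})"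
  by (simp add: block_decisions_def)

lemma measurable_block_decisions:
  assumes d: "d \<in> measurable (PiM {..<n0} (\<lambda>_. borel)) (count_space UNIV)" and n: "L * n0 \<le> n"
  shows "block_decisions d n0 L \<in> measurable (PiM {..<n} (\<lambda>_. borel)) (count_space UNIV)"
  using n
proof (induction L)
  case 0
  show ?case by (simp add: block_decisions_def[abs_def])
next
  case (Suc L)
  have "(\<lambda>y. restrict (\<lambda>s. y (L * n0 + s)) {..<n0}) \<in> PiM {..<n} (\<lambda>_. borel) \<rightarrow>\<^sub>M PiM {..<n0} (\<lambda>_. borel :: real measure)"
    by (intro measurable_restrict measurable_component_singleton) (use Suc.prems in auto)
  from measurable_compose[OF this d]
  have last: "(\<lambda>y. d (restrict (\<lambda>s. y (L * n0 + s)) {..<n0})) \<in> measurable (PiM {..<n} (\<lambda>_. borel)) (count_space UNIV)" .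
  \<comment> \<open>The appended decision has countably many possible values \<open>z\<close>, so it
    suffices to treat each fixed \<open>z\<close>.\<close>
  have "(\<lambda>y. (\<lambda>z. block_decisions d n0 L y @ [z]) (d (restrict (\<lambda>s. y (L * n0 + s)) {..<n0})))
      \<in> measurable (PiM {..<n} (\<lambda>_. borel)) (count_space UNIV)"
  proof (rule measurable_compose_countable[OF _ last])
    fix z
    show "(\<lambda>y. block_decisions d n0 L y @ [z]) \<in> measurable (PiM {..<n} (\<lambda>_. borel)) (count_space UNIV)"
      by (rule measurable_compose[OF Suc.IH]) (use Suc.prems in simp_all)
  qed
  then show ?case by (simp add: block_decisions_def[abs_def])
qed

definition concat_dec :: "((nat \<Rightarrow> real) \<Rightarrow> nat \<times> nat) \<Rightarrow> nat \<Rightarrow> nat \<Rightarrow> nat \<Rightarrow> nat \<Rightarrow> (nat \<Rightarrow> nat \<Rightarrow> nat)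
    \<Rightarrow> nat \<Rightarrow> (nat \<Rightarrow> nat \<Rightarrow> nat) \<Rightarrow> (nat \<Rightarrow> real) \<Rightarrow> nat \<times> nat" where
  "concat_dec d n0 L k M1 c1 M2 c2 y =
    (nearest L k M1 c1 (\<lambda>l. fst (block_decisions d n0 L y ! l)),
     nearest L k M2 c2 (\<lambda>l. snd (block_decisions d n0 L y ! l)))"

lemma measurable_concat_dec:
  assumes "d \<in> measurable (PiM {..<n0} (\<lambda>_. borel)) (count_space UNIV)" "L * n0 \<le> n"
  shows "concat_dec d n0 L k M1 c1 M2 c2 \<in> measurable (PiM {..<n} (\<lambda>_. borel)) (count_space UNIV)"
proof -
  have "(\<lambda>y. (\<lambda>ds. (nearest L k M1 c1 (\<lambda>l. fst (ds ! l)), nearest L k M2 c2 (\<lambda>l. snd (ds ! l)))) (block_decisions d n0 L y))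
      \<in> measurable (PiM {..<n} (\<lambda>_. borel)) (count_space UNIV)"
    by (rule measurable_compose[OF measurable_block_decisions[OF assms]]) simp
  then show ?thesis unfolding concat_dec_def[abs_def] .
qed

lemma concat_dec_correct:
  assumes C1: "min_dist L (2 * k - 1) C1" "bij_betw c1 {..<M1} C1"
    and C2: "min_dist L (2 * k - 1) C2" "bij_betw c2 {..<M2} C2"
    and ij: "i < M1" "j < M2"
    and few: "card {l. l < L \<and> d (restrict (\<lambda>s. y (l * n0 + s)) {..<n0}) \<noteq> (c1 i l, c2 j l)} < k"
  shows "concat_dec d n0 L k M1 c1 M2 c2 y = (i, j)"
proof -
  let ?B = "{l. l < L \<and> d (restrict (\<lambda>s. y (l * n0 + s)) {..<n0}) \<noteq> (c1 i l, c2 j l)}"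
  have "hdist L (\<lambda>l. fst (block_decisions d n0 L y ! l)) (c1 i) \<le> card ?B"
    unfolding hdist_def by (intro card_mono) (auto simp: block_decisions_nth)
  moreover have "hdist L (\<lambda>l. snd (block_decisions d n0 L y ! l)) (c2 j) \<le> card ?B"
    unfolding hdist_def by (intro card_mono) (auto simp: block_decisions_nth)
  ultimately show ?thesis
    using few nearest_eq[OF C1 ij(1)] nearest_eq[OF C2 ij(2)] by (auto simp: concat_dec_def)
qed

definition inner_err where
  "inner_err p q N K n0 d a b = measure (noise_space n0) {\<omega> \<in> space (noise_space n0).
     d (restrict (yout p q N K a b \<omega>) {..<n0}) \<noteq> (a, b)}"

text \<open>An outer error requires at least \<open>k\<close> wrong blocks, hence a set
  \<open>S\<close> of exactly \<open>k\<close> blocks that are all wrong. By independence such a set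
  has probability equal to a product of inner errors, and summing over \<open>S\<close> gives
  \<open>fail_bound\<close>.\<close>

lemma concat_error_le:
  assumes C1: "min_dist L (2 * k - 1) C1" "bij_betw c1 {..<M1} C1"
    and C2: "min_dist L (2 * k - 1) C2" "bij_betw c2 {..<M2} C2"
    and ij: "i < M1" "j < M2" and n: "L * n0 \<le> n" "0 < n0" and k: "0 < k"
    and meas: "meas_enc n0 p" "meas_enc n0 q"
    and d: "d \<in> measurable (PiM {..<n0} (\<lambda>_. borel)) (count_space UNIV)"
  shows "measure (noise_space n) {\<omega> \<in> space (noise_space n). concat_dec d n0 L k M1 c1 M2 c2
      (restrict (yout (concat_enc p n0 L c1) (concat_enc q n0 L c2) N K i j \<omega>) {..<n}) \<noteq> (i, j)}
    \<le> fail_bound L k (inner_err p q N K n0 d) (c1 i) (c2 j)"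
proof -
  interpret prob_space "noise_space n" by (rule prob_space_noise)
  let ?y = "\<lambda>\<omega>. restrict (yout (concat_enc p n0 L c1) (concat_enc q n0 L c2) N K i j \<omega>) {..<n}"
  let ?A = "\<lambda>a b. {\<omega> \<in> space (noise_space n0). d (restrict (yout p q N K a b \<omega>) {..<n0}) \<noteq> (a, b)}"
  let ?E = "\<lambda>l. block n0 l -` ?A (c1 i l) (c2 j l) \<inter> space (noise_space n)"
  let ?S = "{S. S \<subseteq> {..<L} \<and> card S = k}"
  have finS: "finite ?S" by (rule finite_subset[of _ "Pow {..<L}"]) auto
  have Am: "?A a b \<in> sets (noise_space n0)" for a b
    using measurable_sets[OF measurable_compose[OF output_measurable[OF meas order_refl] d], of "- {(a, b)}" N K a b]
    by (simp add: vimage_def Int_def conj_commute)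
  have yb: "restrict (\<lambda>s. ?y \<omega> (l * n0 + s)) {..<n0} = restrict (yout p q N K (c1 i l) (c2 j l) (block n0 l \<omega>)) {..<n0}"
    if l: "l < L" for l \<omega>
  proof (rule restrict_ext)
    fix s assume "s \<in> {..<n0}"
    then have s: "s < n0" by simp
    have "l * n0 + s < n" using block_index_less[OF l s] n(1) by linarith
    then show "?y \<omega> (l * n0 + s) = yout p q N K (c1 i l) (c2 j l) (block n0 l \<omega>) s"
      using concat_channel[OF l s] by simp
  qed
  have "{\<omega> \<in> space (noise_space n). concat_dec d n0 L k M1 c1 M2 c2 (?y \<omega>) \<noteq> (i, j)} \<subseteq> (\<Union>S\<in>?S. \<Inter>l\<in>S. ?E l)"
  proof
    fix \<omega> assume "\<omega> \<in> {\<omega> \<in> space (noise_space n). concat_dec d n0 L k M1 c1 M2 c2 (?y \<omega>) \<noteq> (i, j)}"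
    then have \<omega>: "\<omega> \<in> space (noise_space n)" and bad: "concat_dec d n0 L k M1 c1 M2 c2 (?y \<omega>) \<noteq> (i, j)" by auto
    let ?B = "{l. l < L \<and> d (restrict (\<lambda>s. ?y \<omega> (l * n0 + s)) {..<n0}) \<noteq> (c1 i l, c2 j l)}"
    have "k \<le> card ?B"
      using concat_dec_correct[OF C1 C2 ij, of d "?y \<omega>" n0] bad by (meson not_le)
    then obtain S where S: "S \<subseteq> ?B" "card S = k" by (meson obtain_subset_with_card_n)
    have "\<omega> \<in> ?E l" if "l \<in> S" for l
    proof -
      have l: "l < L" and "d (restrict (\<lambda>s. ?y \<omega> (l * n0 + s)) {..<n0}) \<noteq> (c1 i l, c2 j l)" using S that by auto
      then have "d (restrict (yout p q N K (c1 i l) (c2 j l) (block n0 l \<omega>)) {..<n0}) \<noteq> (c1 i l, c2 j l)"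
        unfolding yb[OF l] by simp
      moreover have "block n0 l \<omega> \<in> space (noise_space n0)"
        by (rule measurable_space[OF distr_block(1)[OF l n(1)] \<omega>])
      ultimately show ?thesis using \<omega> by simp
    qed
    moreover have "S \<in> ?S" using S by auto
    ultimately show "\<omega> \<in> (\<Union>S\<in>?S. \<Inter>l\<in>S. ?E l)" by blast
  qed
  moreover have Em: "?E l \<in> events" if "l < L" for l
    by (rule measurable_sets[OF distr_block(1)[OF that n(1)] Am])
  have SE: "(\<Inter>l\<in>S. ?E l) \<in> events" if "S \<in> ?S" for S
  proof (rule sets.finite_INT)
    \<comment> \<open>Positivity of \<open>k\<close> enters here: the intersection over an empty
      \<open>S\<close> would not be an event.\<close>
    show "finite S" "S \<noteq> {}" using that k by (auto intro: card_ge_0_finite)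
    show "?E l \<in> events" if "l \<in> S" for l using \<open>S \<in> ?S\<close> that by (intro Em) auto
  qed
  then have "(\<Union>S\<in>?S. \<Inter>l\<in>S. ?E l) \<in> events" using finS by (intro sets.finite_UN) auto
  ultimately have "prob {\<omega> \<in> space (noise_space n). concat_dec d n0 L k M1 c1 M2 c2 (?y \<omega>) \<noteq> (i, j)}
      \<le> prob (\<Union>S\<in>?S. \<Inter>l\<in>S. ?E l)" by (rule finite_measure_mono)
  also have "\<dots> \<le> (\<Sum>S\<in>?S. prob (\<Inter>l\<in>S. ?E l))"
    by (intro finite_measure_subadditive_finite image_subsetI SE finS)
  also have "\<dots> = (\<Sum>S\<in>?S. \<Prod>l\<in>S. inner_err p q N K n0 d (c1 i l) (c2 j l))"
  proof (rule sum.cong[OF refl])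
    fix S assume "S \<in> ?S"
    then have S: "S \<noteq> {}" "S \<subseteq> {..<L}" using k by auto
    show "prob (\<Inter>l\<in>S. ?E l) = (\<Prod>l\<in>S. inner_err p q N K n0 d (c1 i l) (c2 j l))"
      unfolding inner_err_def by (rule prob_blocks[OF S n]) (rule Am)
  qed
  finally show ?thesis unfolding fail_bound_def .
qed

text \<open>The outer codes are selected for the error probabilities of the given \<open>K\<close>.
  Minimum distance \<open>2 * k - 1\<close> corrects fewer than \<open>k\<close> wrong blocks; the
  last two conclusions are the Gilbert-Varshamov sizes.\<close>

theorem concatenation:
  assumes code: "is_code P1 P2 N K n0 m1 m2 p q d" and err: "err_prob N K n0 m1 m2 p q d \<le> e" and e: "0 \<le> e"
    and n: "L * n0 \<le> n" "0 < n0" and k: "0 < k" "2 * k - 1 \<le> L"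
    and P: "0 \<le> P1" "real (L * n0) * P1 \<le> real n * P1'" "0 \<le> P2" "real (L * n0) * P2 \<le> real n * P2'"
  obtains M1 M2 phi1 phi2 dec where "is_code P1' P2' N K n M1 M2 phi1 phi2 dec"
    "err_prob N K n M1 M2 phi1 phi2 dec \<le> 2 ^ L * e ^ k"
    "m1 ^ L \<le> M1 * (2 ^ L * m1 ^ (2 * k - 1))" "m2 ^ L \<le> M2 * (2 ^ L * m2 ^ (2 * k - 1))"
proof -
  from code have m: "0 < m1" "0 < m2" and meas: "meas_enc n0 p" "meas_enc n0 q"
    and d: "d \<in> measurable (PiM {..<n0} (\<lambda>_. borel)) (count_space UNIV)"
    and pw: "power1 p q N K n0 m1 m2 \<le> ennreal (real n0 * real m1 * real m2 * P1)"
      "power2 p q N K n0 m1 m2 \<le> ennreal (real n0 * real m1 * real m2 * P2)"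
    unfolding is_code_iff by auto
  let ?p = "inner_err p q N K n0 d"
  have p0: "0 \<le> ?p a b" for a b by (simp add: inner_err_def)
  have ps: "(\<Sum>a<m1. \<Sum>b<m2. ?p a b) \<le> real m1 * real m2 * e"
    using err m unfolding err_prob_eq inner_err_def by (simp add: field_simps)
  have kL: "0 < 2 * k - 1" "k \<le> L" using k by auto
  from exists_good_outer_codes[OF m kL(1) k(2) kL(2) p0 ps e] obtain C1 C2 where
    C1: "C1 \<subseteq> words L m1" "min_dist L (2 * k - 1) C1" "shift_closed L m1 C1" "m1 ^ L \<le> card C1 * (2 ^ L * m1 ^ (2 * k - 1))" and
    C2: "C2 \<subseteq> words L m2" "min_dist L (2 * k - 1) C2" "shift_closed L m2 C2" "m2 ^ L \<le> card C2 * (2 ^ L * m2 ^ (2 * k - 1))" and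
    fb: "(\<Sum>x\<in>C1. \<Sum>y\<in>C2. fail_bound L k ?p x y) \<le> real (card C1) * real (card C2) * (2 ^ L * e ^ k)" by blast
  have fin: "finite C1" "finite C2" using C1(1) C2(1) finite_words by (auto intro: finite_subset)
  from ex_bij_betw_nat_finite[OF fin(1)] obtain c1 where c1: "bij_betw c1 {..<card C1} C1" by (auto simp: atLeast0LessThan)
  from ex_bij_betw_nat_finite[OF fin(2)] obtain c2 where c2: "bij_betw c2 {..<card C2} C2" by (auto simp: atLeast0LessThan)
  let ?M1 = "card C1" and ?M2 = "card C2"
  have M: "0 < ?M1" "0 < ?M2"
    using C1(4) C2(4) m by (auto intro!: Nat.gr0I simp: not_le)
  let ?f1 = "concat_enc p n0 L c1" and ?f2 = "concat_enc q n0 L c2" and ?dec = "concat_dec d n0 L k ?M1 c1 ?M2 c2"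
  have "power1 ?f1 ?f2 N K n ?M1 ?M2 \<le> ennreal (real n * real ?M1 * real ?M2 * P1')"
    unfolding power1_def
    by (rule concat_power[OF C1(1,3) m(1) c1 C2(1,3) m(2) c2 n(1) P(1,2), where Xi = "X1 p q N K"])
      (use channel_measurable[OF meas] concat_channel concat_silent pw(1) in \<open>auto simp: power1_def\<close>)
  moreover have "power2 ?f1 ?f2 N K n ?M1 ?M2 \<le> ennreal (real n * real ?M1 * real ?M2 * P2')"
    unfolding power2_def
    by (rule concat_power[OF C1(1,3) m(1) c1 C2(1,3) m(2) c2 n(1) P(3,4), where Xi = "X2 p q N K"])
      (use channel_measurable[OF meas] concat_channel concat_silent pw(2) in \<open>auto simp: power2_def\<close>)
  ultimately have ic: "is_code P1' P2' N K n ?M1 ?M2 ?f1 ?f2 ?dec"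
    unfolding is_code_iff using M meas_concat_enc[OF meas(1) n(2)] meas_concat_enc[OF meas(2) n(2)]
      measurable_concat_dec[OF d n(1)] by blast
  have "(\<Sum>i<?M1. \<Sum>j<?M2. measure (noise_space n) {\<omega> \<in> space (noise_space n).
        ?dec (restrict (yout ?f1 ?f2 N K i j \<omega>) {..<n}) \<noteq> (i, j)})
      \<le> (\<Sum>i<?M1. \<Sum>j<?M2. fail_bound L k ?p (c1 i) (c2 j))"
    by (intro sum_mono concat_error_le[OF C1(2) c1 C2(2) c2 _ _ n k(1) meas d]) auto
  also have "\<dots> = (\<Sum>i<?M1. \<Sum>y\<in>C2. fail_bound L k ?p (c1 i) y)"
    by (intro sum.cong[OF refl] sum.reindex_bij_betw[OF c2])
  also have "\<dots> = (\<Sum>x\<in>C1. \<Sum>y\<in>C2. fail_bound L k ?p x y)"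
    by (rule sum.reindex_bij_betw[OF c1, where g = "\<lambda>x. \<Sum>y\<in>C2. fail_bound L k ?p x y"])
  also note fb
  finally have "err_prob N K n ?M1 ?M2 ?f1 ?f2 ?dec \<le> 2 ^ L * e ^ k"
    unfolding err_prob_eq using M by (simp add: field_simps)
  then show thesis using that ic C1(4) C2(4) by blast
qed

section \<open>Rates\<close>

lemma tendsto_div_over:
  fixes A D :: nat
  assumes "0 < D"
  shows "(\<lambda>n. real ((n * A) div D) / real n) \<longlonglongrightarrow> real A / real D"
proof (rule tendsto_sandwich)
  have eq: "real A / real D - 1 / real n = (real (n * A) / real D - 1) / real n" if "n > 0" for n
    using that assms by (simp add: field_simps)
  have "real A / real D - 1 / real n \<le> real ((n * A) div D) / real n" if "n > 0" for n
    unfolding eq[OF that]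
  proof (intro divide_right_mono)
    have "real (n * A) / real D - 1 \<le> of_int \<lfloor>real (n * A) / real D\<rfloor>" by linarith
    then show "real (n * A) / real D - 1 \<le> real ((n * A) div D)"
      by (simp only: floor_divide_of_nat_eq of_int_of_nat_eq)
  qed simp
  then show "\<forall>\<^sub>F n in sequentially. real A / real D - 1 / real n \<le> real ((n * A) div D) / real n"
    by (rule eventually_mono[OF eventually_gt_at_top[of 0]])
  have "real ((n * A) div D) / real n \<le> real A / real D" if "n > 0" for n
  proof -
    have "real ((n * A) div D) \<le> real (n * A) / real D" by (rule of_nat_div_le_of_nat)
    then show ?thesis using that assms by (simp add: field_simps)
  qed
  then show "\<forall>\<^sub>F n in sequentially. real ((n * A) div D) / real n \<le> real A / real D"
    by (rule eventually_mono[OF eventually_gt_at_top[of 0]])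
  show "(\<lambda>n. real A / real D - 1 / real n) \<longlonglongrightarrow> real A / real D"
    using tendsto_diff[OF tendsto_const lim_1_over_n] by simp
qed (rule tendsto_const)

lemma ln_code_size:
  fixes m M L d :: nat
  assumes "0 < m" "m ^ L \<le> M * (2 ^ L * m ^ d)" "d \<le> L"
  shows "(real L - real d) * ln (real m) - real L * ln 2 \<le> ln (real M)"
proof -
  have M: "0 < M" using assms by (intro Nat.gr0I) auto
  have "real (m ^ L) \<le> real (M * (2 ^ L * m ^ d))" using assms(2) by (simp only: of_nat_le_iff)
  then have "ln (real (m ^ L)) \<le> ln (real (M * (2 ^ L * m ^ d)))"
    using assms(1) M by (subst ln_le_cancel_iff) auto
  also have "\<dots> = ln (real M) + real L * ln 2 + real d * ln (real m)"
    using assms(1) M by (simp add: ln_mult ln_realpow)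
  finally show ?thesis using assms(1) by (simp add: ln_realpow algebra_simps)
qed

text \<open>The allowance \<epsilon> is spent in quarters: on the rate of the inner code, on the
  silent slots together with the outer distance, and on the factor \<open>2 ^ L\<close>. The
  remaining quarter makes the limit strictly larger than \<open>r - \<epsilon>\<close>. The absolute
  value of \<open>r\<close> covers negative rates.\<close>

lemma eventually_rate:
  fixes A n0 m :: nat and M :: "nat \<Rightarrow> nat" and r \<epsilon> :: real
  defines "L \<equiv> \<lambda>n. (n * A) div (n0 * (A + 1))"
  assumes A: "3 \<le> A" "3 * \<bar>r\<bar> / (A + 1) \<le> \<epsilon> / 4" and n0: "0 < n0" "ln 2 / n0 \<le> \<epsilon> / 4" and \<epsilon>: "0 < \<epsilon>"
    and m: "0 < m" "ln (real m) / n0 > r - \<epsilon> / 4"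
    and M: "\<And>n. 1 \<le> L n \<Longrightarrow> m ^ L n \<le> M n * (2 ^ L n * m ^ (2 * (L n div A + 1) - 1))"
    and L1: "\<forall>\<^sub>F n in sequentially. 1 \<le> L n"
    and d: "\<And>n. 1 \<le> L n \<Longrightarrow> 2 * (L n div A + 1) - 1 \<le> L n"
  shows "\<forall>\<^sub>F n in sequentially. ln (real (M n)) / real n > r - \<epsilon>"
proof -
  have lm: "0 \<le> ln (real m)" using m(1) by simp
  \<comment> \<open>Logarithmic size of the outer code per block, apart from a bounded term: the
    distance is at most \<open>2 * L / A + 1\<close>, and the extra 1 costs \<open>ln m\<close>
    once, which vanishes after division by \<open>n\<close>.\<close>
  define c where "c = (1 - 2 / real A) * ln (real m) - ln 2"
  \<comment> \<open>The share \<open>A / (A + 1)\<close> of slots in use times the outer rate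
    \<open>1 - 2 / A\<close>.\<close>
  define \<theta> where "\<theta> = (real A - 2) / (real A + 1)"
  have Apos: "0 < real A" using A(1) by simp
  have \<theta>: "0 \<le> \<theta>" "1 - \<theta> = 3 / (real A + 1)" using A(1) by (auto simp: \<theta>_def field_simps)
  have lim: "(\<lambda>n. real (L n) / real n * c - ln (real m) * (1 / real n)) \<longlonglongrightarrow> real A / real (n0 * (A + 1)) * c - ln (real m) * 0"
    unfolding L_def using n0(1) by (intro tendsto_intros tendsto_div_over lim_1_over_n) auto
  have "real A / real (n0 * (A + 1)) * c = \<theta> * (ln (real m) / n0) - real A / (real A + 1) * (ln 2 / n0)"
  proof -
    have "real A * c = (real A - 2) * ln (real m) - real A * ln 2"
      using Apos by (simp add: c_def field_simps)
    moreover have "real A / real (n0 * (A + 1)) * c = real A * c / (real n0 * (real A + 1))"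
      by (simp add: algebra_simps)
    ultimately show ?thesis
      unfolding \<theta>_def
      by (simp only: times_divide_times_eq diff_divide_distrib[symmetric] mult.commute[of "real A + 1" "real n0"])
  qed
  also have "\<dots> \<ge> \<theta> * (r - \<epsilon> / 4) - 1 * (ln 2 / n0)"
    using m(2) \<theta>(1) Apos by (intro diff_mono mult_left_mono mult_right_mono) (auto simp: field_simps)
  also have "\<theta> * (r - \<epsilon> / 4) = (r - \<epsilon> / 4) - 3 / (real A + 1) * (r - \<epsilon> / 4)"
    unfolding \<theta>(2)[symmetric] left_diff_distrib[of 1 \<theta>] by simp
  finally have 1: "real A / real (n0 * (A + 1)) * c \<ge> r - \<epsilon> / 4 - 3 / (real A + 1) * (r - \<epsilon> / 4) - ln 2 / n0" by simp
  have "3 / (real A + 1) * (r - \<epsilon> / 4) \<le> 3 / (real A + 1) * \<bar>r\<bar>"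
    using \<epsilon> by (intro mult_left_mono) auto
  also have "\<dots> \<le> \<epsilon> / 4" using A(2) by (simp add: add.commute)
  finally have "real A / real (n0 * (A + 1)) * c - ln (real m) * 0 > r - \<epsilon>" using 1 n0(2) \<epsilon> by linarith
  from order_tendstoD(1)[OF lim this]
  have "\<forall>\<^sub>F n in sequentially. r - \<epsilon> < real (L n) / real n * c - ln (real m) * (1 / real n)" .
  then show ?thesis
    using L1 eventually_gt_at_top[of 0]
  proof eventually_elim
    case (elim n)
    let ?d = "2 * (L n div A + 1) - 1"
    have "real ?d \<le> 2 * (real (L n) / real A) + 1"
      using of_nat_div_le_of_nat[of "L n" A, where 'a = real] by simp
    then have "(real (L n) - (2 * (real (L n) / real A) + 1)) * ln (real m) - real (L n) * ln 2
        \<le> (real (L n) - real ?d) * ln (real m) - real (L n) * ln 2"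
      using lm by (intro diff_mono mult_right_mono) auto
    also have "\<dots> \<le> ln (real (M n))"
      by (rule ln_code_size[OF m(1) M[OF elim(2)] d[OF elim(2)]])
    finally have "real (L n) * c - ln (real m) \<le> ln (real (M n))"
      by (simp add: c_def algebra_simps)
    then have "(real (L n) * c - ln (real m)) / real n \<le> ln (real (M n)) / real n"
      by (intro divide_right_mono) auto
    with elim(1) show ?case by (simp add: diff_divide_distrib)
  qed
qed

theorem noisy_feedback_approaches_perfect:
  assumes P: "0 < P1" "0 < P2" and R: "achievable P1 P2 N 0 R" and \<epsilon>: "0 < \<epsilon>"
  obtains s2 where "s2 > 0"
    "\<And>K. \<lbrakk>psd2 K; K$1$1 \<le> s2; K$2$2 \<le> s2\<rbrakk> \<Longrightarrow> achievable P1 P2 N K (fst R - \<epsilon>, snd R - \<epsilon>)"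
proof -
  \<comment> \<open>The first summand makes the relative loss \<open>3 / (A + 1)\<close> cost at
    most \<epsilon>/4 for both users; the 3 ensures that the outer distance fits into the
    length.\<close>
  obtain A :: nat where A: "12 * (\<bar>fst R\<bar> + \<bar>snd R\<bar>) / \<epsilon> + 3 \<le> real A" using real_arch_simple by blast
  have "0 \<le> 12 * (\<bar>fst R\<bar> + \<bar>snd R\<bar>) / \<epsilon>" using \<epsilon> by simp
  with A have A3: "3 \<le> A" by linarith
  have "12 * (\<bar>fst R\<bar> + \<bar>snd R\<bar>) / \<epsilon> \<le> real A + 1" using A by linarith
  then have "12 * (\<bar>fst R\<bar> + \<bar>snd R\<bar>) \<le> \<epsilon> * (real A + 1)" using \<epsilon> by (simp add: field_simps)
  then have AR: "3 * \<bar>fst R\<bar> / (A + 1) \<le> \<epsilon> / 4" "3 * \<bar>snd R\<bar> / (A + 1) \<le> \<epsilon> / 4"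
    by (simp_all add: field_simps)
  \<comment> \<open>The outer codes correct fewer than \<open>k = L div A + 1\<close> wrong blocks.
    As \<open>A * k\<close> is at least \<open>L\<close>, this choice gives \<open>e ^ k\<close> at
    most \<open>(1 / 4) ^ L\<close>, which beats the union bound factor
    \<open>2 ^ L\<close>.\<close>
  define e :: real where "e = (1 / 4) ^ A"
  have e0: "0 < e" by (simp add: e_def)
  from R \<epsilon> obtain m1 m2 phi1 phi2 dec where
    code: "\<forall>\<^sub>F n in sequentially. is_code P1 P2 N 0 n (m1 n) (m2 n) (phi1 n) (phi2 n) (dec n) \<and>
      ln (real (m1 n)) / real n > fst R - \<epsilon> / 4 \<and> ln (real (m2 n)) / real n > snd R - \<epsilon> / 4"
    and err: "(\<lambda>n. err_prob N 0 n (m1 n) (m2 n) (phi1 n) (phi2 n) (dec n)) \<longlonglongrightarrow> 0"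
    unfolding achievable_def by (meson divide_pos_pos zero_less_numeral)
  \<comment> \<open>A long inner block makes the Gilbert-Varshamov factor \<open>2 ^ L\<close>
    negligible for the rate.\<close>
  have "(\<lambda>n. ln 2 * (1 / real n)) \<longlonglongrightarrow> ln 2 * 0" by (intro tendsto_intros lim_1_over_n)
  then have "\<forall>\<^sub>F n in sequentially. ln 2 * (1 / real n) < \<epsilon> / 4" using \<epsilon> by (intro order_tendstoD(2)) auto
  with code order_tendstoD(2)[OF err e0] eventually_gt_at_top[of 0]
  have "\<forall>\<^sub>F n in sequentially. (is_code P1 P2 N 0 n (m1 n) (m2 n) (phi1 n) (phi2 n) (dec n) \<and>
      ln (real (m1 n)) / real n > fst R - \<epsilon> / 4 \<and> ln (real (m2 n)) / real n > snd R - \<epsilon> / 4) \<and>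
      err_prob N 0 n (m1 n) (m2 n) (phi1 n) (phi2 n) (dec n) < e \<and> 0 < n \<and> ln 2 / real n \<le> \<epsilon> / 4"
    by eventually_elim auto
  then obtain n0 where c0: "is_code P1 P2 N 0 n0 (m1 n0) (m2 n0) (phi1 n0) (phi2 n0) (dec n0)"
    and r0: "ln (real (m1 n0)) / real n0 > fst R - \<epsilon> / 4" "ln (real (m2 n0)) / real n0 > snd R - \<epsilon> / 4"
    and e1: "err_prob N 0 n0 (m1 n0) (m2 n0) (phi1 n0) (phi2 n0) (dec n0) < e"
    and n0: "0 < n0" "ln 2 / real n0 \<le> \<epsilon> / 4"
    unfolding eventually_sequentially by blast
  \<comment> \<open>The factor \<open>(A + 1) / A\<close> granted to the power of the inner code is
    the reciprocal of the largest share of slots in use; see \<open>L\<close> and \<open>LP\<close>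
    below.\<close>
  define \<eta> where "\<eta> = 1 + 1 / real A"
  have \<eta>: "P1 < P1 * \<eta>" "P2 < P2 * \<eta>" using P A3 by (auto simp: \<eta>_def)
  from robust_code[OF c0 e1 n0(1) P(1) \<eta>(1) P(2) \<eta>(2)] obtain s2 psi1 psi2 d where s2: "s2 > 0"
    and inner: "\<And>K. \<lbrakk>psd2 K; K$1$1 \<le> s2; K$2$2 \<le> s2\<rbrakk> \<Longrightarrow>
       is_code (P1 * \<eta>) (P2 * \<eta>) N K n0 (m1 n0) (m2 n0) psi1 psi2 d \<and> err_prob N K n0 (m1 n0) (m2 n0) psi1 psi2 d < e"
    by blast
  define L where "L n = (n * A) div (n0 * (A + 1))" for n
  have Lub: "L n * (n0 * (A + 1)) \<le> n * A" for n
    unfolding L_def by (rule div_times_less_eq_dividend)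
  have Ln: "L n * n0 \<le> n" for n
  proof -
    have "L n * n0 * A \<le> L n * (n0 * (A + 1))" by simp
    also note Lub[of n]
    finally show ?thesis using A3 by simp
  qed
  have LP: "real (L n * n0) * (P * \<eta>) \<le> real n * P" if "0 < P" for n P
  proof -
    have "real (L n * (n0 * (A + 1))) \<le> real (n * A)" using Lub[of n] by (simp only: of_nat_le_iff)
    then have "real (L n * n0) * \<eta> \<le> real n" using A3 by (simp add: \<eta>_def field_simps)
    from mult_right_mono[OF this, of P] show ?thesis using that by (simp add: mult_ac)
  qed
  have Lat: "filterlim L at_top sequentially"
    unfolding filterlim_at_top eventually_sequentially
  proof (intro allI exI impI)
    fix Z n :: nat assume n: "Z * (n0 * (A + 1)) \<le> n"
    have "Z = (Z * (n0 * (A + 1))) div (n0 * (A + 1))" using n0(1) by simp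
    also have "\<dots> \<le> (n * A) div (n0 * (A + 1))"
    proof (rule div_le_mono)
      have "n * 1 \<le> n * A" using A3 by (intro mult_le_mono2) simp
      then show "Z * (n0 * (A + 1)) \<le> n * A" using n by linarith
    qed
    finally show "Z \<le> L n" by (simp add: L_def)
  qed
  then have L1: "\<forall>\<^sub>F n in sequentially. 1 \<le> L n" unfolding filterlim_at_top by blast
  have dL: "2 * (L n div A + 1) - 1 \<le> L n" if "1 \<le> L n" for n
  proof -
    \<comment> \<open>The distance \<open>2 * (L div A) + 1\<close> must not exceed the length;
      \<open>A = 3\<close> is the critical case.\<close>
    have "L n div A \<le> L n div 3" by (rule div_le_mono2) (use A3 in auto)
    then have "2 * (L n div A) + 1 \<le> 2 * (L n div 3) + 1" by (simp only: add_le_cancel_right mult_le_mono2)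
    also have "\<dots> \<le> L n" using that by presburger
    finally show ?thesis by simp
  qed
  have small: "2 ^ L n * e ^ (L n div A + 1) \<le> (1 / 2) ^ L n" for n
  proof -
    have "L n \<le> A * (L n div A + 1)" using A3 dividend_less_div_times[of A "L n"] by (simp add: mult.commute)
    then have "(1 / 4 :: real) ^ (A * (L n div A + 1)) \<le> (1 / 4) ^ L n" by (intro power_decreasing) auto
    then have "2 ^ L n * e ^ (L n div A + 1) \<le> 2 ^ L n * (1 / 4) ^ L n"
      unfolding e_def power_mult[symmetric] by (intro mult_left_mono) auto
    also have "\<dots> = (1 / 2) ^ L n" by (simp add: power_mult_distrib[symmetric])
    finally show ?thesis .
  qed
  have "achievable P1 P2 N K (fst R - \<epsilon>, snd R - \<epsilon>)" if K: "psd2 K" "K$1$1 \<le> s2" "K$2$2 \<le> s2" for K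
  proof -
    note ic = inner[OF K, THEN conjunct1] and ie = less_imp_le[OF inner[OF K, THEN conjunct2]]
    have m: "0 < m1 n0" "0 < m2 n0" using ic by (auto simp: is_code_def)
    let ?Q = "\<lambda>n (M1, M2, f1, f2, dc). is_code P1 P2 N K n M1 M2 f1 f2 dc \<and>
        err_prob N K n M1 M2 f1 f2 dc \<le> 2 ^ L n * e ^ (L n div A + 1) \<and>
        m1 n0 ^ L n \<le> M1 * (2 ^ L n * m1 n0 ^ (2 * (L n div A + 1) - 1)) \<and>
        m2 n0 ^ L n \<le> M2 * (2 ^ L n * m2 n0 ^ (2 * (L n div A + 1) - 1))"
    \<comment> \<open>For small \<open>n\<close> there is no complete block and the choice is
      arbitrary; achievability concerns large \<open>n\<close> only.\<close>
    have "\<exists>x. 1 \<le> L n \<longrightarrow> ?Q n x" for n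
    proof (cases "1 \<le> L n")
      case True
      have k: "0 < L n div A + 1" by simp
      have Pp: "0 \<le> P1 * \<eta>" "0 \<le> P2 * \<eta>" using P \<eta> by linarith+
      show ?thesis
      proof (rule concatenation[OF ic ie less_imp_le[OF e0] Ln[of n] n0(1) k dL[OF True] Pp(1) LP[OF P(1)] Pp(2) LP[OF P(2)]])
        fix M1 M2 f1 f2 dc assume "is_code P1 P2 N K n M1 M2 f1 f2 dc"
          "err_prob N K n M1 M2 f1 f2 dc \<le> 2 ^ L n * e ^ (L n div A + 1)"
          "m1 n0 ^ L n \<le> M1 * (2 ^ L n * m1 n0 ^ (2 * (L n div A + 1) - 1))"
          "m2 n0 ^ L n \<le> M2 * (2 ^ L n * m2 n0 ^ (2 * (L n div A + 1) - 1))"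
        then show ?thesis by (intro exI[of _ "(M1, M2, f1, f2, dc)"]) simp
      qed
    qed blast
    from choice[OF allI[OF this]] obtain x where x: "\<forall>n. 1 \<le> L n \<longrightarrow> ?Q n (x n)" ..
    define M1 where "M1 n = fst (x n)" for n
    define M2 where "M2 n = fst (snd (x n))" for n
    define f1 where "f1 n = fst (snd (snd (x n)))" for n
    define f2 where "f2 n = fst (snd (snd (snd (x n))))" for n
    define dc where "dc n = snd (snd (snd (snd (x n))))" for n
    have xe: "x n = (M1 n, M2 n, f1 n, f2 n, dc n)" for n
      by (simp add: M1_def M2_def f1_def f2_def dc_def)
    have Q: "is_code P1 P2 N K n (M1 n) (M2 n) (f1 n) (f2 n) (dc n)"
        "err_prob N K n (M1 n) (M2 n) (f1 n) (f2 n) (dc n) \<le> 2 ^ L n * e ^ (L n div A + 1)"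
        "m1 n0 ^ L n \<le> M1 n * (2 ^ L n * m1 n0 ^ (2 * (L n div A + 1) - 1))"
        "m2 n0 ^ L n \<le> M2 n * (2 ^ L n * m2 n0 ^ (2 * (L n div A + 1) - 1))" if "1 \<le> L n" for n
      using x that by (simp_all add: xe)
    have rate1: "\<forall>\<^sub>F n in sequentially. ln (real (M1 n)) / real n > fst R - \<epsilon>"
      by (rule eventually_rate[OF A3 AR(1) n0 \<epsilon> m(1) r0(1)])
        (use Q(3) L1 dL in \<open>simp_all only: L_def\<close>)
    have rate2: "\<forall>\<^sub>F n in sequentially. ln (real (M2 n)) / real n > snd R - \<epsilon>"
      by (rule eventually_rate[OF A3 AR(2) n0 \<epsilon> m(2) r0(2)])
        (use Q(4) L1 dL in \<open>simp_all only: L_def\<close>)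
    have err0: "(\<lambda>n. err_prob N K n (M1 n) (M2 n) (f1 n) (f2 n) (dc n)) \<longlonglongrightarrow> 0"
    proof (rule tendsto_sandwich[OF _ _ tendsto_const])
      show "\<forall>\<^sub>F n in sequentially. 0 \<le> err_prob N K n (M1 n) (M2 n) (f1 n) (f2 n) (dc n)"
        by (simp add: err_prob_def sum_nonneg)
      show "\<forall>\<^sub>F n in sequentially. err_prob N K n (M1 n) (M2 n) (f1 n) (f2 n) (dc n) \<le> (1 / 2) ^ L n"
        using L1 by eventually_elim (use Q(2) small order_trans in blast)
      show "(\<lambda>n. (1 / 2 :: real) ^ L n) \<longlonglongrightarrow> 0"
        by (rule filterlim_compose[OF LIMSEQ_power_zero Lat]) simp
    qed
    show ?thesis
      unfolding achievable_def
    proof (intro allI impI)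
      fix \<delta> :: real assume \<delta>: "0 < \<delta>"
      have "\<forall>\<^sub>F n in sequentially. is_code P1 P2 N K n (M1 n) (M2 n) (f1 n) (f2 n) (dc n) \<and>
         ln (real (M1 n)) / real n > fst (fst R - \<epsilon>, snd R - \<epsilon>) - \<delta> \<and>
         ln (real (M2 n)) / real n > snd (fst R - \<epsilon>, snd R - \<epsilon>) - \<delta>"
        using L1 rate1 rate2 by eventually_elim (use Q(1) \<delta> in auto)
      with err0 show "\<exists>m1 m2 phi1 phi2 dec. (\<forall>\<^sub>F n in sequentially.
           is_code P1 P2 N K n (m1 n) (m2 n) (phi1 n) (phi2 n) (dec n) \<and>
           ln (real (m1 n)) / real n > fst (fst R - \<epsilon>, snd R - \<epsilon>) - \<delta> \<and>
           ln (real (m2 n)) / real n > snd (fst R - \<epsilon>, snd R - \<epsilon>) - \<delta>) \<and>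
        (\<lambda>n. err_prob N K n (m1 n) (m2 n) (phi1 n) (phi2 n) (dec n)) \<longlonglongrightarrow> 0"
        by blast
    qed
  qed
  then show thesis using that s2 by blast
qed

theorem mainTheorem5:
  fixes P1 P2 N :: real
  assumes "P1 > 0" and "P2 > 0" and "N > 0"
  shows "closure (\<Union>s2\<in>{0<..}. \<Inter>{C_NoisyFB P1 P2 N K | K. psd2 K \<and> K$1$1 \<le> s2 \<and> K$2$2 \<le> s2})
           = C_PerfectFB P1 P2 N"
proof
  let ?U = "\<Union>s2\<in>{0<..}. \<Inter>{C_NoisyFB P1 P2 N K | K. psd2 K \<and> K$1$1 \<le> s2 \<and> K$2$2 \<le> s2}"
  \<comment> \<open>Zero covariance is admissible for every threshold, so each intersection lies in
    the region for perfect feedback, and closedness handles the closure.\<close>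
  have "psd2 0" by (simp add: psd2_def transpose_def vec_eq_iff)
  then have "\<Inter>{C_NoisyFB P1 P2 N K | K. psd2 K \<and> K$1$1 \<le> s2 \<and> K$2$2 \<le> s2} \<subseteq> C_NoisyFB P1 P2 N 0"
    if "s2 > 0" for s2
    using that by (intro Inter_lower) (auto intro!: exI[of _ 0])
  then have "?U \<subseteq> C_PerfectFB P1 P2 N" unfolding C_PerfectFB_def by (intro UN_least) auto
  then show "closure ?U \<subseteq> C_PerfectFB P1 P2 N"
    unfolding C_PerfectFB_def by (rule closure_minimal[OF _ closed_C_NoisyFB])
  show "C_PerfectFB P1 P2 N \<subseteq> closure ?U"
  proof
    fix R assume "R \<in> C_PerfectFB P1 P2 N"
    then have R: "achievable P1 P2 N 0 R" by (simp add: C_PerfectFB_def C_NoisyFB_def)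
    show "R \<in> closure ?U"
      unfolding closure_approachable
    proof (intro allI impI)
      fix r :: real assume r: "0 < r"
      \<comment> \<open>Lowering both rates by \<open>r / 3\<close> moves the point by at most
        \<open>2 * r / 3\<close>, which is less than \<open>r\<close>.\<close>
      then have "0 < r / 3" by simp
      from noisy_feedback_approaches_perfect[OF assms(1,2) R this] obtain s2 where s2: "s2 > 0"
        "\<And>K. \<lbrakk>psd2 K; K$1$1 \<le> s2; K$2$2 \<le> s2\<rbrakk> \<Longrightarrow> achievable P1 P2 N K (fst R - r / 3, snd R - r / 3)"
        by blast
      let ?R = "(fst R - r / 3, snd R - r / 3)"
      have "?R \<in> ?U" using s2 by (intro UN_I[of s2]) (auto simp: C_NoisyFB_def)
      moreover have "dist ?R R < r"
      proof -
        have "dist ?R R = sqrt ((r / 3)\<^sup>2 + (r / 3)\<^sup>2)"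
          using r by (cases R) (simp add: dist_Pair_Pair dist_real_def)
        also have "\<dots> \<le> r / 3 + r / 3" using r by (intro sqrt_sum_squares_le_sum) auto
        also have "\<dots> < r" using r by simp
        finally show ?thesis .
      qed
      ultimately show "\<exists>y\<in>?U. dist y R < r" by blast
    qed
  qed
qed

end
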